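(* Let $\mathcal{M}$ be a type $\mathrm{II}_\infty$ factor and $|||\cdot|||$ be a unitarily invariant norm on $\mathcal{J}(\mathcal{M})$. There is a natural continuous injective map $\Phi$ from $\overline{\mathcal{J}(\mathcal{M})_{|||\cdot|||}}$ to $\widetilde{\mathcal{M}}$ that extends the identity map from $\mathcal{J}(\mathcal{M})$ to $\mathcal{J}(\mathcal{M})$.
   Context: $\tau$ is a faithful normal semifinite tracial weight on $\mathcal{M}$. $\mathcal{J}(\mathcal{M})$ is the set of $T\in\mathcal{M}$ with $T=ETE$ for some finite projection $E\in\mathcal{M}$. A norm on $\mathcal{J}(\mathcal{M})$ is unitarily invariant if $|||UTV|||=|||T|||$ for all $T\in\mathcal{J}(\mathcal{M})$ and unitaries $U,V\in\mathcal{M}$. $\overline{\mathcal{J}(\mathcal{M})_{|||\cdot|||}}$ is the completion of $\mathcal{J}(\mathcal{M})$ with respect to $|||\cdot|||$. $\widetilde{\mathcal{M}}$ is the completion of $\mathcal{M}$ in the measure topology (Nelson), whose basic neighborhoods of $0$ are $N(\epsilon,\delta)=\{T\in\mathcal{M}:\ \text{there is a projection }E\in\mathcal{M}\text{ with }\tau(E)<\delta\text{ and }\|TE^\perp\|<\epsilon\}$, $\epsilon,\delta>0$. "Natural" means that $\Phi$ sends the class of a $|||\cdot|||$-Cauchy sequence in $\mathcal{J}(\mathcal{M})$ to its limit in the measure topology. *)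

theory Defs
  imports "HOL-Analysis.Analysis"
begin

section \<open>Operators on complex Hilbert spaces\<close>

text \<open>
  The inner product is linear in the first argument. Positivity and definiteness are contained
  in \<open>cinner_self\<close>; completeness comes from \<^class>\<open>banach\<close>.
\<close>

class complex_hilbert_space = banach +
  fixes scaleC :: "complex \<Rightarrow> 'a \<Rightarrow> 'a"
    and cinner :: "'a \<Rightarrow> 'a \<Rightarrow> complex"
  assumes scaleC_add_right: "scaleC a (x + y) = scaleC a x + scaleC a y"
    and scaleC_add_left: "scaleC (a + b) x = scaleC a x + scaleC b x"
    and scaleC_scaleC: "scaleC a (scaleC b x) = scaleC (a * b) x"
    and scaleC_of_real: "scaleC (complex_of_real r) x = scaleR r x"
    and cinner_commute: "cinner x y = cnj (cinner y x)"
    and cinner_add_left: "cinner (x + y) z = cinner x z + cinner y z"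
    and cinner_scaleC_left: "cinner (scaleC a x) y = a * cinner x y"
    and cinner_self: "cinner x x = complex_of_real ((norm x)\<^sup>2)"

lemma norm_scaleC: "norm (scaleC a x) = cmod a * norm x"
  for x :: "'h::complex_hilbert_space"
proof -
  have "cinner (scaleC a x) (scaleC a x) = a * cnj (a * cinner x x)"
    by (metis cinner_commute cinner_scaleC_left)
  also have "\<dots> = complex_of_real ((cmod a * norm x)\<^sup>2)"
    using complex_norm_square[of a]
    by (simp add: cinner_self power_mult_distrib flip: mult.assoc)
  finally have "(norm (scaleC a x))\<^sup>2 = (cmod a * norm x)\<^sup>2"
    using cinner_self[of "scaleC a x"] of_real_eq_iff by metis
  then show ?thesis
    by (simp add: power2_eq_iff_nonneg)
qed

lemma bounded_linear_scaleC:
  "bounded_linear (scaleC a :: 'h::complex_hilbert_space \<Rightarrow> 'h)"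
proof (rule bounded_linear_intro[where K = "cmod a"])
  fix x y :: 'h and r :: real
  show "scaleC a (x + y) = scaleC a x + scaleC a y"
    by (rule scaleC_add_right)
  show "scaleC a (r *\<^sub>R x) = r *\<^sub>R scaleC a x"
    by (metis mult.commute scaleC_of_real scaleC_scaleC)
  show "norm (scaleC a x) \<le> norm x * cmod a"
    by (simp add: norm_scaleC)
qed

text \<open>
  \<open>'h op\<close> is the space of bounded \<^emph>\<open>real\<close>-linear operators with the operator norm; the algebra
  B(H) is the subset \<open>complex_operators\<close> of it.
\<close>

type_synonym 'h op = "'h \<Rightarrow>\<^sub>L 'h"

definition complex_operators :: "('h::complex_hilbert_space) op set" where
  "complex_operators = {T. \<forall>a x. blinfun_apply T (scaleC a x) = scaleC a (blinfun_apply T x)}"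

lift_definition scalar_op :: "complex \<Rightarrow> ('h::complex_hilbert_space) op" is scaleC
  by (rule bounded_linear_scaleC)

definition adj_op :: "('h::complex_hilbert_space) op \<Rightarrow> 'h op" where
  "adj_op T = (THE S. \<forall>x y. cinner (blinfun_apply T x) y = cinner x (blinfun_apply S y))"

definition positive_op :: "('h::complex_hilbert_space) op \<Rightarrow> bool" where
  "positive_op T \<longleftrightarrow> T \<in> complex_operators \<and>
     (\<forall>x. Im (cinner (blinfun_apply T x) x) = 0 \<and> 0 \<le> Re (cinner (blinfun_apply T x) x))"

definition le_op :: "('h::complex_hilbert_space) op \<Rightarrow> 'h op \<Rightarrow> bool" where
  "le_op S T \<longleftrightarrow> positive_op (T - S)"


section \<open>Von Neumann algebras and factors\<close>

definition commutant :: "('h::complex_hilbert_space) op set \<Rightarrow> 'h op set" where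
  "commutant A = {T \<in> complex_operators. \<forall>S\<in>A. T o\<^sub>L S = S o\<^sub>L T}"

definition von_neumann_algebra :: "('h::complex_hilbert_space) op set \<Rightarrow> bool" where
  "von_neumann_algebra M \<longleftrightarrow>
     M \<subseteq> complex_operators \<and> (\<forall>T\<in>M. adj_op T \<in> M) \<and> commutant (commutant M) = M"

definition factor :: "('h::complex_hilbert_space) op set \<Rightarrow> bool" where
  "factor M \<longleftrightarrow> von_neumann_algebra M \<and> M \<inter> commutant M = range scalar_op"

definition projections :: "('h::complex_hilbert_space) op set \<Rightarrow> 'h op set" where
  "projections M = {E \<in> M. E o\<^sub>L E = E \<and> adj_op E = E}"

definition unitaries :: "('h::complex_hilbert_space) op set \<Rightarrow> 'h op set" where
  "unitaries M = {U \<in> M. adj_op U o\<^sub>L U = id_blinfun \<and> U o\<^sub>L adj_op U = id_blinfun}"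

definition equivalent_projections ::
    "('h::complex_hilbert_space) op set \<Rightarrow> 'h op \<Rightarrow> 'h op \<Rightarrow> bool" where
  "equivalent_projections M E F \<longleftrightarrow> (\<exists>V\<in>M. adj_op V o\<^sub>L V = E \<and> V o\<^sub>L adj_op V = F)"

definition finite_projections :: "('h::complex_hilbert_space) op set \<Rightarrow> 'h op set" where
  "finite_projections M =
     {E \<in> projections M. \<forall>F\<in>projections M. le_op F E \<and> equivalent_projections M E F \<longrightarrow> F = E}"

definition abelian_projections :: "('h::complex_hilbert_space) op set \<Rightarrow> 'h op set" where
  "abelian_projections M = {E \<in> projections M. \<forall>S\<in>M. \<forall>T\<in>M.
     (E o\<^sub>L S o\<^sub>L E) o\<^sub>L (E o\<^sub>L T o\<^sub>L E) = (E o\<^sub>L T o\<^sub>L E) o\<^sub>L (E o\<^sub>L S o\<^sub>L E)}"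

text \<open>
  In a factor every nonzero projection has central carrier \<open>I\<close>, and an infinite \<open>I\<close> is properly
  infinite, so the usual conditions for type \<open>II\<^sub>\<infinity>\<close> take the following form.
\<close>

definition type_II_infinity_factor :: "('h::complex_hilbert_space) op set \<Rightarrow> bool" where
  "type_II_infinity_factor M \<longleftrightarrow> factor M \<and>
     abelian_projections M = {0} \<and>
     (\<exists>E\<in>finite_projections M. E \<noteq> 0) \<and>
     id_blinfun \<notin> finite_projections M"


section \<open>Traces and unitarily invariant norms\<close>

definition positive_part :: "('h::complex_hilbert_space) op set \<Rightarrow> 'h op set" where
  "positive_part M = {T \<in> M. positive_op T}"

text \<open>Only the values of \<open>\<tau>\<close> on the positive part of \<open>M\<close> are meaningful.\<close>

definition tracial_weight ::
    "('h::complex_hilbert_space) op set \<Rightarrow> ('h op \<Rightarrow> ennreal) \<Rightarrow> bool" where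
  "tracial_weight M \<tau> \<longleftrightarrow>
     (\<forall>S\<in>positive_part M. \<forall>T\<in>positive_part M. \<tau> (S + T) = \<tau> S + \<tau> T) \<and>
     (\<forall>r\<ge>0. \<forall>T\<in>positive_part M. \<tau> (r *\<^sub>R T) = ennreal r * \<tau> T) \<and>
     (\<forall>T\<in>M. \<tau> (adj_op T o\<^sub>L T) = \<tau> (T o\<^sub>L adj_op T))"

definition faithful_weight ::
    "('h::complex_hilbert_space) op set \<Rightarrow> ('h op \<Rightarrow> ennreal) \<Rightarrow> bool" where
  "faithful_weight M \<tau> \<longleftrightarrow> (\<forall>T\<in>positive_part M. \<tau> T = 0 \<longrightarrow> T = 0)"

definition is_lub_op ::
    "('h::complex_hilbert_space) op set \<Rightarrow> 'h op set \<Rightarrow> 'h op \<Rightarrow> bool" where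
  "is_lub_op M D T \<longleftrightarrow> T \<in> positive_part M \<and> (\<forall>S\<in>D. le_op S T) \<and>
     (\<forall>R\<in>positive_part M. (\<forall>S\<in>D. le_op S R) \<longrightarrow> le_op T R)"

definition normal_weight ::
    "('h::complex_hilbert_space) op set \<Rightarrow> ('h op \<Rightarrow> ennreal) \<Rightarrow> bool" where
  "normal_weight M \<tau> \<longleftrightarrow>
     (\<forall>D T. D \<subseteq> positive_part M \<and> D \<noteq> {} \<and>
        (\<forall>A\<in>D. \<forall>B\<in>D. \<exists>C\<in>D. le_op A C \<and> le_op B C) \<and>
        is_lub_op M D T \<longrightarrow> \<tau> T = (SUP S\<in>D. \<tau> S))"

definition semifinite_weight ::
    "('h::complex_hilbert_space) op set \<Rightarrow> ('h op \<Rightarrow> ennreal) \<Rightarrow> bool" where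
  "semifinite_weight M \<tau> \<longleftrightarrow>
     (\<forall>T\<in>positive_part M. T \<noteq> 0 \<longrightarrow>
        (\<exists>S\<in>positive_part M. S \<noteq> 0 \<and> le_op S T \<and> \<tau> S < \<infinity>))"

definition faithful_normal_semifinite_trace ::
    "('h::complex_hilbert_space) op set \<Rightarrow> ('h op \<Rightarrow> ennreal) \<Rightarrow> bool" where
  "faithful_normal_semifinite_trace M \<tau> \<longleftrightarrow>
     tracial_weight M \<tau> \<and> faithful_weight M \<tau> \<and> normal_weight M \<tau> \<and> semifinite_weight M \<tau>"

definition J_ideal :: "('h::complex_hilbert_space) op set \<Rightarrow> 'h op set" where
  "J_ideal M = {T \<in> M. \<exists>E\<in>finite_projections M. T = E o\<^sub>L T o\<^sub>L E}"

text \<open>The product \<open>scalar_op a o\<^sub>L T\<close> is the complex scalar multiple \<open>a T\<close>.\<close>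

definition norm_on_J ::
    "('h::complex_hilbert_space) op set \<Rightarrow> ('h op \<Rightarrow> real) \<Rightarrow> bool" where
  "norm_on_J M \<nu> \<longleftrightarrow>
     (\<forall>T\<in>J_ideal M. 0 \<le> \<nu> T \<and> (\<nu> T = 0 \<longleftrightarrow> T = 0)) \<and>
     (\<forall>a. \<forall>T\<in>J_ideal M. \<nu> (scalar_op a o\<^sub>L T) = cmod a * \<nu> T) \<and>
     (\<forall>S\<in>J_ideal M. \<forall>T\<in>J_ideal M. \<nu> (S + T) \<le> \<nu> S + \<nu> T)"

definition unitarily_invariant_norm ::
    "('h::complex_hilbert_space) op set \<Rightarrow> ('h op \<Rightarrow> real) \<Rightarrow> bool" where
  "unitarily_invariant_norm M \<nu> \<longleftrightarrow> norm_on_J M \<nu> \<and>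
     (\<forall>T\<in>J_ideal M. \<forall>U\<in>unitaries M. \<forall>V\<in>unitaries M. \<nu> (U o\<^sub>L T o\<^sub>L V) = \<nu> T)"


section \<open>Completion of a first countable topological group\<close>

text \<open>
  \<open>X\<close> is an additive subgroup whose group topology has \<open>Z\<close> as filter of neighbourhoods of \<open>0\<close>.
  When \<open>Z\<close> has a countable base, the completion of \<open>X\<close> consists of the Cauchy sequences in \<open>X\<close>
  modulo the sequences converging to \<open>0\<close>. Neighbourhoods of a class are given by those \<open>P\<close>
  in \<open>Z\<close>: the classes of \<open>s\<close> and \<open>t\<close> are \<open>P\<close>-close if \<open>t n - s n\<close> is eventually in \<open>P\<close>.
\<close>

definition cauchy_seqs :: "'a::ab_group_add set \<Rightarrow> 'a filter \<Rightarrow> (nat \<Rightarrow> 'a) set" where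
  "cauchy_seqs X Z = {s. range s \<subseteq> X \<and>
     filterlim (\<lambda>(m, n). s m - s n) Z (sequentially \<times>\<^sub>F sequentially)}"

definition cauchy_rel ::
    "'a::ab_group_add set \<Rightarrow> 'a filter \<Rightarrow> ((nat \<Rightarrow> 'a) \<times> (nat \<Rightarrow> 'a)) set" where
  "cauchy_rel X Z = {(s, t). s \<in> cauchy_seqs X Z \<and> t \<in> cauchy_seqs X Z \<and>
     filterlim (\<lambda>n. s n - t n) Z sequentially}"

definition cauchy_completion :: "'a::ab_group_add set \<Rightarrow> 'a filter \<Rightarrow> (nat \<Rightarrow> 'a) set set" where
  "cauchy_completion X Z = cauchy_seqs X Z // cauchy_rel X Z"

definition cauchy_class ::
    "'a::ab_group_add set \<Rightarrow> 'a filter \<Rightarrow> (nat \<Rightarrow> 'a) \<Rightarrow> (nat \<Rightarrow> 'a) set" where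
  "cauchy_class X Z s = cauchy_rel X Z `` {s}"

definition completion_embed ::
    "'a::ab_group_add set \<Rightarrow> 'a filter \<Rightarrow> 'a \<Rightarrow> (nat \<Rightarrow> 'a) set" where
  "completion_embed X Z x = cauchy_class X Z (\<lambda>_. x)"

definition completion_nhd ::
    "'a::ab_group_add set \<Rightarrow> 'a filter \<Rightarrow> ('a \<Rightarrow> bool) \<Rightarrow> (nat \<Rightarrow> 'a) set \<Rightarrow> (nat \<Rightarrow> 'a) set set" where
  "completion_nhd X Z P c =
     {d \<in> cauchy_completion X Z. \<exists>s\<in>c. \<exists>t\<in>d. \<forall>\<^sub>F n in sequentially. P (t n - s n)}"

definition completion_topology ::
    "'a::ab_group_add set \<Rightarrow> 'a filter \<Rightarrow> (nat \<Rightarrow> 'a) set topology" where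
  "completion_topology X Z = topology (\<lambda>U. U \<subseteq> cauchy_completion X Z \<and>
     (\<forall>c\<in>U. \<exists>P. eventually P Z \<and> completion_nhd X Z P c \<subseteq> U))"

lemma openin_completion_topology:
  "openin (completion_topology X Z) U \<longleftrightarrow> U \<subseteq> cauchy_completion X Z \<and>
     (\<forall>c\<in>U. \<exists>P. eventually P Z \<and> completion_nhd X Z P c \<subseteq> U)"
proof -
  have mono: "completion_nhd X Z P c \<subseteq> completion_nhd X Z Q c"
    if "\<And>x. P x \<Longrightarrow> Q x" for P Q c
    unfolding completion_nhd_def using that by (fastforce elim: eventually_mono)
  have "istopology (\<lambda>U. U \<subseteq> cauchy_completion X Z \<and>
     (\<forall>c\<in>U. \<exists>P. eventually P Z \<and> completion_nhd X Z P c \<subseteq> U))"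
    unfolding istopology_def
  proof (intro conjI allI impI ballI)
    fix S T c
    assume S: "S \<subseteq> cauchy_completion X Z \<and> (\<forall>c\<in>S. \<exists>P. eventually P Z \<and> completion_nhd X Z P c \<subseteq> S)"
      and T: "T \<subseteq> cauchy_completion X Z \<and> (\<forall>c\<in>T. \<exists>P. eventually P Z \<and> completion_nhd X Z P c \<subseteq> T)"
      and c: "c \<in> S \<inter> T"
    obtain P where P: "eventually P Z" "completion_nhd X Z P c \<subseteq> S" using S c by blast
    obtain Q where Q: "eventually Q Z" "completion_nhd X Z Q c \<subseteq> T" using T c by blast
    have "completion_nhd X Z (\<lambda>x. P x \<and> Q x) c \<subseteq> S \<inter> T"
      using mono[of "\<lambda>x. P x \<and> Q x" P c] mono[of "\<lambda>x. P x \<and> Q x" Q c] P Q by blast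
    then show "\<exists>R. eventually R Z \<and> completion_nhd X Z R c \<subseteq> S \<inter> T"
      using P(1) Q(1) eventually_conj by blast
  next
    fix \<K> c
    assume K: "\<forall>K\<in>\<K>. K \<subseteq> cauchy_completion X Z \<and>
        (\<forall>c\<in>K. \<exists>P. eventually P Z \<and> completion_nhd X Z P c \<subseteq> K)"
      and "c \<in> \<Union>\<K>"
    then obtain K where "K \<in> \<K>" "c \<in> K" by blast
    then show "\<exists>P. eventually P Z \<and> completion_nhd X Z P c \<subseteq> \<Union>\<K>"
      using K by (meson Sup_upper subset_trans)
  qed blast+
  then show ?thesis
    by (simp add: completion_topology_def topology_inverse')
qed

lemma topspace_completion_topology: "topspace (completion_topology X Z) = cauchy_completion X Z"
proof -
  have "openin (completion_topology X Z) (cauchy_completion X Z)"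
    unfolding openin_completion_topology completion_nhd_def
    by (auto intro: always_eventually)
  then show ?thesis
    unfolding topspace_def openin_completion_topology by auto
qed


section \<open>The completions of \<open>J(M)\<close> and of \<open>M\<close>\<close>

definition norm_zero_nhds ::
    "('h::complex_hilbert_space) op set \<Rightarrow> ('h op \<Rightarrow> real) \<Rightarrow> 'h op filter" where
  "norm_zero_nhds M \<nu> = (INF \<epsilon>\<in>{0<..}. principal {T \<in> J_ideal M. \<nu> T < \<epsilon>})"

definition measure_nhd ::
    "('h::complex_hilbert_space) op set \<Rightarrow> ('h op \<Rightarrow> ennreal) \<Rightarrow> real \<Rightarrow> real \<Rightarrow> 'h op set" where
  "measure_nhd M \<tau> \<epsilon> \<delta> = {T \<in> M. \<exists>E\<in>projections M.
     \<tau> E < ennreal \<delta> \<and> norm (T o\<^sub>L (id_blinfun - E)) < \<epsilon>}"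

definition measure_zero_nhds ::
    "('h::complex_hilbert_space) op set \<Rightarrow> ('h op \<Rightarrow> ennreal) \<Rightarrow> 'h op filter" where
  "measure_zero_nhds M \<tau> =
     (INF (\<epsilon>, \<delta>)\<in>{0<..} \<times> {0<..}. principal (measure_nhd M \<tau> \<epsilon> \<delta>))"

end

theory Submission
  imports Defs
begin

text \<open>
  A norm-Cauchy sequence in \<open>J(M)\<close> is Cauchy in measure, because the norm topology is finer than the
  measure topology on \<open>J(M)\<close>. Sending a class to the class of the same sequences for the measure
  topology is then well defined, continuous, natural and the identity on \<open>J(M)\<close>
  (\<open>completion_map_exists\<close>). Injectivity says that a norm-Cauchy sequence tending to \<open>0\<close> in measure
  tends to \<open>0\<close> in norm. Two estimates carry the proof. Both rest on
  \<open>\<nu> (A T B) \<le> 16 \<parallel>A\<parallel> \<parallel>B\<parallel> \<nu> T\<close>, which holds because a contraction is a combination of four unitaries.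

  \<^item> \<open>small_norm_small_measure\<close>. If \<open>T\<close> is not small in measure, then \<open>\<parallel>T x\<parallel> \<ge> (\<epsilon>/2) \<parallel>x\<parallel>\<close> on the range of a
    spectral projection \<open>Q\<close> of \<open>T\<^sup>* T\<close> with trace at least \<open>\<delta>\<close>. A fixed nonzero projection \<open>P\<close> of trace less
    than \<open>\<delta>\<close> is equivalent to a subprojection of \<open>Q\<close>, hence has the form \<open>A T B\<close> with \<open>A\<close> and \<open>B\<close>
    bounded in terms of \<open>\<epsilon>\<close> (\<open>nu_lower_bound\<close>). So \<open>\<nu> T\<close> is bounded below by a multiple of \<open>\<nu> P\<close>.

  \<^item> \<open>norm_lower_semicontinuous\<close>. Up to a constant factor, \<open>\<nu>\<close> is lower semicontinuous for the measure
    topology: if \<open>S\<close> is sufficiently small in measure and \<open>\<nu> (T - S) \<le> r\<close>, then \<open>\<nu> T\<close> is at most a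
    constant times \<open>r\<close>. With \<open>T = s n\<close> and \<open>S = s m\<close> for large \<open>m\<close> this gives injectivity. The proof
    compares \<open>T\<close> with its cut-down away from a projection \<open>F\<close> of small trace. The discarded piece has
    norm at most a multiple of \<open>\<parallel>T\<parallel> \<nu> F\<close>, and \<open>F\<close> is equivalent to a subprojection of the part of the range of a
    spectral projection of \<open>T\<^sup>* T\<close> where the retained piece is still bounded below.

  The operator theory behind this is developed from the definitions. Square roots come from a
  contraction argument, spectral projections from the absolute value of a self-adjoint operator.
  The trace enters through four facts about projections: comparison in a factor
  (\<open>comparison\<close>), \<open>\<tau> (E \<or> F) \<le> \<tau> E + \<tau> F\<close> (\<open>projection_join\<close>), the equivalence of finiteness with
  finite trace (\<open>finite_projection_iff\<close>), and the existence of nonzero projections of arbitrarily small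
  trace (\<open>small_projection_exists\<close>), which is where the absence of abelian projections is needed.
\<close>

section \<open>Geometry of complex Hilbert spaces\<close>

lemma cinner_add_right: "cinner x (y + z) = cinner x y + cinner x z"
  by (metis cinner_add_left cinner_commute complex_cnj_add)

lemma cinner_scaleC_right: "cinner x (scaleC a y) = cnj a * cinner x y"
  by (metis cinner_commute cinner_scaleC_left complex_cnj_mult)

lemma cinner_scaleR_left: "cinner (r *\<^sub>R x) y = complex_of_real r * cinner x y"
  by (metis cinner_scaleC_left scaleC_of_real)

lemma cinner_scaleR_right: "cinner x (r *\<^sub>R y) = complex_of_real r * cinner x y"
  by (metis cinner_scaleC_right scaleC_of_real complex_cnj_complex_of_real)

lemma cinner_minus_left: "cinner (- x) y = - cinner x y"
  using cinner_scaleR_left[of "-1" x y] by simp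

lemma cinner_minus_right: "cinner x (- y) = - cinner x y"
  using cinner_scaleR_right[of x "-1" y] by simp

lemma cinner_diff_left: "cinner (x - y) z = cinner x z - cinner y z"
  using cinner_add_left[of x "- y" z] by (simp add: cinner_minus_left)

lemma cinner_diff_right: "cinner x (y - z) = cinner x y - cinner x z"
  using cinner_add_right[of x y "- z"] by (simp add: cinner_minus_right)

lemma cinner_zero_left [simp]: "cinner 0 x = 0"
  using cinner_scaleR_left[of 0 0 x] by simp

lemma cinner_zero_right [simp]: "cinner x 0 = 0"
  using cinner_scaleR_right[of x 0 0] by simp

lemmas cinner_simps = cinner_add_left cinner_add_right cinner_diff_left cinner_diff_right
  cinner_minus_left cinner_minus_right cinner_scaleR_left cinner_scaleR_right
  cinner_scaleC_left cinner_scaleC_right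

lemma Re_cinner_commute: "Re (cinner x y) = Re (cinner y x)"
  by (subst cinner_commute) simp

lemma power2_norm_eq: "(norm x)\<^sup>2 = Re (cinner x x)"
  by (simp add: cinner_self)

lemma cinner_self_eq_0 [simp]: "cinner x x = 0 \<longleftrightarrow> x = 0"
  by (simp add: cinner_self)

lemma power2_norm_add: "(norm (x + y))\<^sup>2 = (norm x)\<^sup>2 + 2 * Re (cinner x y) + (norm y)\<^sup>2"
  using Re_cinner_commute[of x y] by (simp add: power2_norm_eq cinner_simps)

lemma power2_norm_diff: "(norm (x - y))\<^sup>2 = (norm x)\<^sup>2 - 2 * Re (cinner x y) + (norm y)\<^sup>2"
  using Re_cinner_commute[of x y] by (simp add: power2_norm_eq cinner_simps)

lemma Re_cinner_le: "Re (cinner x y) \<le> norm x * norm y"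
proof -
  have "norm (x + y) \<le> norm x + norm y" by (rule norm_triangle_ineq)
  then have "(norm (x + y))\<^sup>2 \<le> (norm x + norm y)\<^sup>2" by (simp add: power_mono)
  then show ?thesis by (simp add: power2_norm_add power2_sum)
qed

lemma Cauchy_Schwarz_cinner: "cmod (cinner x y) \<le> norm x * norm y"
proof (cases "cinner x y = 0")
  case False
  define u where "u = cnj (cinner x y) / complex_of_real (cmod (cinner x y))"
  have "u * cinner x y = complex_of_real (cmod (cinner x y))"
    using False by (simp add: u_def complex_norm_square[symmetric] mult.commute power2_eq_square)
  then have "cmod (cinner x y) = Re (cinner (scaleC u x) y)"
    by (simp add: cinner_scaleC_left)
  also have "\<dots> \<le> norm (scaleC u x) * norm y" by (rule Re_cinner_le)
  also have "norm (scaleC u x) = norm x"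
    using False by (simp add: norm_scaleC u_def norm_divide)
  finally show ?thesis .
qed simp

lemma bounded_bilinear_cinner: "bounded_bilinear cinner"
  by (rule bounded_bilinear.intro)
     (auto simp: cinner_simps scaleR_conv_of_real intro!: exI[of _ 1] Cauchy_Schwarz_cinner)

lemmas tendsto_cinner = bounded_bilinear.tendsto[OF bounded_bilinear_cinner]
lemmas continuous_on_cinner = bounded_bilinear.continuous_on[OF bounded_bilinear_cinner]

lemma cinner_eqI: "(\<And>z. cinner x z = cinner y z) \<Longrightarrow> x = y"
  by (metis cinner_diff_left cinner_self_eq_0 eq_iff_diff_eq_0)

lemma cinner_eqI2: "(\<And>z. cinner z x = cinner z y) \<Longrightarrow> x = y"
  by (metis cinner_diff_right cinner_self_eq_0 eq_iff_diff_eq_0)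

definition complex_subspace :: "'h::complex_hilbert_space set \<Rightarrow> bool" where
  "complex_subspace K \<longleftrightarrow> 0 \<in> K \<and> (\<forall>x\<in>K. \<forall>y\<in>K. x + y \<in> K) \<and> (\<forall>a. \<forall>x\<in>K. scaleC a x \<in> K)"

lemma complex_subspace_scaleR: "complex_subspace K \<Longrightarrow> x \<in> K \<Longrightarrow> r *\<^sub>R x \<in> K"
  by (metis complex_subspace_def scaleC_of_real)

lemma complex_subspace_diff:
  assumes "complex_subspace K" "x \<in> K" "y \<in> K"
  shows "x - y \<in> K"
proof -
  have "(-1) *\<^sub>R y \<in> K" using assms complex_subspace_scaleR by blast
  then show ?thesis using assms unfolding complex_subspace_def
    by (metis ab_group_add_class.ab_diff_conv_add_uminus scaleR_minus1_left)
qed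

text \<open>By the parallelogram law a minimising sequence for the distance from \<open>x\<close> to \<open>K\<close> is
  Cauchy.\<close>

lemma nearest_point_exists:
  fixes K :: "'h::complex_hilbert_space set"
  assumes K: "complex_subspace K" "closed K"
  shows "\<exists>y\<in>K. \<forall>k\<in>K. norm (x - y) \<le> norm (x - k)"
proof -
  define d where "d = (INF k\<in>K. norm (x - k))"
  have ne: "K \<noteq> {}" using K unfolding complex_subspace_def by blast
  have bb: "bdd_below ((\<lambda>k. norm (x - k)) ` K)" by (rule bdd_belowI2[of _ 0]) simp
  have d_le: "d \<le> norm (x - k)" if "k \<in> K" for k
    unfolding d_def using bb that by (rule cINF_lower)
  have d0: "0 \<le> d" unfolding d_def using ne by (intro cINF_greatest) auto
  have "\<exists>k\<in>K. norm (x - k) < d + inverse (real (Suc n))" for n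
    using cINF_less_iff[OF ne bb, of "d + inverse (real (Suc n))"] unfolding d_def by simp
  then obtain f where fK: "f n \<in> K" and f: "norm (x - f n) < d + inverse (real (Suc n))" for n
    by metis
  have lim: "(\<lambda>n. norm (x - f n)) \<longlonglongrightarrow> d"
  proof (rule tendsto_sandwich[OF _ _ tendsto_const[of d]])
    show "(\<lambda>n. d + inverse (real (Suc n))) \<longlonglongrightarrow> d"
      using tendsto_add[OF tendsto_const[of d] LIMSEQ_inverse_real_of_nat] by simp
  qed (auto intro!: always_eventually d_le fK less_imp_le[OF f] simp del: of_nat_Suc)
  have par: "(norm (f m - f n))\<^sup>2 \<le> 2 * (norm (x - f m))\<^sup>2 + 2 * (norm (x - f n))\<^sup>2 - 4 * d\<^sup>2" for m n
  proof -
    have "(1/2) *\<^sub>R (f m + f n) \<in> K"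
      using K fK complex_subspace_scaleR unfolding complex_subspace_def by blast
    then have "d \<le> norm (x - (1/2) *\<^sub>R (f m + f n))" by (rule d_le)
    also have "x - (1/2) *\<^sub>R (f m + f n) = (1/2) *\<^sub>R ((x - f m) + (x - f n))"
      by (simp add: algebra_simps flip: scaleR_add_left)
    finally have "2 * d \<le> norm ((x - f m) + (x - f n))" by simp
    then have "(2 * d)\<^sup>2 \<le> (norm ((x - f m) + (x - f n)))\<^sup>2" using d0 by (intro power_mono) auto
    moreover have "(norm ((x - f n) - (x - f m)))\<^sup>2 + (norm ((x - f m) + (x - f n)))\<^sup>2
        = 2 * (norm (x - f m))\<^sup>2 + 2 * (norm (x - f n))\<^sup>2"
      using Re_cinner_commute[of "x - f m" "x - f n"] power2_norm_diff[of "x - f n" "x - f m"]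
        power2_norm_add[of "x - f m" "x - f n"]
      by linarith
    ultimately show ?thesis by (simp add: power_mult_distrib)
  qed
  have "Cauchy f"
  proof (rule metric_CauchyI)
    fix e :: real assume e: "0 < e"
    have "(\<lambda>n. (norm (x - f n))\<^sup>2) \<longlonglongrightarrow> d\<^sup>2" by (intro tendsto_power lim)
    then have "\<forall>\<^sub>F n in sequentially. (norm (x - f n))\<^sup>2 < d\<^sup>2 + e\<^sup>2 / 4"
      by (rule order_tendstoD) (use e in simp)
    then obtain N where N: "\<And>n. n \<ge> N \<Longrightarrow> (norm (x - f n))\<^sup>2 < d\<^sup>2 + e\<^sup>2 / 4"
      by (auto simp: eventually_sequentially)
    have "dist (f m) (f n) < e" if "m \<ge> N" "n \<ge> N" for m n
    proof -
      have "(norm (f m - f n))\<^sup>2 < e\<^sup>2" using par[of m n] N[OF that(1)] N[OF that(2)] by linarith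
      then show ?thesis using e by (simp add: dist_norm power2_less_imp_less)
    qed
    then show "\<exists>N. \<forall>m\<ge>N. \<forall>n\<ge>N. dist (f m) (f n) < e" by blast
  qed
  then obtain y where y: "f \<longlonglongrightarrow> y" using Cauchy_convergent convergent_def by blast
  have "y \<in> K" using closed_sequentially[OF K(2) _ y] fK by blast
  moreover have "norm (x - y) = d"
    using LIMSEQ_unique[OF tendsto_norm[OF tendsto_diff[OF tendsto_const y]] lim] .
  ultimately show ?thesis using d_le by metis
qed

text \<open>Minimality of the distance along each line through the nearest point gives orthogonality.\<close>

lemma orthogonal_decomposition:
  fixes K :: "'h::complex_hilbert_space set"
  assumes K: "complex_subspace K" "closed K"
  shows "\<exists>y\<in>K. \<forall>k\<in>K. cinner (x - y) k = 0"
proof -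
  obtain y where y: "y \<in> K" and min: "\<And>k. k \<in> K \<Longrightarrow> norm (x - y) \<le> norm (x - k)"
    using nearest_point_exists[OF K] by blast
  have re: "Re (cinner (x - y) k) = 0" if k: "k \<in> K" for k
  proof (cases "k = 0")
    case False
    define c where "c = Re (cinner (x - y) k)"
    define t where "t = c / (norm k)\<^sup>2"
    have "y + t *\<^sub>R k \<in> K" using K y k complex_subspace_scaleR unfolding complex_subspace_def by blast
    then have "(norm (x - y))\<^sup>2 \<le> (norm ((x - y) - t *\<^sub>R k))\<^sup>2"
      using min by (metis diff_diff_eq norm_ge_zero power_mono)
    also have "\<dots> = (norm (x - y))\<^sup>2 - 2 * t * c + t\<^sup>2 * (norm k)\<^sup>2"
      by (simp only: power2_norm_diff) (simp add: cinner_simps c_def power_mult_distrib)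
    also have "\<dots> = (norm (x - y))\<^sup>2 - c\<^sup>2 / (norm k)\<^sup>2"
      using False by (simp add: t_def field_simps power2_eq_square)
    finally have "c\<^sup>2 / (norm k)\<^sup>2 \<le> 0" by simp
    then show ?thesis using False by (simp add: c_def divide_le_0_iff)
  qed simp
  have "cinner (x - y) k = 0" if k: "k \<in> K" for k
  proof -
    have "scaleC \<i> k \<in> K" using K k unfolding complex_subspace_def by blast
    from re[OF this] have "Im (cinner (x - y) k) = 0" by (simp add: cinner_scaleC_right)
    then show ?thesis using re[OF k] by (simp add: complex_eq_iff)
  qed
  then show ?thesis using y by blast
qed

section \<open>Adjoints\<close>

lemma scaleC_zero_right [simp]: "scaleC a (0::'h::complex_hilbert_space) = 0"
  using norm_scaleC[of a 0] by simp

lemma scaleC_minus_left: "scaleC (- a) (x::'h::complex_hilbert_space) = - scaleC a x"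
proof -
  have "scaleC (- a + a) x = scaleC (- a) x + scaleC a x" by (rule scaleC_add_left)
  moreover have "scaleC 0 x = 0" using norm_scaleC[of 0 x] by simp
  ultimately show ?thesis by (simp add: add_eq_0_iff)
qed

lemma scaleC_one [simp]: "scaleC 1 (x::'h::complex_hilbert_space) = x"
  using scaleC_of_real[of 1 x] by simp

lemma scaleC_diff_right: "scaleC a (x - y) = scaleC a x - scaleC a (y::'h::complex_hilbert_space)"
  using scaleC_add_right[of a "x - y" y] by (simp add: algebra_simps)

lemma scaleC_scaleR: "scaleC a (r *\<^sub>R x) = r *\<^sub>R scaleC a (x::'h::complex_hilbert_space)"
  by (metis mult.commute scaleC_of_real scaleC_scaleC)

lemma complex_operatorsD:
  "T \<in> complex_operators \<Longrightarrow> blinfun_apply T (scaleC a x) = scaleC a (blinfun_apply T x)"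
  by (simp add: complex_operators_def)

text \<open>The functional vanishes on a closed subspace \<open>K\<close> of codimension at most one. A vector
  orthogonal to \<open>K\<close>, suitably scaled, represents it.\<close>

lemma Riesz_representation:
  fixes T :: "'h::complex_hilbert_space op"
  assumes T: "T \<in> complex_operators"
  shows "\<exists>z. \<forall>x. cinner (T x) y = cinner x z"
proof (cases "\<forall>x. cinner (T x) y = 0")
  case True
  then show ?thesis by (intro exI[of _ 0]) simp
next
  case False
  then obtain u where u: "cinner (T u) y \<noteq> 0" by blast
  define K where "K = {x. cinner (T x) y = 0}"
  have K: "complex_subspace K"
    by (auto simp: K_def complex_subspace_def blinfun.add_right cinner_simps complex_operatorsD[OF T]
        blinfun.zero_right)
  have "closed K" unfolding K_def
    by (intro closed_Collect_eq continuous_on_cinner continuous_intros)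
  then obtain v where v: "v \<in> K" and orth: "\<And>k. k \<in> K \<Longrightarrow> cinner (u - v) k = 0"
    using orthogonal_decomposition[OF K] by blast
  define w where "w = u - v"
  define c where "c = cinner (T w) y"
  have c: "c \<noteq> 0" using u v by (simp add: w_def K_def blinfun.diff_right cinner_simps c_def)
  then have w: "w \<noteq> 0" by (auto simp: c_def blinfun.zero_right)
  define b where "b = cnj c / cinner w w"
  have "cinner (T x) y = cinner x (scaleC b w)" for x
  proof -
    define a where "a = cinner (T x) y / c"
    have "x - scaleC a w \<in> K"
      using c by (simp add: K_def blinfun.diff_right cinner_simps complex_operatorsD[OF T] a_def c_def)
    then have "cinner w (x - scaleC a w) = 0" using orth w_def by blast
    then have "cinner w x = cnj a * cinner w w" by (simp add: cinner_simps)
    then have "cinner x w = a * cinner w w"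
      by (metis cinner_commute complex_cnj_cnj complex_cnj_mult)
    then show ?thesis using w c cinner_commute[of w w]
      by (simp add: cinner_scaleC_right b_def a_def)
  qed
  then show ?thesis by blast
qed

lemma adjoint_exists:
  fixes T :: "'h::complex_hilbert_space op"
  assumes T: "T \<in> complex_operators"
  shows "\<exists>S::'h op. \<forall>x y. cinner (T x) y = cinner x (S y)"
proof -
  obtain g where g: "\<And>x y. cinner (T x) y = cinner x (g y)"
    using Riesz_representation[OF T] by metis
  have "bounded_linear g"
  proof (rule bounded_linear_intro[where K = "norm T"])
    show "g (x + y) = g x + g y" for x y
      by (rule cinner_eqI2) (simp add: g[symmetric] cinner_simps)
    show "g (r *\<^sub>R x) = r *\<^sub>R g x" for r x
      by (rule cinner_eqI2) (simp add: g[symmetric] cinner_simps)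
    show "norm (g x) \<le> norm x * norm T" for x
    proof (cases "g x = 0")
      case False
      have "(norm (g x))\<^sup>2 = Re (cinner (T (g x)) x)" by (simp add: power2_norm_eq g)
      also have "\<dots> \<le> norm (T (g x)) * norm x" by (rule Re_cinner_le)
      also have "\<dots> \<le> norm T * norm (g x) * norm x"
        by (intro mult_right_mono norm_blinfun) simp
      finally show ?thesis using False by (simp add: power2_eq_square mult_ac)
    qed simp
  qed
  then show ?thesis using g
    by (intro exI[of _ "Blinfun g"]) (simp add: bounded_linear_Blinfun_apply)
qed

lemma adj_op_eqI:
  assumes "\<And>x y. cinner (blinfun_apply T x) y = cinner x (blinfun_apply S y)"
  shows "adj_op T = S"
  unfolding adj_op_def
proof (rule the_equality)
  fix R :: "'a op" assume "\<forall>x y. cinner (T x) y = cinner x (R y)"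
  then show "R = S" using assms by (metis blinfun_eqI cinner_eqI2)
qed (use assms in blast)

lemma cinner_adj_right:
  "T \<in> complex_operators \<Longrightarrow>
    cinner (blinfun_apply T x) y = cinner x (blinfun_apply (adj_op T) y)"
proof -
  assume T: "T \<in> complex_operators"
  obtain S :: "'a op" where S: "\<forall>x y. cinner (T x) y = cinner x (S y)"
    using adjoint_exists[OF T] by blast
  then have "adj_op T = S" by (intro adj_op_eqI) blast
  then show ?thesis using S by simp
qed

lemma cinner_adj_left:
  "T \<in> complex_operators \<Longrightarrow>
    cinner (blinfun_apply (adj_op T) x) y = cinner x (blinfun_apply T y)"
  using cinner_adj_right[of T y x] by (subst (1 2) cinner_commute) simp

lemma complex_operators_adj:
  assumes "T \<in> complex_operators" shows "adj_op T \<in> complex_operators"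
  unfolding complex_operators_def
  by (intro CollectI allI, rule cinner_eqI) (simp add: cinner_adj_left[OF assms] cinner_simps)

lemma adj_adj: "T \<in> complex_operators \<Longrightarrow> adj_op (adj_op T) = T"
  by (rule adj_op_eqI) (rule cinner_adj_left)

lemma complex_operators_compose:
  "S \<in> complex_operators \<Longrightarrow> T \<in> complex_operators \<Longrightarrow> S o\<^sub>L T \<in> complex_operators"
  by (simp add: complex_operators_def)

lemma complex_operators_add:
  "S \<in> complex_operators \<Longrightarrow> T \<in> complex_operators \<Longrightarrow> S + T \<in> complex_operators"
  by (simp add: complex_operators_def blinfun.add_left scaleC_add_right)

lemma complex_operators_diff:
  "S \<in> complex_operators \<Longrightarrow> T \<in> complex_operators \<Longrightarrow> S - T \<in> complex_operators"
  by (simp add: complex_operators_def blinfun.diff_left scaleC_diff_right)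

lemma complex_operators_scaleR:
  "T \<in> complex_operators \<Longrightarrow> r *\<^sub>R T \<in> complex_operators"
  by (simp add: complex_operators_def blinfun.scaleR_left scaleC_scaleR)

lemma complex_operators_id: "id_blinfun \<in> complex_operators"
  by (simp add: complex_operators_def)

lemma complex_operators_zero: "0 \<in> complex_operators"
  by (simp add: complex_operators_def)

lemma complex_operators_scalar: "scalar_op a \<in> complex_operators"
  by (simp add: complex_operators_def scalar_op.rep_eq scaleC_scaleC mult.commute)

lemma adj_compose:
  "S \<in> complex_operators \<Longrightarrow> T \<in> complex_operators \<Longrightarrow>
    adj_op (S o\<^sub>L T) = adj_op T o\<^sub>L adj_op S"
  by (rule adj_op_eqI) (simp add: cinner_adj_right)

lemma adj_add:
  "S \<in> complex_operators \<Longrightarrow> T \<in> complex_operators \<Longrightarrow> adj_op (S + T) = adj_op S + adj_op T"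
  by (rule adj_op_eqI) (simp add: cinner_adj_right blinfun.add_left cinner_simps)

lemma adj_diff:
  "S \<in> complex_operators \<Longrightarrow> T \<in> complex_operators \<Longrightarrow> adj_op (S - T) = adj_op S - adj_op T"
  by (rule adj_op_eqI) (simp add: cinner_adj_right blinfun.diff_left cinner_simps)

lemma adj_scaleR: "T \<in> complex_operators \<Longrightarrow> adj_op (r *\<^sub>R T) = r *\<^sub>R adj_op T"
  by (rule adj_op_eqI) (simp add: cinner_adj_right blinfun.scaleR_left cinner_simps)

lemma adj_id [simp]: "adj_op id_blinfun = id_blinfun"
  by (rule adj_op_eqI) simp

lemma adj_zero [simp]: "adj_op 0 = 0"
  by (rule adj_op_eqI) simp

lemma adj_scalar: "adj_op (scalar_op a) = scalar_op (cnj a)"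
  by (rule adj_op_eqI) (simp add: scalar_op.rep_eq cinner_simps)

lemma power2_norm_apply:
  "T \<in> complex_operators \<Longrightarrow>
    (norm (blinfun_apply T x))\<^sup>2 = Re (cinner (blinfun_apply (adj_op T o\<^sub>L T) x) x)"
  by (simp add: power2_norm_eq cinner_adj_left)

lemma norm_adj_le:
  assumes T: "T \<in> complex_operators"
  shows "norm (adj_op T) \<le> norm T"
proof (rule norm_blinfun_bound)
  fix x
  show "norm (adj_op T x) \<le> norm T * norm x"
  proof (cases "adj_op T x = 0")
    case False
    have "(norm (adj_op T x))\<^sup>2 = Re (cinner (T (adj_op T x)) x)"
      by (simp add: power2_norm_eq cinner_adj_right[OF T])
    also have "\<dots> \<le> norm (T (adj_op T x)) * norm x" by (rule Re_cinner_le)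
    also have "\<dots> \<le> norm T * norm (adj_op T x) * norm x"
      by (intro mult_right_mono norm_blinfun) simp
    finally show ?thesis using False by (simp add: power2_eq_square mult_ac)
  qed simp
qed simp

lemma norm_adj: "T \<in> complex_operators \<Longrightarrow> norm (adj_op T) = norm T"
  using norm_adj_le[of T] norm_adj_le[of "adj_op T"] by (simp add: complex_operators_adj adj_adj)

lemma adj_op_mult_self_eq_0:
  "T \<in> complex_operators \<Longrightarrow> adj_op T o\<^sub>L T = 0 \<Longrightarrow> T = 0"
  by (rule blinfun_eqI) (use power2_norm_apply[of T] in simp)

section \<open>Von Neumann algebras\<close>

lemmas op_apply = blinfun.add_left blinfun.add_right blinfun.diff_left blinfun.diff_right
  blinfun.minus_left blinfun.minus_right blinfun.scaleR_left blinfun.scaleR_right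

lemma compose_eq_apply: "S o\<^sub>L T = R \<Longrightarrow> blinfun_apply S (blinfun_apply T x) = blinfun_apply R x"
  by (metis blinfun_apply_blinfun_compose)

lemma compose_assoc: "(R o\<^sub>L S) o\<^sub>L T = R o\<^sub>L (S o\<^sub>L T)"
  by (rule blinfun_eqI) simp

lemma compose_add_left: "(R + S) o\<^sub>L T = (R o\<^sub>L T) + (S o\<^sub>L T)"
  by (rule blinfun_eqI) (simp add: op_apply)

lemma compose_add_right: "R o\<^sub>L (S + T) = (R o\<^sub>L S) + (R o\<^sub>L T)"
  by (rule blinfun_eqI) (simp add: op_apply)

lemma compose_diff_left: "(R - S) o\<^sub>L T = (R o\<^sub>L T) - (S o\<^sub>L T)"
  by (rule blinfun_eqI) (simp add: op_apply)

lemma compose_diff_right: "R o\<^sub>L (S - T) = (R o\<^sub>L S) - (R o\<^sub>L T)"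
  by (rule blinfun_eqI) (simp add: op_apply)

lemma compose_scaleR_left: "(r *\<^sub>R S) o\<^sub>L T = r *\<^sub>R (S o\<^sub>L T)"
  by (rule blinfun_eqI) (simp add: op_apply)

lemma compose_scaleR_right: "R o\<^sub>L (r *\<^sub>R T) = r *\<^sub>R (R o\<^sub>L T)"
  by (rule blinfun_eqI) (simp add: op_apply)

lemma compose_id [simp]: "id_blinfun o\<^sub>L T = T" "T o\<^sub>L id_blinfun = T"
  by (rule blinfun_eqI, simp)+

lemma compose_zero [simp]: "0 o\<^sub>L T = 0" "T o\<^sub>L 0 = 0"
  by (rule blinfun_eqI, simp)+

lemmas compose_sum_left = bounded_bilinear.sum_left[OF bounded_bilinear_blinfun_compose]
lemmas compose_sum_right = bounded_bilinear.sum_right[OF bounded_bilinear_blinfun_compose]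

lemmas op_algebra = compose_assoc compose_add_left compose_add_right compose_diff_left
  compose_diff_right compose_scaleR_left compose_scaleR_right

lemma commutantD: "T \<in> commutant A \<Longrightarrow> S \<in> A \<Longrightarrow> T o\<^sub>L S = S o\<^sub>L T"
  by (simp add: commutant_def)

lemma commutant_antimono: "A \<subseteq> B \<Longrightarrow> commutant B \<subseteq> commutant A"
  by (auto simp: commutant_def)

lemma subset_bicommutant: "A \<subseteq> complex_operators \<Longrightarrow> A \<subseteq> commutant (commutant A)"
  by (auto simp: commutant_def)

lemma commutant_complex: "commutant A \<subseteq> complex_operators"
  by (auto simp: commutant_def)

lemma adj_commutant:
  assumes A: "\<And>T. T \<in> A \<Longrightarrow> adj_op T \<in> A" "A \<subseteq> complex_operators" and S: "S \<in> commutant A"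
  shows "adj_op S \<in> commutant A"
proof -
  have Sc: "S \<in> complex_operators" using S commutant_complex by blast
  have "adj_op S o\<^sub>L T = T o\<^sub>L adj_op S" if T: "T \<in> A" for T
  proof -
    have Tc: "T \<in> complex_operators" using T A by blast
    have "S o\<^sub>L adj_op T = adj_op T o\<^sub>L S" using S A T commutantD by blast
    then have "adj_op (S o\<^sub>L adj_op T) = adj_op (adj_op T o\<^sub>L S)" by simp
    then show ?thesis using Sc Tc by (simp add: adj_compose complex_operators_adj adj_adj)
  qed
  then show ?thesis using Sc complex_operators_adj unfolding commutant_def by blast
qed

locale von_neumann =
  fixes M :: "('h::complex_hilbert_space) op set"
  assumes vna: "von_neumann_algebra M"
begin

lemma in_complex: "T \<in> M \<Longrightarrow> T \<in> complex_operators"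
  using vna unfolding von_neumann_algebra_def by blast

lemma adj_in: "T \<in> M \<Longrightarrow> adj_op T \<in> M"
  using vna unfolding von_neumann_algebra_def by blast

lemma in_bicommutantI:
  assumes "T \<in> complex_operators" "\<And>S. S \<in> commutant M \<Longrightarrow> T o\<^sub>L S = S o\<^sub>L T"
  shows "T \<in> M"
proof -
  have "T \<in> commutant (commutant M)" using assms unfolding commutant_def[of "commutant M"] by blast
  then show ?thesis using vna unfolding von_neumann_algebra_def by blast
qed

lemma commutes: "T \<in> M \<Longrightarrow> S \<in> commutant M \<Longrightarrow> T o\<^sub>L S = S o\<^sub>L T"
  using commutantD by metis

lemma commutes_apply:
  "T \<in> M \<Longrightarrow> S \<in> commutant M \<Longrightarrow> blinfun_apply T (blinfun_apply S x) = blinfun_apply S (blinfun_apply T x)"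
  using commutes by (metis blinfun_apply_blinfun_compose)

lemma commutant_in_complex: "S \<in> commutant M \<Longrightarrow> S \<in> complex_operators"
  using commutant_complex by blast

lemma adj_in_commutant: "S \<in> commutant M \<Longrightarrow> adj_op S \<in> commutant M"
  using adj_commutant[of M S] adj_in in_complex by blast

lemma id_in: "id_blinfun \<in> M"
  by (rule in_bicommutantI) (auto simp: complex_operators_id)

lemma zero_in: "0 \<in> M"
  by (rule in_bicommutantI) (auto simp: complex_operators_zero)

lemma compose_in: "S \<in> M \<Longrightarrow> T \<in> M \<Longrightarrow> S o\<^sub>L T \<in> M"
  by (rule in_bicommutantI, simp add: complex_operators_compose in_complex,
      rule blinfun_eqI, simp add: commutes_apply)

lemma add_in: "S \<in> M \<Longrightarrow> T \<in> M \<Longrightarrow> S + T \<in> M"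
  by (rule in_bicommutantI, simp add: complex_operators_add in_complex,
      rule blinfun_eqI, simp add: commutes_apply op_apply)

lemma diff_in: "S \<in> M \<Longrightarrow> T \<in> M \<Longrightarrow> S - T \<in> M"
  by (rule in_bicommutantI, simp add: complex_operators_diff in_complex,
      rule blinfun_eqI, simp add: commutes_apply op_apply)

lemma scaleR_in: "T \<in> M \<Longrightarrow> r *\<^sub>R T \<in> M"
  by (rule in_bicommutantI, simp add: complex_operators_scaleR in_complex,
      rule blinfun_eqI, simp add: commutes_apply op_apply)

lemma scalar_in: "scalar_op a \<in> M"
  by (rule in_bicommutantI)
     (auto intro!: blinfun_eqI
       simp: complex_operators_scalar scalar_op.rep_eq commutant_in_complex complex_operatorsD)

lemma uminus_in: "T \<in> M \<Longrightarrow> - T \<in> M"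
  using scaleR_in[of T "-1"] by simp

lemmas closure = compose_in add_in diff_in scaleR_in scalar_in uminus_in id_in zero_in adj_in

text \<open>Linearity over the complex numbers and commutation with a fixed operator pass to strong limits.\<close>

lemma strong_limit_in:
  assumes Tn: "\<And>n::nat. Tn n \<in> M" and lim: "\<And>x. (\<lambda>n. Tn n x) \<longlonglongrightarrow> blinfun_apply T x"
  shows "T \<in> M"
proof (rule in_bicommutantI)
  have "T (scaleC a x) = scaleC a (T x)" for a x
  proof (rule LIMSEQ_unique[OF lim])
    have "(\<lambda>n. scaleC a (Tn n x)) \<longlonglongrightarrow> scaleC a (T x)"
      by (rule bounded_linear.tendsto[OF bounded_linear_scaleC lim])
    then show "(\<lambda>n. Tn n (scaleC a x)) \<longlonglongrightarrow> scaleC a (T x)"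
      by (simp add: complex_operatorsD[OF in_complex[OF Tn]])
  qed
  then show "T \<in> complex_operators" by (simp add: complex_operators_def)
next
  fix S assume S: "S \<in> commutant M"
  show "T o\<^sub>L S = S o\<^sub>L T"
  proof (rule blinfun_eqI)
    fix x
    have "(\<lambda>n. S (Tn n x)) \<longlonglongrightarrow> S (T x)"
      by (rule blinfun.tendsto[OF tendsto_const lim])
    then have "(\<lambda>n. Tn n (S x)) \<longlonglongrightarrow> S (T x)" by (simp add: commutes_apply[OF Tn S])
    then show "(T o\<^sub>L S) x = (S o\<^sub>L T) x" using LIMSEQ_unique[OF lim] by simp
  qed
qed

lemma norm_limit_in:
  assumes "\<And>n::nat. Tn n \<in> M" "Tn \<longlonglongrightarrow> T"
  shows "T \<in> M"
  using strong_limit_in[of Tn T] assms blinfun.tendsto[OF assms(2) tendsto_const] by blast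

text \<open>The projection onto an invariant subspace of the commutant commutes with the commutant,
  since the orthogonal complement is invariant as well.\<close>

lemma projection_onto_invariant_subspace:
  assumes K: "complex_subspace K" "closed K"
    and inv: "\<And>S x. S \<in> commutant M \<Longrightarrow> x \<in> K \<Longrightarrow> blinfun_apply S x \<in> K"
  shows "\<exists>P\<in>projections M. (\<forall>x. blinfun_apply P x \<in> K) \<and> (\<forall>x\<in>K. blinfun_apply P x = x)"
proof -
  obtain p where pK: "\<And>x. p x \<in> K" and orth: "\<And>x k. k \<in> K \<Longrightarrow> cinner (x - p x) k = 0"
    using orthogonal_decomposition[OF K] by metis
  have unique: "p x = y" if y: "y \<in> K" and o: "\<And>k. k \<in> K \<Longrightarrow> cinner (x - y) k = 0" for x y
  proof -
    have d: "p x - y \<in> K" using complex_subspace_diff[OF K(1) pK y] .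
    have "cinner (p x - y) (p x - y) = cinner (x - y) (p x - y) - cinner (x - p x) (p x - y)"
      by (simp add: cinner_simps)
    also have "\<dots> = 0" using o orth d by simp
    finally show ?thesis by simp
  qed
  have p_add: "p (x + y) = p x + p y" for x y
  proof (rule unique)
    show "p x + p y \<in> K" using K pK unfolding complex_subspace_def by blast
    fix k assume k: "k \<in> K"
    have "x + y - (p x + p y) = (x - p x) + (y - p y)" by simp
    then show "cinner (x + y - (p x + p y)) k = 0"
      using orth[OF k] by (simp only: cinner_add_left) simp
  qed
  have p_scaleC: "p (scaleC a x) = scaleC a (p x)" for a x
  proof (rule unique)
    show "scaleC a (p x) \<in> K" using K pK unfolding complex_subspace_def by blast
    show "cinner (scaleC a x - scaleC a (p x)) k = 0" if "k \<in> K" for k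
      using orth[OF that] by (simp add: cinner_scaleC_left flip: scaleC_diff_right)
  qed
  have p_norm: "norm (p x) \<le> norm x" for x
  proof -
    have "cinner (x - p x) (p x) = 0" using orth pK by blast
    then have "(norm (p x))\<^sup>2 = Re (cinner x (p x))" by (simp add: power2_norm_eq cinner_simps)
    also have "\<dots> \<le> norm x * norm (p x)" by (rule Re_cinner_le)
    finally show ?thesis by (cases "p x = 0") (simp_all add: power2_eq_square)
  qed
  have "bounded_linear p"
    by (rule bounded_linear_intro[where K = 1])
       (use p_add p_scaleC p_norm in \<open>auto simp flip: scaleC_of_real\<close>)
  then have Pp: "blinfun_apply (Blinfun p) x = p x" for x
    by (simp add: bounded_linear_Blinfun_apply)
  have p_id: "p x = x" if "x \<in> K" for x using unique[OF that] by simp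
  have p_sym: "cinner (p x) y = cinner x (p y)" for x y
  proof -
    have "cinner (x - p x) (p y) = 0" "cinner (y - p y) (p x) = 0" using orth pK by blast+
    moreover have "cinner (p x) (y - p y) = 0"
      using calculation(2) cinner_commute[of "p x" "y - p y"] by simp
    ultimately show ?thesis by (simp add: cinner_simps)
  qed
  have "Blinfun p \<in> M"
  proof (rule in_bicommutantI)
    show "Blinfun p \<in> complex_operators" by (simp add: complex_operators_def Pp p_scaleC)
    fix S assume S: "S \<in> commutant M"
    have "p (S x) = S (p x)" for x
    proof (rule unique)
      show "S (p x) \<in> K" using inv S pK by blast
      fix k assume k: "k \<in> K"
      have "cinner (S x - S (p x)) k = cinner (x - p x) (adj_op S k)"
        using S by (simp add: cinner_adj_right[symmetric] commutant_in_complex op_apply)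
      then show "cinner (S x - S (p x)) k = 0" using orth inv[OF adj_in_commutant[OF S] k] by simp
    qed
    then show "Blinfun p o\<^sub>L S = S o\<^sub>L Blinfun p" by (auto intro!: blinfun_eqI simp: Pp)
  qed
  moreover have "Blinfun p o\<^sub>L Blinfun p = Blinfun p" by (auto intro!: blinfun_eqI simp: Pp p_id pK)
  moreover have "adj_op (Blinfun p) = Blinfun p" by (rule adj_op_eqI) (simp add: Pp p_sym)
  ultimately have "Blinfun p \<in> projections M" by (simp add: projections_def)
  then show ?thesis using pK p_id Pp by (intro bexI[of _ "Blinfun p"]) auto
qed

end

section \<open>Square roots and spectral projections\<close>

text \<open>For self-adjoint \<open>A\<close> this is the von Neumann algebra generated by \<open>A\<close>. It is commutative, so
  membership in it replaces explicit bookkeeping of what commutes with functions of \<open>A\<close>.\<close>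

abbreviation generated_algebra :: "('h::complex_hilbert_space) op \<Rightarrow> 'h op set" where
  "generated_algebra A \<equiv> commutant (commutant {A})"

lemma von_neumann_generated_algebra:
  assumes A: "A \<in> complex_operators" "adj_op A = A"
  shows "von_neumann (generated_algebra A)"
proof
  have c: "adj_op S \<in> commutant {A}" if "S \<in> commutant {A}" for S
    using adj_commutant[of "{A}" S] A that by auto
  have "commutant (commutant (commutant {A})) = commutant {A}"
    using subset_bicommutant[of "{A}"] subset_bicommutant[OF commutant_complex, of "{A}"]
      commutant_antimono A by blast
  then show "von_neumann_algebra (generated_algebra A)"
    using adj_commutant[of "commutant {A}", OF c commutant_complex] commutant_complex
    unfolding von_neumann_algebra_def by (metis (no_types, lifting))
qed

lemma self_in_generated_algebra: "A \<in> complex_operators \<Longrightarrow> A \<in> generated_algebra A"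
  using subset_bicommutant[of "{A}"] by auto

lemma generated_algebra_commute:
  assumes "A \<in> complex_operators" "S \<in> generated_algebra A" "T \<in> generated_algebra A"
  shows "S o\<^sub>L T = T o\<^sub>L S"
proof -
  have "{A} \<subseteq> commutant {A}" using assms by (auto simp: commutant_def)
  then have "T \<in> commutant {A}" using assms(3) commutant_antimono by blast
  then show ?thesis using assms(2) commutantD by blast
qed

lemma generated_algebra_commutes:
  assumes "S \<in> generated_algebra A" "B \<in> complex_operators" "B o\<^sub>L A = A o\<^sub>L B"
  shows "S o\<^sub>L B = B o\<^sub>L S"
  using assms by (intro commutantD[OF assms(1)]) (simp add: commutant_def)

lemma generated_algebra_subset:
  assumes "von_neumann M" "A \<in> M"
  shows "generated_algebra A \<subseteq> M"
proof -
  interpret von_neumann M by fact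
  have "commutant (commutant {A}) \<subseteq> commutant (commutant M)"
    using assms commutant_antimono[of "{A}" M] by (intro commutant_antimono) auto
  then show ?thesis using vna unfolding von_neumann_algebra_def by blast
qed

text \<open>Polarisation bounds \<open>Re \<langle>A x, y\<rangle>\<close> by the quadratic form. The choice \<open>y = t A x\<close> with
  \<open>\<parallel>y\<parallel> = \<parallel>x\<parallel>\<close> gives the norm.\<close>

lemma norm_le_quadratic_form:
  fixes A :: "('h::complex_hilbert_space) op"
  assumes A: "A \<in> complex_operators" "adj_op A = A"
    and q: "\<And>x. \<bar>Re (cinner (A x) x)\<bar> \<le> a * (norm x)\<^sup>2" and a: "0 \<le> a"
  shows "norm A \<le> a"
proof (rule norm_blinfun_bound[OF a])
  fix x
  have sym: "cinner (A x) y = cinner x (A y)" for x y using cinner_adj_right[OF A(1)] A(2) by simp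
  have bound: "2 * Re (cinner (A x) y) \<le> a * ((norm x)\<^sup>2 + (norm y)\<^sup>2)" for x y
  proof -
    have "4 * Re (cinner (A x) y) = Re (cinner (A (x + y)) (x + y)) - Re (cinner (A (x - y)) (x - y))"
      using sym[of y x] Re_cinner_commute[of y "A x"] by (simp add: op_apply cinner_simps)
    also have "\<dots> \<le> a * (norm (x + y))\<^sup>2 + a * (norm (x - y))\<^sup>2"
      using q[of "x + y"] q[of "x - y"] by linarith
    also have "\<dots> = 2 * (a * ((norm x)\<^sup>2 + (norm y)\<^sup>2))"
      by (simp add: power2_norm_add power2_norm_diff algebra_simps)
    finally show ?thesis by simp
  qed
  show "norm (A x) \<le> a * norm x"
  proof (cases "A x = 0")
    case False
    define t where "t = norm x / norm (A x)"
    have "2 * t * (norm (A x))\<^sup>2 \<le> a * ((norm x)\<^sup>2 + t\<^sup>2 * (norm (A x))\<^sup>2)"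
      using bound[of x "t *\<^sub>R A x"]
      by (simp add: cinner_simps power_mult_distrib power2_norm_eq mult.assoc)
    also have "t\<^sup>2 * (norm (A x))\<^sup>2 = (norm x)\<^sup>2" using False by (simp add: t_def power_divide)
    also have "2 * t * (norm (A x))\<^sup>2 = 2 * (norm x * norm (A x))"
      using False by (simp add: t_def power2_eq_square)
    finally have "norm x * norm (A x) \<le> norm x * (a * norm x)" by (simp add: power2_eq_square mult_ac)
    moreover have "norm x > 0" using False by (auto simp: op_apply)
    ultimately show ?thesis by simp
  qed (use a in simp)
qed

lemma self_adjoint_closed:
  assumes "\<And>n::nat. Tn n \<in> complex_operators" "\<And>n. adj_op (Tn n) = Tn n" "Tn \<longlonglongrightarrow> T"
  shows "adj_op T = T"
proof (rule adj_op_eqI, rule LIMSEQ_unique)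
  fix x y
  show "(\<lambda>n. cinner (Tn n x) y) \<longlonglongrightarrow> cinner (T x) y"
    by (intro tendsto_cinner blinfun.tendsto tendsto_const assms)
  have "cinner (Tn n x) y = cinner x (Tn n y)" for n
    using cinner_adj_right[OF assms(1)] assms(2) by metis
  then show "(\<lambda>n. cinner (Tn n x) y) \<longlonglongrightarrow> cinner x (T y)"
    by (simp add: tendsto_cinner blinfun.tendsto tendsto_const assms)
qed

lemma (in von_neumann) complete_self_adjoint_ball:
  "complete {Y \<in> M. adj_op Y = Y \<and> norm Y \<le> r}"
proof -
  have "closed {Y \<in> M. adj_op Y = Y \<and> norm Y \<le> r}"
    unfolding closed_sequential_limits
  proof (intro allI impI CollectI conjI; elim conjE)
    fix Tn T assume Tn: "\<forall>n. Tn n \<in> {Y \<in> M. adj_op Y = Y \<and> norm Y \<le> r}" "Tn \<longlonglongrightarrow> T"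
    show "T \<in> M" by (rule norm_limit_in[of Tn]) (use Tn in auto)
    show "adj_op T = T" by (rule self_adjoint_closed[of Tn]) (use Tn in \<open>auto intro: in_complex\<close>)
    show "norm T \<le> r"
      by (rule tendsto_upperbound[OF tendsto_norm[of Tn T]]) (use Tn in \<open>auto simp: always_eventually\<close>)
  qed
  then show ?thesis by (simp add: complete_eq_closed)
qed

text \<open>The equation \<open>(1 - Y)\<^sup>2 = 1 - X\<close> says that \<open>Y\<close> is a fixed point of
  \<open>Y \<mapsto> (X + Y\<^sup>2) / 2\<close>, which is a contraction of the ball of radius \<open>r = 1 - sqrt (1 - x)\<close>
  when \<open>norm X \<le> x < 1\<close>.\<close>

lemma square_root_near_identity:
  fixes X :: "('h::complex_hilbert_space) op"
  assumes M: "von_neumann M" and X: "X \<in> M" "adj_op X = X" "norm X \<le> x" and x: "x < 1"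
  shows "\<exists>Y\<in>M. adj_op Y = Y \<and> norm Y \<le> 1 - sqrt (1 - x) \<and>
    (id_blinfun - Y) o\<^sub>L (id_blinfun - Y) = id_blinfun - X"
proof -
  interpret von_neumann M by fact
  define r where "r = 1 - sqrt (1 - x)"
  have x0: "0 \<le> x" using X(3) norm_ge_zero order_trans by blast
  have r: "0 \<le> r" "r < 1" using x x0 by (auto simp: r_def)
  have rr: "x + r\<^sup>2 = 2 * r" using x by (simp add: r_def power2_diff)
  define s where "s = {Y \<in> M. adj_op Y = Y \<and> norm Y \<le> r}"
  define f where "f Y = (1/2) *\<^sub>R (X + (Y o\<^sub>L Y))" for Y
  have compose_le: "norm (S o\<^sub>L T) \<le> a * b" if "norm S \<le> a" "norm T \<le> b" for S T :: "'h op" and a b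
    by (rule order_trans[OF norm_blinfun_compose]) (use that in \<open>auto intro: mult_mono order_trans[OF norm_ge_zero]\<close>)
  have "\<exists>!Y\<in>s. f Y = Y"
  proof (rule Banach_fix[where c = r])
    show "complete s" unfolding s_def by (rule complete_self_adjoint_ball)
    show "s \<noteq> {}" using r zero_in by (auto simp: s_def intro!: exI[of _ 0])
    show "f ` s \<subseteq> s"
    proof safe
      fix Y assume Y: "Y \<in> s"
      have "norm (X + (Y o\<^sub>L Y)) \<le> x + r * r"
        using Y X compose_le[of Y r Y r] norm_triangle_ineq[of X "Y o\<^sub>L Y"] by (simp add: s_def)
      then have "norm (f Y) \<le> r" using rr by (simp add: f_def power2_eq_square)
      moreover have "f Y \<in> M" using Y X by (simp add: s_def f_def closure)
      moreover have "adj_op (f Y) = f Y" using Y X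
        by (simp add: s_def f_def adj_scaleR adj_add adj_compose in_complex closure)
      ultimately show "f Y \<in> s" by (simp add: s_def)
    qed
    fix Y Z assume YZ: "Y \<in> s" "Z \<in> s"
    show "dist (f Y) (f Z) \<le> r * dist Y Z"
    proof -
      have "f Y - f Z = (1/2) *\<^sub>R ((Y o\<^sub>L (Y - Z)) + ((Y - Z) o\<^sub>L Z))"
        by (simp add: f_def op_algebra algebra_simps)
      then have "norm (f Y - f Z) \<le> (1/2) * (norm (Y o\<^sub>L (Y - Z)) + norm ((Y - Z) o\<^sub>L Z))"
        by (simp add: norm_triangle_ineq)
      also have "\<dots> \<le> (1/2) * (r * norm (Y - Z) + norm (Y - Z) * r)"
        using YZ by (intro mult_left_mono add_mono compose_le) (auto simp: s_def)
      finally show "dist (f Y) (f Z) \<le> r * dist Y Z" by (simp add: dist_norm)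
    qed
  qed (use r in auto)
  then obtain Y where Y: "Y \<in> s" "f Y = Y" by blast
  have "2 *\<^sub>R f Y = X + (Y o\<^sub>L Y)" by (simp add: f_def)
  then have "X + (Y o\<^sub>L Y) = 2 *\<^sub>R Y" using Y(2) by simp
  then have "(id_blinfun - Y) o\<^sub>L (id_blinfun - Y) = id_blinfun - X"
    by (simp add: op_algebra algebra_simps scaleR_2)
  then show ?thesis using Y(1) unfolding s_def r_def by blast
qed

text \<open>The inverse is the fixed point of \<open>Z \<mapsto> 1 + Y Z\<close>.\<close>

lemma inverse_near_identity:
  fixes Y :: "('h::complex_hilbert_space) op"
  assumes M: "von_neumann M" and Y: "Y \<in> M" "norm Y < 1"
  shows "\<exists>Z\<in>M. (id_blinfun - Y) o\<^sub>L Z = id_blinfun"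
proof -
  interpret von_neumann M by fact
  have "\<exists>!Z\<in>M. id_blinfun + (Y o\<^sub>L Z) = Z"
  proof (rule Banach_fix[where c = "norm Y"])
    have "closed M" unfolding closed_sequential_limits using norm_limit_in by blast
    then show "complete M" by (simp add: complete_eq_closed)
    show "M \<noteq> {}" using zero_in by blast
    show "(\<lambda>Z. id_blinfun + (Y o\<^sub>L Z)) ` M \<subseteq> M" using Y by (auto intro: closure)
    fix S T :: "'h op"
    have "norm (Y o\<^sub>L (S - T)) \<le> norm Y * norm (S - T)" by (rule norm_blinfun_compose)
    then show "dist (id_blinfun + (Y o\<^sub>L S)) (id_blinfun + (Y o\<^sub>L T)) \<le> norm Y * dist S T"
      by (simp add: dist_norm op_algebra)
  qed (use Y in auto)
  then obtain Z where "Z \<in> M" "id_blinfun + (Y o\<^sub>L Z) = Z" by blast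
  then show ?thesis by (intro bexI[of _ Z]) (auto simp: op_algebra algebra_simps)
qed

text \<open>Scaling by \<open>k = \<parallel>B\<parallel> + c\<close> writes \<open>B\<close> as \<open>k (1 - X)\<close> with \<open>\<parallel>X\<parallel> \<le> 1 - c / k\<close>. The exact radius in the
  contraction argument yields the sharp bound \<open>W \<ge> sqrt c\<close>, on which both the norm of the inverse \<open>S\<close>
  and the convergence of the approximations to the absolute value depend.\<close>

lemma positive_square_root:
  fixes B :: "('h::complex_hilbert_space) op"
  assumes B: "B \<in> complex_operators" "adj_op B = B" and c: "0 < c"
    and q: "\<And>x. c * (norm x)\<^sup>2 \<le> Re (cinner (B x) x)"
  obtains W S where "W \<in> generated_algebra B" "S \<in> generated_algebra B"
    "adj_op W = W" "adj_op S = S" "W o\<^sub>L W = B" "S o\<^sub>L W = id_blinfun"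
    "\<And>x. sqrt c * (norm x)\<^sup>2 \<le> Re (cinner (W x) x)" "norm S \<le> 1 / sqrt c"
proof -
  interpret von_neumann "generated_algebra B" by (rule von_neumann_generated_algebra[OF B])
  note vn = von_neumann_generated_algebra[OF B]
  have Bin: "B \<in> generated_algebra B" by (rule self_in_generated_algebra[OF B(1)])
  define k where "k = norm B + c"
  have k: "0 < k" "c \<le> k" "norm B \<le> k" using c norm_ge_zero[of B] unfolding k_def by linarith+
  define X where "X = id_blinfun - (1/k) *\<^sub>R B"
  have X: "X \<in> generated_algebra B" "adj_op X = X"
    using Bin by (auto simp: X_def closure adj_diff adj_scaleR in_complex B)
  have "norm X \<le> 1 - c / k"
  proof (rule norm_le_quadratic_form)
    fix x
    have "Re (cinner (B x) x) \<le> norm (B x) * norm x" by (rule Re_cinner_le)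
    also have "\<dots> \<le> norm B * norm x * norm x" by (intro mult_right_mono norm_blinfun) simp
    also have "\<dots> \<le> k * (norm x)\<^sup>2"
      unfolding power2_eq_square mult.assoc using k by (intro mult_right_mono) auto
    finally have "Re (cinner (B x) x) / k \<le> (norm x)\<^sup>2" using k by (simp add: field_simps)
    moreover have "(c / k) * (norm x)\<^sup>2 \<le> Re (cinner (B x) x) / k"
      using q[of x] k by (simp add: divide_right_mono)
    moreover have "Re (cinner (X x) x) = (norm x)\<^sup>2 - Re (cinner (B x) x) / k"
      by (simp add: X_def op_apply cinner_simps power2_norm_eq)
    ultimately show "\<bar>Re (cinner (X x) x)\<bar> \<le> (1 - c / k) * (norm x)\<^sup>2"
      unfolding left_diff_distrib by simp
  qed (use X in_complex k in auto)
  then obtain Y where Y: "Y \<in> generated_algebra B" "adj_op Y = Y" "norm Y \<le> 1 - sqrt (c / k)"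
    and YX: "(id_blinfun - Y) o\<^sub>L (id_blinfun - Y) = id_blinfun - X"
    using square_root_near_identity[OF vn X, of "1 - c / k"] c k by auto
  have "0 < sqrt (c / k)" using c k by simp
  then have "norm Y < 1" using Y(3) by linarith
  then obtain Z where Z: "Z \<in> generated_algebra B" "(id_blinfun - Y) o\<^sub>L Z = id_blinfun"
    using inverse_near_identity[OF vn Y(1)] by blast
  have Z': "Z o\<^sub>L (id_blinfun - Y) = id_blinfun"
    using Z generated_algebra_commute[OF B(1) Z(1), of "id_blinfun - Y"] Y closure by simp
  define W where "W = sqrt k *\<^sub>R (id_blinfun - Y)"
  define S where "S = (1 / sqrt k) *\<^sub>R Z"
  have Win: "W \<in> generated_algebra B" and Sin: "S \<in> generated_algebra B"
    using Y Z by (auto simp: W_def S_def closure)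
  have Wadj: "adj_op W = W" using Y by (simp add: W_def adj_scaleR adj_diff in_complex closure)
  have WW: "W o\<^sub>L W = B"
    using k by (simp add: W_def compose_scaleR_left compose_scaleR_right YX) (simp add: X_def)
  have SW: "S o\<^sub>L W = id_blinfun" and WS: "W o\<^sub>L S = id_blinfun"
    using k by (simp_all add: S_def W_def compose_scaleR_left compose_scaleR_right Z Z')
  have "adj_op S o\<^sub>L W = id_blinfun"
    using arg_cong[OF WS, of adj_op] Win Sin Wadj by (simp add: adj_compose in_complex)
  then have Sadj: "adj_op S = S" by (metis WS compose_assoc compose_id)
  have Wq: "sqrt c * (norm x)\<^sup>2 \<le> Re (cinner (W x) x)" for x
  proof -
    have "Re (cinner (Y x) x) \<le> norm (Y x) * norm x" by (rule Re_cinner_le)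
    also have "\<dots> \<le> norm Y * norm x * norm x" by (intro mult_right_mono norm_blinfun) simp
    also have "\<dots> \<le> (1 - sqrt (c / k)) * (norm x)\<^sup>2"
      unfolding power2_eq_square mult.assoc using Y(3) by (intro mult_right_mono) auto
    finally have "sqrt (c / k) * (norm x)\<^sup>2 \<le> (norm x)\<^sup>2 - Re (cinner (Y x) x)"
      by (simp add: algebra_simps)
    then have "sqrt k * (sqrt (c / k) * (norm x)\<^sup>2) \<le> sqrt k * ((norm x)\<^sup>2 - Re (cinner (Y x) x))"
      using k by (intro mult_left_mono) auto
    moreover have "sqrt k * sqrt (c / k) = sqrt c" using k by (simp flip: real_sqrt_mult)
    ultimately show ?thesis
      by (simp add: W_def op_apply cinner_simps power2_norm_eq flip: mult.assoc)
  qed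
  have "norm S \<le> 1 / sqrt c"
  proof (rule norm_blinfun_bound)
    fix x
    have "sqrt c * (norm (S x))\<^sup>2 \<le> Re (cinner (W (S x)) (S x))" by (rule Wq)
    also have "\<dots> = Re (cinner x (S x))" using compose_eq_apply[OF WS] by simp
    also have "\<dots> \<le> norm x * norm (S x)" by (rule Re_cinner_le)
    finally show "norm (S x) \<le> 1 / sqrt c * norm x"
      using c by (cases "S x = 0") (simp_all add: power2_eq_square field_simps)
  qed (use c in simp)
  then show thesis using that Win Sin Wadj Sadj WW SW Wq by blast
qed

text \<open>The square roots of \<open>A\<^sup>2 + 1 / (n + 1)\<close> converge in norm, at the rate at which square
  roots of nonnegative numbers do.\<close>

lemma absolute_value_exists:
  fixes A :: "('h::complex_hilbert_space) op"
  assumes A: "A \<in> complex_operators" "adj_op A = A"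
  obtains W where "W \<in> generated_algebra A" "adj_op W = W" "W o\<^sub>L W = A o\<^sub>L A"
    "\<And>x. 0 \<le> Re (cinner (W x) x)"
proof -
  note vn = von_neumann_generated_algebra[OF A]
  interpret von_neumann "generated_algebra A" by (rule vn)
  have Ain: "A \<in> generated_algebra A" by (rule self_in_generated_algebra[OF A(1)])
  define c where "c n = inverse (real (Suc n))" for n
  have c: "0 < c n" for n by (simp add: c_def)
  have c_anti: "c n \<le> c m" if "m \<le> n" for m n using that by (simp add: c_def field_simps)
  define B where "B n = (A o\<^sub>L A) + c n *\<^sub>R id_blinfun" for n
  have Bin: "B n \<in> generated_algebra A" for n using Ain by (simp add: B_def closure)
  have Badj: "adj_op (B n) = B n" for n
    using A by (simp add: B_def adj_add adj_compose adj_scaleR complex_operators_compose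
        complex_operators_scaleR complex_operators_id)
  have Bq: "c n * (norm x)\<^sup>2 \<le> Re (cinner (B n x) x)" for n x
  proof -
    have "0 \<le> Re (cinner (A (A x)) x)" using power2_norm_apply[OF A(1), of x] A(2)
      by (metis blinfun_apply_blinfun_compose zero_le_power2)
    then show ?thesis by (simp add: B_def op_apply cinner_simps power2_norm_eq)
  qed
  have "\<exists>W. W \<in> generated_algebra A \<and> adj_op W = W \<and> W o\<^sub>L W = B n \<and>
     (\<forall>x. sqrt (c n) * (norm x)\<^sup>2 \<le> Re (cinner (W x) x))" for n
  proof -
    obtain W where "W \<in> generated_algebra (B n)" "adj_op W = W" "W o\<^sub>L W = B n"
      "\<And>x. sqrt (c n) * (norm x)\<^sup>2 \<le> Re (cinner (W x) x)"
      using positive_square_root[OF in_complex[OF Bin] Badj c Bq, of n] by metis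
    then show ?thesis using generated_algebra_subset[OF vn Bin[of n]] by blast
  qed
  then obtain W where W: "\<And>n. W n \<in> generated_algebra A" "\<And>n. adj_op (W n) = W n"
      "\<And>n. W n o\<^sub>L W n = B n"
    and Wq: "\<And>n x. sqrt (c n) * (norm x)\<^sup>2 \<le> Re (cinner (W n x) x)"
    by metis
  have Wpos: "0 \<le> Re (cinner (W n x) x)" for n x
    by (rule order_trans[OF _ Wq]) (use c[of n] in simp)
  have close: "norm (W m - W n) \<le> sqrt (c m)" if "m \<le> n" for m n
  proof (rule norm_blinfun_bound)
    fix x
    define D where "D = W m - W n"
    have "(W m + W n) o\<^sub>L D = (c m - c n) *\<^sub>R id_blinfun"
      using generated_algebra_commute[OF A(1) W(1)[of m] W(1)[of n]] W(3)[of m] W(3)[of n]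
      by (simp add: D_def op_algebra B_def algebra_simps)
    then have "W m (D x) + W n (D x) = (c m - c n) *\<^sub>R x"
      using compose_eq_apply[of "W m + W n" D _ x] by (simp add: op_apply)
    moreover have "sqrt (c m) * (norm (D x))\<^sup>2 \<le> Re (cinner (W m (D x) + W n (D x)) (D x))"
      using Wq[of m "D x"] Wpos[of n "D x"] by (simp add: cinner_simps)
    ultimately have "sqrt (c m) * (norm (D x))\<^sup>2 \<le> (c m - c n) * Re (cinner x (D x))"
      by (simp add: cinner_simps)
    also have "\<dots> \<le> c m * (norm x * norm (D x))"
      using c_anti[OF that] c[of n]
      by (intro order_trans[OF mult_left_mono[OF Re_cinner_le]] mult_right_mono) auto
    also have "\<dots> = sqrt (c m) * (sqrt (c m) * norm x * norm (D x))"
      using real_sqrt_mult_self[of "c m"] c[of m] by (simp flip: mult.assoc)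
    finally have "norm (D x) * norm (D x) \<le> sqrt (c m) * norm x * norm (D x)"
      using c[of m] by (simp add: power2_eq_square)
    then have "norm (D x) \<le> sqrt (c m) * norm x" by (cases "D x = 0") (use c[of m] in simp_all)
    then show "norm ((W m - W n) x) \<le> sqrt (c m) * norm x" by (simp add: D_def)
  qed (use c[of m] in simp)
  have clim: "c \<longlonglongrightarrow> 0" unfolding c_def by (rule LIMSEQ_inverse_real_of_nat)
  have "Cauchy W"
  proof (rule metric_CauchyI)
    fix e :: real assume e: "0 < e"
    have "\<forall>\<^sub>F n in sequentially. sqrt (c n) < e"
      by (rule order_tendstoD[OF tendsto_real_sqrt[OF clim]]) (use e in simp)
    then obtain N where N: "\<And>n. n \<ge> N \<Longrightarrow> sqrt (c n) < e" by (auto simp: eventually_sequentially)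
    have "dist (W m) (W n) < e" if "m \<ge> N" "n \<ge> N" for m n
      using close[of m n] close[of n m] N[OF that(1)] N[OF that(2)] le_cases[of m n]
      by (metis dist_commute dist_norm order_le_less_trans)
    then show "\<exists>N. \<forall>m\<ge>N. \<forall>n\<ge>N. dist (W m) (W n) < e" by blast
  qed
  then obtain V where V: "W \<longlonglongrightarrow> V" using Cauchy_convergent convergent_def by blast
  have VV: "V o\<^sub>L V = A o\<^sub>L A"
  proof (rule LIMSEQ_unique)
    show "(\<lambda>n. W n o\<^sub>L W n) \<longlonglongrightarrow> (V o\<^sub>L V)"
      by (rule bounded_bilinear.tendsto[OF bounded_bilinear_blinfun_compose V V])
    have "(\<lambda>n. (A o\<^sub>L A) + c n *\<^sub>R id_blinfun) \<longlonglongrightarrow> (A o\<^sub>L A) + 0 *\<^sub>R id_blinfun"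
      by (intro tendsto_intros clim)
    then show "(\<lambda>n. W n o\<^sub>L W n) \<longlonglongrightarrow> (A o\<^sub>L A)" by (simp add: W(3) B_def)
  qed
  have "0 \<le> Re (cinner (V x) x)" for x
  proof (rule tendsto_lowerbound)
    show "(\<lambda>n. Re (cinner (W n x) x)) \<longlonglongrightarrow> Re (cinner (V x) x)"
      by (intro tendsto_Re tendsto_cinner blinfun.tendsto tendsto_const V)
  qed (simp_all add: Wpos)
  then show thesis
    using that norm_limit_in[OF W(1) V] self_adjoint_closed[OF in_complex[OF W(1)] W(2) V] VV by blast
qed

text \<open>With \<open>W\<close> the absolute value of \<open>A\<close>, the projection onto the kernel of \<open>W - A\<close> separates the
  positive part of \<open>A\<close> from the negative part, because \<open>(W - A) (W + A) = 0\<close>.\<close>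

lemma positive_spectral_projection:
  fixes A :: "('h::complex_hilbert_space) op"
  assumes A: "A \<in> complex_operators" "adj_op A = A"
  obtains Q where "Q \<in> projections (generated_algebra A)"
    "\<And>x. 0 \<le> Re (cinner (A (Q x)) (Q x))" "\<And>x. Re (cinner (A (x - Q x)) (x - Q x)) \<le> 0"
proof -
  interpret von_neumann "generated_algebra A" by (rule von_neumann_generated_algebra[OF A])
  have Ain: "A \<in> generated_algebra A" by (rule self_in_generated_algebra[OF A(1)])
  obtain W where W: "W \<in> generated_algebra A" "adj_op W = W" "W o\<^sub>L W = A o\<^sub>L A"
    and Wpos: "\<And>x. 0 \<le> Re (cinner (W x) x)"
    using absolute_value_exists[OF A] by metis
  define K where "K = {x. W x = A x}"
  have K: "complex_subspace K" using complex_operatorsD[OF A(1)] complex_operatorsD[OF in_complex[OF W(1)]]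
    by (auto simp: K_def complex_subspace_def op_apply)
  have "closed K" unfolding K_def by (intro closed_Collect_eq continuous_intros)
  moreover have "S x \<in> K" if "S \<in> commutant (generated_algebra A)" "x \<in> K" for S x
    using that commutes_apply[OF W(1) that(1)] commutes_apply[OF Ain that(1)] by (simp add: K_def)
  ultimately obtain Q where Q: "Q \<in> projections (generated_algebra A)"
    and QK: "\<And>x. Q x \<in> K" "\<And>x. x \<in> K \<Longrightarrow> Q x = x"
    using projection_onto_invariant_subspace[OF K] by metis
  have Qin: "Q \<in> generated_algebra A" using Q by (simp add: projections_def)
  have comm: "W (A x) = A (W x)" "Q (W x) = W (Q x)" "Q (A x) = A (Q x)" for x
    using generated_algebra_commute[OF A(1)] W(1) Ain Qin by (metis blinfun_apply_blinfun_compose)+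
  have "W (W x) = A (A x)" for x using compose_eq_apply[OF W(3)] by simp
  then have "W x + A x \<in> K" for x by (simp add: K_def op_apply comm add.commute)
  from QK(2)[OF this] have "W (Q x) + A (Q x) = W x + A x" for x
    by (simp add: op_apply comm)
  then have neg: "A (x - Q x) = - W (x - Q x)" for x
    by (simp add: op_apply algebra_simps)
  have pos: "A (Q x) = W (Q x)" for x using QK(1)[of x] by (simp add: K_def)
  show thesis
  proof (rule that[OF Q])
    show "0 \<le> Re (cinner (A (Q x)) (Q x))" for x by (simp add: pos Wpos)
    show "Re (cinner (A (x - Q x)) (x - Q x)) \<le> 0" for x
      using Wpos[of "x - Q x"] by (simp add: neg cinner_simps)
  qed
qed

section \<open>Projections and partial isometries\<close>

lemma power2_norm_compose_adj:
  "T \<in> complex_operators \<Longrightarrow>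
    Re (cinner (blinfun_apply (adj_op T) (blinfun_apply T x)) x) = (norm (blinfun_apply T x))\<^sup>2"
  using power2_norm_apply[of T x] by simp

text \<open>\<open>Q\<close> is the spectral projection of \<open>T\<^sup>* T\<close> for the half-line above \<open>l\<^sup>2\<close>.\<close>

lemma spectral_cut_generated:
  fixes T :: "('h::complex_hilbert_space) op"
  assumes T: "T \<in> complex_operators" and l: "0 \<le> l"
  obtains Q where "Q \<in> projections (generated_algebra (adj_op T o\<^sub>L T))"
    "\<And>x. l * norm (Q x) \<le> norm (T (Q x))" "\<And>x. norm (T (x - Q x)) \<le> l * norm (x - Q x)"
proof -
  define H where "H = adj_op T o\<^sub>L T"
  have H: "H \<in> complex_operators" "adj_op H = H"
    by (simp_all add: H_def T adj_compose adj_adj complex_operators_compose complex_operators_adj)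
  note vn = von_neumann_generated_algebra[OF H]
  interpret von_neumann "generated_algebra H" by (rule vn)
  define A where "A = H - l\<^sup>2 *\<^sub>R id_blinfun"
  have A: "A \<in> generated_algebra H"
    using self_in_generated_algebra[OF H(1)] by (simp add: A_def closure)
  have Aadj: "adj_op A = A"
    by (simp add: A_def adj_diff adj_scaleR H complex_operators_id complex_operators_scaleR)
  have q: "Re (cinner (A x) x) = (norm (T x))\<^sup>2 - (l * norm x)\<^sup>2" for x
    by (simp add: A_def H_def op_apply cinner_simps power2_norm_compose_adj T power_mult_distrib)
       (simp add: power2_norm_eq)
  obtain Q where Q: "Q \<in> projections (generated_algebra A)"
    "\<And>x. 0 \<le> Re (cinner (A (Q x)) (Q x))" "\<And>x. Re (cinner (A (x - Q x)) (x - Q x)) \<le> 0"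
    using positive_spectral_projection[OF in_complex[OF A] Aadj] by metis
  show thesis
  proof (rule that[of Q])
    show "Q \<in> projections (generated_algebra (adj_op T o\<^sub>L T))"
      using Q(1) generated_algebra_subset[OF vn A] by (auto simp: projections_def H_def)
    show "l * norm (Q x) \<le> norm (T (Q x))" for x
      using Q(2)[of x] by - (rule power2_le_imp_le, simp_all add: q)
    show "norm (T (x - Q x)) \<le> l * norm (x - Q x)" for x
      using Q(3)[of x] l by - (rule power2_le_imp_le, simp_all add: q)
  qed
qed

definition partial_isometries :: "('h::complex_hilbert_space) op set \<Rightarrow> 'h op set" where
  "partial_isometries M = {V \<in> M. V o\<^sub>L (adj_op V o\<^sub>L V) = V}"

context von_neumann
begin

lemmas adj_simps = adj_compose adj_add adj_diff adj_adj adj_scaleR in_complex closure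

lemma projD:
  assumes "E \<in> projections M"
  shows "E \<in> M" "adj_op E = E" "E o\<^sub>L E = E" "\<And>x. blinfun_apply E (blinfun_apply E x) = blinfun_apply E x"
    "\<And>x y. cinner (blinfun_apply E x) y = cinner x (blinfun_apply E y)"
proof -
  show 1: "E \<in> M" "adj_op E = E" "E o\<^sub>L E = E" using assms by (auto simp: projections_def)
  show "E (E x) = E x" for x using compose_eq_apply[OF 1(3)] .
  show "cinner (E x) y = cinner x (E y)" for x y
    using cinner_adj_right[OF in_complex[OF 1(1)]] 1(2) by metis
qed

lemma projI: "E \<in> M \<Longrightarrow> adj_op E = E \<Longrightarrow> E o\<^sub>L E = E \<Longrightarrow> E \<in> projections M"
  by (simp add: projections_def)

lemma proj_absorb:
  assumes "E \<in> projections M" "F \<in> projections M" "E o\<^sub>L F = F"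
  shows "F o\<^sub>L E = F"
  using arg_cong[OF assms(3), of adj_op] projD[OF assms(1)] projD[OF assms(2)]
  by (simp add: adj_simps)

lemma proj_absorb':
  assumes "E \<in> projections M" "F \<in> projections M" "F o\<^sub>L E = F"
  shows "E o\<^sub>L F = F"
  using arg_cong[OF assms(3), of adj_op] projD[OF assms(1)] projD[OF assms(2)]
  by (simp add: adj_simps)

lemma proj_norm_apply:
  assumes "E \<in> projections M"
  shows "norm (blinfun_apply E x) \<le> norm x"
proof -
  have "(norm (E x))\<^sup>2 = Re (cinner x (E x))"
    using projD[OF assms] by (simp add: power2_norm_eq)
  also have "\<dots> \<le> norm x * norm (E x)" by (rule Re_cinner_le)
  finally show ?thesis by (cases "E x = 0") (simp_all add: power2_eq_square)
qed

lemma proj_norm: "E \<in> projections M \<Longrightarrow> norm E \<le> 1"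
  by (rule norm_blinfun_bound) (simp_all add: proj_norm_apply)

lemma proj_complement:
  "E \<in> projections M \<Longrightarrow> id_blinfun - E \<in> projections M"
  using projD[of E] by (intro projI) (simp_all add: adj_simps op_algebra)

lemma proj_diff:
  assumes "E \<in> projections M" "F \<in> projections M" "E o\<^sub>L F = F"
  shows "E - F \<in> projections M"
  using projD[OF assms(1)] projD[OF assms(2)] assms(3) proj_absorb[OF assms]
  by (intro projI) (simp_all add: adj_simps op_algebra)

lemma proj_orthogonal_sym:
  assumes "E \<in> projections M" "F \<in> projections M" "E o\<^sub>L F = 0"
  shows "F o\<^sub>L E = 0"
  using arg_cong[OF assms(3), of adj_op] projD[OF assms(1)] projD[OF assms(2)]
  by (simp add: adj_simps)

lemma proj_add:
  assumes "E \<in> projections M" "F \<in> projections M" "E o\<^sub>L F = 0"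
  shows "E + F \<in> projections M"
  using projD[OF assms(1)] projD[OF assms(2)] assms(3) proj_orthogonal_sym[OF assms]
  by (intro projI) (simp_all add: adj_simps op_algebra)

lemma proj_id: "id_blinfun \<in> projections M"
  by (intro projI) (simp_all add: closure)

lemma partial_isometryD:
  assumes "V \<in> partial_isometries M"
  shows "V \<in> M" "V o\<^sub>L (adj_op V o\<^sub>L V) = V" "adj_op V o\<^sub>L (V o\<^sub>L adj_op V) = adj_op V"
    "adj_op V o\<^sub>L V \<in> projections M" "V o\<^sub>L adj_op V \<in> projections M"
proof -
  show 1: "V \<in> M" "V o\<^sub>L (adj_op V o\<^sub>L V) = V"
    using assms by (auto simp: partial_isometries_def)
  show 2: "adj_op V o\<^sub>L (V o\<^sub>L adj_op V) = adj_op V"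
    using arg_cong[OF 1(2), of adj_op] 1(1) by (simp add: adj_simps compose_assoc)
  show "adj_op V o\<^sub>L V \<in> projections M"
    using 1 by (intro projI) (simp_all add: adj_simps op_algebra)
  show "V o\<^sub>L adj_op V \<in> projections M"
    using 1(1) 2 by (intro projI) (simp_all add: adj_simps op_algebra)
qed

lemma adj_partial_isometry:
  assumes "V \<in> partial_isometries M"
  shows "adj_op V \<in> partial_isometries M"
  using partial_isometryD(1,3)[OF assms] by (simp add: partial_isometries_def adj_simps)

lemma partial_isometryI:
  assumes V: "V \<in> M" and P: "adj_op V o\<^sub>L V \<in> projections M"
  shows "V \<in> partial_isometries M"
proof -
  let ?P = "adj_op V o\<^sub>L V"
  have "norm (V (?P x) - V x) = 0" for x
  proof -
    have "adj_op V (V (?P x - x)) = 0" using projD(4)[OF P, of x] by (simp add: op_apply)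
    then have "(norm (V (?P x - x)))\<^sup>2 = 0"
      using power2_norm_compose_adj[OF in_complex[OF V], of "?P x - x"] by simp
    then show ?thesis by (simp add: op_apply)
  qed
  then show ?thesis using V by (auto simp: partial_isometries_def intro!: blinfun_eqI)
qed

lemma zero_partial_isometry: "0 \<in> partial_isometries M"
  by (simp add: partial_isometries_def zero_in)

lemma partial_isometry_support:
  assumes V: "V \<in> partial_isometries M" and G: "G \<in> projections M"
  shows "V o\<^sub>L G = V \<longleftrightarrow> G o\<^sub>L (adj_op V o\<^sub>L V) = adj_op V o\<^sub>L V"
proof -
  note VD = partial_isometryD[OF V]
  show ?thesis
  proof
    assume "V o\<^sub>L G = V"
    then have "(adj_op V o\<^sub>L V) o\<^sub>L G = adj_op V o\<^sub>L V" by (simp add: compose_assoc)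
    then show "G o\<^sub>L (adj_op V o\<^sub>L V) = adj_op V o\<^sub>L V"
      by (rule proj_absorb'[OF G VD(4)])
  next
    assume "G o\<^sub>L (adj_op V o\<^sub>L V) = adj_op V o\<^sub>L V"
    then have "(adj_op V o\<^sub>L V) o\<^sub>L G = adj_op V o\<^sub>L V" by (rule proj_absorb[OF G VD(4)])
    then have "V o\<^sub>L ((adj_op V o\<^sub>L V) o\<^sub>L G) = V" using VD(2) by simp
    then show "V o\<^sub>L G = V" using VD(2) by (metis compose_assoc)
  qed
qed

text \<open>A projection \<open>E\<close> with \<open>T E = T\<close> commutes with \<open>T\<^sup>* T\<close>, hence with \<open>Q\<close>. Since \<open>T\<close> vanishes on
  \<open>Q (1 - E)\<close> and is bounded below on \<open>Q\<close>, it follows that \<open>Q\<close> lies below \<open>E\<close>.\<close>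

lemma spectral_cut:
  assumes T: "T \<in> M" and l: "0 \<le> l"
  obtains Q where "Q \<in> projections M"
    "\<And>x. l * norm (blinfun_apply Q x) \<le> norm (blinfun_apply T (blinfun_apply Q x))"
    "\<And>x. norm (blinfun_apply T (x - blinfun_apply Q x)) \<le> l * norm (x - blinfun_apply Q x)"
    "Q o\<^sub>L (adj_op T o\<^sub>L T) = (adj_op T o\<^sub>L T) o\<^sub>L Q"
    "\<And>E. 0 < l \<Longrightarrow> E \<in> projections M \<Longrightarrow> T o\<^sub>L E = T \<Longrightarrow> Q o\<^sub>L E = Q"
proof -
  obtain Q where Q: "Q \<in> projections (generated_algebra (adj_op T o\<^sub>L T))"
    and Q1: "\<And>x. l * norm (Q x) \<le> norm (T (Q x))" and Q2: "\<And>x. norm (T (x - Q x)) \<le> l * norm (x - Q x)"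
    using spectral_cut_generated[OF in_complex[OF T] l] by metis
  have comm: "Q o\<^sub>L B = B o\<^sub>L Q" if "B \<in> complex_operators" "B o\<^sub>L (adj_op T o\<^sub>L T) = (adj_op T o\<^sub>L T) o\<^sub>L B" for B
    using generated_algebra_commutes[OF _ that] Q by (simp add: projections_def)
  have "von_neumann M" by unfold_locales
  then have "Q \<in> projections M"
    using Q generated_algebra_subset[of M "adj_op T o\<^sub>L T"] T
    by (auto simp: projections_def closure)
  moreover have "Q o\<^sub>L (adj_op T o\<^sub>L T) = (adj_op T o\<^sub>L T) o\<^sub>L Q"
    by (rule comm) (simp_all add: T adj_simps)
  moreover have "Q o\<^sub>L E = Q" if l: "0 < l" and E: "E \<in> projections M" "T o\<^sub>L E = T" for E
  proof -
    have "adj_op T = E o\<^sub>L adj_op T" using arg_cong[OF E(2), of adj_op] T projD[OF E(1)]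
      by (simp add: adj_simps)
    then have QE: "Q o\<^sub>L E = E o\<^sub>L Q"
      using E T projD[OF E(1)] by (intro comm) (simp_all add: in_complex compose_assoc flip: compose_assoc[of E])
    have "Q (x - E x) = 0" for x
    proof -
      have "Q (x - E x) = Q x - E (Q x)"
        using compose_eq_apply[OF QE, of x] by (simp add: op_apply)
      moreover have "T (Q x - E (Q x)) = 0"
        using compose_eq_apply[OF E(2), of "Q x"] by (simp add: op_apply)
      ultimately have "l * norm (Q (x - E x)) \<le> 0" using Q1[of "x - E x"] by simp
      then show ?thesis using l by (simp add: mult_le_0_iff)
    qed
    then show ?thesis by (intro blinfun_eqI) (simp add: op_apply)
  qed
  ultimately show thesis using that Q1 Q2 by blast
qed

text \<open>On the range of \<open>P\<close> the operator \<open>P T\<^sup>* T P\<close> is invertible. Adding \<open>l\<^sup>2 (1 - P)\<close> makes it invertible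
  everywhere, and multiplying \<open>T P\<close> by the inverse square root of the sum gives the isometric part.\<close>

lemma polar_decomposition_below:
  assumes T: "T \<in> M" and P: "P \<in> projections M" and l: "0 < l"
    and lower: "\<And>x. l * norm (blinfun_apply P x) \<le> norm (blinfun_apply T (blinfun_apply P x))"
  obtains V R W where "V \<in> partial_isometries M" "adj_op V o\<^sub>L V = P" "R \<in> M" "W \<in> M"
    "V = T o\<^sub>L (P o\<^sub>L R)" "norm R \<le> 1 / l" "T o\<^sub>L P = V o\<^sub>L W"
proof -
  note PD = projD[OF P]
  define B where "B = (P o\<^sub>L (adj_op T o\<^sub>L (T o\<^sub>L P))) + l\<^sup>2 *\<^sub>R (id_blinfun - P)"
  have Bin: "B \<in> M" using T PD by (simp add: B_def closure)
  have Badj: "adj_op B = B" using T PD by (simp add: B_def adj_simps compose_assoc)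
  have q: "l\<^sup>2 * (norm x)\<^sup>2 \<le> Re (cinner (B x) x)" for x
  proof -
    have sq: "(norm x)\<^sup>2 = (norm (P x))\<^sup>2 + (norm (x - P x))\<^sup>2" for x
    proof -
      have "Re (cinner (P x) (x - P x)) = 0" using PD by (simp add: cinner_simps)
      then show ?thesis using power2_norm_add[of "P x" "x - P x"] by simp
    qed
    have "l\<^sup>2 * (norm (P x))\<^sup>2 \<le> (norm (T (P x)))\<^sup>2"
      using power_mono[OF lower[of x], of 2] l by (simp add: power_mult_distrib)
    then have "l\<^sup>2 * (norm x)\<^sup>2 \<le> (norm (T (P x)))\<^sup>2 + l\<^sup>2 * (norm (x - P x))\<^sup>2"
      unfolding sq[of x] by (simp add: distrib_left)
    also have "\<dots> = Re (cinner (B x) x)"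
      using PD cinner_adj_left[OF in_complex[OF T]]
      by (simp add: B_def op_apply cinner_simps power2_norm_eq)
    finally show ?thesis .
  qed
  obtain W S where W: "W \<in> generated_algebra B" and S: "S \<in> generated_algebra B" "adj_op S = S"
    and WW: "W o\<^sub>L W = B" and SW: "S o\<^sub>L W = id_blinfun" and nS: "norm S \<le> 1 / sqrt (l\<^sup>2)"
    using positive_square_root[OF in_complex[OF Bin] Badj _ q] l by (metis zero_less_power)
  have sub: "generated_algebra B \<subseteq> M" by (rule generated_algebra_subset[OF _ Bin]) unfold_locales
  have BP: "B o\<^sub>L P = P o\<^sub>L (adj_op T o\<^sub>L (T o\<^sub>L P))" and PB: "P o\<^sub>L B = B o\<^sub>L P"
    using PD by (auto intro!: blinfun_eqI simp: B_def op_apply)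
  have PS: "S o\<^sub>L P = P o\<^sub>L S"
    by (rule generated_algebra_commutes[OF S(1) in_complex[OF PD(1)] PB])
  have WS: "W o\<^sub>L S = id_blinfun" using generated_algebra_commute[OF in_complex[OF Bin] S(1) W] SW by simp
  have SBS: "S (B (S x)) = x" for x
    using compose_eq_apply[OF WW, of "S x"] compose_eq_apply[OF WS, of x] compose_eq_apply[OF SW, of x]
    by simp
  define V where "V = T o\<^sub>L (P o\<^sub>L S)"
  have Vin: "V \<in> M" using T PD S sub by (auto simp: V_def closure)
  have Sin: "S \<in> M" using S sub by blast
  have VV: "adj_op V o\<^sub>L V = P"
  proof (rule blinfun_eqI)
    fix x
    have "adj_op V = S o\<^sub>L (P o\<^sub>L adj_op T)"
      using T PD Sin S(2) by (simp add: V_def adj_simps compose_assoc)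
    then have "(adj_op V o\<^sub>L V) x = S (P (adj_op T (T (P (S x)))))" by (simp add: V_def)
    also have "\<dots> = S (B (P (S x)))" using compose_eq_apply[OF BP, of "S x"] by simp
    also have "\<dots> = S (B (S (P x)))" using compose_eq_apply[OF PS, of x] by simp
    finally show "(adj_op V o\<^sub>L V) x = P x" by (simp add: SBS)
  qed
  have "T o\<^sub>L P = V o\<^sub>L W"
    using compose_eq_apply[OF SW] by (auto intro!: blinfun_eqI simp: V_def)
  then show thesis
    using that[of V S W] VV Sin sub W nS l Vin P partial_isometryI[OF Vin] by (auto simp: V_def)
qed

text \<open>The polar part of \<open>A\<close> on a spectral projection of \<open>A\<^sup>* A\<close>. The last identity says that \<open>A\<close> maps the
  initial space of \<open>V\<close> into its final space and the complement of one into the complement of the other.\<close>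

lemma partial_isometry_in_range:
  assumes A: "A \<in> M" "A \<noteq> 0"
  obtains V where "V \<in> partial_isometries M" "V \<noteq> 0"
    "\<And>G. G \<in> projections M \<Longrightarrow> G o\<^sub>L A = A \<Longrightarrow> G o\<^sub>L V = V"
    "\<And>G. G \<in> projections M \<Longrightarrow> A o\<^sub>L G = A \<Longrightarrow> V o\<^sub>L G = V"
    "V o\<^sub>L (adj_op V o\<^sub>L A) = A o\<^sub>L (adj_op V o\<^sub>L V)"
proof -
  define l where "l = norm A / 2"
  have l: "0 < l" using A by (simp add: l_def)
  obtain Q where Q: "Q \<in> projections M"
    and Q1: "\<And>x. l * norm (Q x) \<le> norm (A (Q x))" and Q2: "\<And>x. norm (A (x - Q x)) \<le> l * norm (x - Q x)"
    and comm: "Q o\<^sub>L (adj_op A o\<^sub>L A) = (adj_op A o\<^sub>L A) o\<^sub>L Q"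
    and supp: "\<And>E. E \<in> projections M \<Longrightarrow> A o\<^sub>L E = A \<Longrightarrow> Q o\<^sub>L E = Q"
    using spectral_cut[OF A(1), of l] l by (metis less_imp_le)
  have "Q \<noteq> 0"
  proof
    assume "Q = 0"
    then have "norm A \<le> l" using Q2 l by (intro norm_blinfun_bound) auto
    then show False using l by (simp add: l_def)
  qed
  obtain V R W where V: "V \<in> partial_isometries M" "adj_op V o\<^sub>L V = Q"
    and R: "V = A o\<^sub>L (Q o\<^sub>L R)" "R \<in> M" and W: "A o\<^sub>L Q = V o\<^sub>L W"
    using polar_decomposition_below[OF A(1) Q l Q1] by metis
  note VD = partial_isometryD[OF V(1)] and QD = projD[OF Q]
  have VQ: "V o\<^sub>L Q = V" using VD(2) V(2) by simp
  show thesis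
  proof (rule that[OF V(1)])
    show "V \<noteq> 0" using V(2) \<open>Q \<noteq> 0\<close> by auto
    show "G o\<^sub>L V = V" if "G \<in> projections M" "G o\<^sub>L A = A" for G
      using R(1) that(2) by (metis compose_assoc)
    show "V o\<^sub>L G = V" if "G \<in> projections M" "A o\<^sub>L G = A" for G
      using supp[OF that] VQ by (metis compose_assoc)
    show "V o\<^sub>L (adj_op V o\<^sub>L A) = A o\<^sub>L (adj_op V o\<^sub>L V)"
    proof (rule blinfun_eqI)
      fix x
      have "A (Q x) = V (W x)" using compose_eq_apply[OF W, of x] by simp
      then have 1: "V (adj_op V (A (Q x))) = A (Q x)"
        using compose_eq_apply[OF VD(2), of "W x"] by simp
      have "adj_op V = adj_op R o\<^sub>L (Q o\<^sub>L adj_op A)"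
        using R A QD by (simp add: adj_simps compose_assoc)
      then have "adj_op V (A (x - Q x)) = adj_op R (Q (adj_op A (A (x - Q x))))" by simp
      also have "Q (adj_op A (A (x - Q x))) = 0"
        using compose_eq_apply[OF comm, of "x - Q x"] QD(4) by (simp add: op_apply)
      finally have "adj_op V (A (x - Q x)) = 0" by (simp add: op_apply)
      then have "V (adj_op V (A x)) = V (adj_op V (A (Q x)))" by (simp add: op_apply)
      then show "(V o\<^sub>L (adj_op V o\<^sub>L A)) x = (A o\<^sub>L (adj_op V o\<^sub>L V)) x" using 1 V(2) by simp
    qed
  qed
qed

lemma orthogonal_partial_sum:
  assumes U: "\<And>k::nat. U k \<in> partial_isometries M"
    and orth: "\<And>k m. k \<noteq> m \<Longrightarrow> adj_op (U k) o\<^sub>L U m = 0"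
  shows "(norm (blinfun_apply (\<Sum>k\<in>I. U k) x))\<^sup>2 = (\<Sum>k\<in>I. (norm (blinfun_apply (U k) x))\<^sup>2)"
proof (induction I rule: infinite_finite_induct)
  case (insert m I)
  have "cinner (U m x) (U k x) = 0" if "k \<in> I" for k
  proof -
    have "adj_op (U k) (U m x) = 0" using compose_eq_apply[OF orth[of k m], of x] that insert by auto
    then show ?thesis
      using cinner_adj_left[OF in_complex[OF partial_isometryD(1)[OF U[of k]]], of "U m x" x] by simp
  qed
  then have "cinner (U m x) (\<Sum>k\<in>I. U k x) = 0"
    by (simp add: bounded_bilinear.sum_right[OF bounded_bilinear_cinner])
  then have "cinner (U m x) ((\<Sum>k\<in>I. U k) x) = 0" by (simp add: blinfun.sum_left)
  then show ?case using insert by (simp add: op_apply power2_norm_add)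
qed simp_all

lemma orthogonal_projection_sum:
  fixes n :: nat
  assumes "\<And>k. k < n \<Longrightarrow> p k \<in> projections M" "\<And>k m. k < m \<Longrightarrow> m < n \<Longrightarrow> p k o\<^sub>L p m = 0"
  shows "(\<Sum>k<n. p k) \<in> projections M"
  using assms
proof (induction n)
  case (Suc n)
  have "(\<Sum>k<n. p k) o\<^sub>L p n = (\<Sum>k<n. p k o\<^sub>L p n)" by (rule compose_sum_left)
  also have "\<dots> = 0" using Suc.prems(2) by (intro sum.neutral) auto
  finally show ?case using proj_add[of "\<Sum>k<n. p k" "p n"] Suc by simp
qed (simp add: projections_def zero_in)

lemma adj_orthogonal_sym:
  assumes "S \<in> M" "T \<in> M"
  shows "adj_op S o\<^sub>L T = 0 \<Longrightarrow> adj_op T o\<^sub>L S = 0" "S o\<^sub>L adj_op T = 0 \<Longrightarrow> T o\<^sub>L adj_op S = 0"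
  using assms by (auto simp: adj_simps dest: arg_cong[of _ 0 adj_op])

text \<open>The initial projections of the \<open>U k\<close> have sums that are projections, so Bessel's inequality bounds
  the squares of the \<open>\<parallel>U k x\<parallel>\<close>, and orthogonality of the final spaces turns this into convergence.\<close>

lemma strong_sum_exists:
  assumes U: "\<And>k::nat. U k \<in> partial_isometries M"
    and orth: "\<And>k m. k \<noteq> m \<Longrightarrow> adj_op (U k) o\<^sub>L U m = 0"
    and orth': "\<And>k m. k \<noteq> m \<Longrightarrow> U k o\<^sub>L adj_op (U m) = 0"
  shows "\<exists>V\<in>M. \<forall>x. (\<lambda>k. blinfun_apply (U k) x) sums blinfun_apply V x"
proof -
  note UD = partial_isometryD[OF U]
  define p where "p k = adj_op (U k) o\<^sub>L U k" for k
  have p: "p k \<in> projections M" for k using UD by (simp add: p_def)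
  have pp: "p k o\<^sub>L p m = 0" if "k \<noteq> m" for k m
    using compose_eq_apply[OF orth'[OF that]] by (auto intro!: blinfun_eqI simp: p_def op_apply)
  have S: "(\<Sum>k<n. p k) \<in> projections M" for n
    by (rule orthogonal_projection_sum) (use p pp in auto)
  have bessel: "(\<Sum>k<n. (norm (U k x))\<^sup>2) \<le> (norm x)\<^sup>2" for n x
  proof -
    have "(norm (U k x))\<^sup>2 = Re (cinner (p k x) x)" for k
      using power2_norm_compose_adj[OF in_complex[OF UD(1)], of k x] by (simp add: p_def)
    then have "(\<Sum>k<n. (norm (U k x))\<^sup>2) = Re (cinner ((\<Sum>k<n. p k) x) x)"
      by (simp add: blinfun.sum_left bounded_bilinear.sum_left[OF bounded_bilinear_cinner])
    also have "\<dots> = (norm ((\<Sum>k<n. p k) x))\<^sup>2"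
      using projD[OF S[of n]] by (simp add: power2_norm_eq)
    also have "\<dots> \<le> (norm x)\<^sup>2" using proj_norm_apply[OF S] by (intro power_mono) auto
    finally show ?thesis .
  qed
  have norm_sum: "(norm (\<Sum>k\<in>I. U k x))\<^sup>2 = (\<Sum>k\<in>I. (norm (U k x))\<^sup>2)" for I x
    using orthogonal_partial_sum[of U I x, OF U orth] by (simp add: blinfun.sum_left)
  have summ: "summable (\<lambda>k. U k x)" for x
  proof -
    have s2: "summable (\<lambda>k. (norm (U k x))\<^sup>2)"
      using bessel by (intro summableI_nonneg_bounded[of _ "(norm x)\<^sup>2"]) auto
    show ?thesis unfolding summable_Cauchy
    proof safe
      fix e :: real assume e: "0 < e"
      then obtain N where N: "\<And>m n. m \<ge> N \<Longrightarrow> norm (\<Sum>k\<in>{m..<n}. (norm (U k x))\<^sup>2) < e\<^sup>2"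
        using s2 unfolding summable_Cauchy by (meson zero_less_power)
      have "norm (\<Sum>k\<in>{m..<n}. U k x) < e" if "m \<ge> N" for m n
      proof -
        have "(norm (\<Sum>k\<in>{m..<n}. U k x))\<^sup>2 < e\<^sup>2"
          using N[OF that, of n] by (simp add: norm_sum)
        then show ?thesis using e by (simp add: power2_less_imp_less)
      qed
      then show "\<exists>N. \<forall>m\<ge>N. \<forall>n. norm (\<Sum>k\<in>{m..<n}. U k x) < e" by blast
    qed
  qed
  define v where "v x = (\<Sum>k. U k x)" for x
  have sums: "(\<lambda>k. U k x) sums v x" for x using summ by (simp add: v_def summable_sums)
  have "bounded_linear v"
  proof (rule bounded_linear_intro[where K = 1])
    show "v (x + y) = v x + v y" for x y
      using sums_add[OF sums[of x] sums[of y]] sums[of "x + y"] by (simp add: op_apply sums_unique2)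
    show "v (r *\<^sub>R x) = r *\<^sub>R v x" for r x
      using sums_scaleR_right[OF sums[of x], of r] sums[of "r *\<^sub>R x"] by (simp add: op_apply sums_unique2)
    show "norm (v x) \<le> norm x * 1" for x
    proof (rule tendsto_upperbound)
      show "(\<lambda>n. norm (\<Sum>k<n. U k x)) \<longlonglongrightarrow> norm (v x)"
        using sums[of x] unfolding sums_def by (rule tendsto_norm)
      show "\<forall>\<^sub>F n in sequentially. norm (\<Sum>k<n. U k x) \<le> norm x * 1"
      proof (rule always_eventually, rule allI)
        fix n show "norm (\<Sum>k<n. U k x) \<le> norm x * 1"
          by (rule power2_le_imp_le) (use bessel[where n = n and x = x] norm_sum[where I = "{..<n}" and x = x] in auto)
      qed
    qed simp
  qed
  then have V: "Blinfun v x = v x" for x by (simp add: bounded_linear_Blinfun_apply)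
  have "Blinfun v \<in> M"
  proof (rule strong_limit_in)
    have "(\<Sum>k<n. U k) \<in> M" for n :: nat by (induction n) (simp_all add: closure UD)
    then show "(\<Sum>k<n. U k) \<in> M" for n .
    show "(\<lambda>n. (\<Sum>k<n. U k) x) \<longlonglongrightarrow> Blinfun v x" for x
      using sums[of x] by (simp add: sums_def V blinfun.sum_left)
  qed
  then show ?thesis using sums V by (intro bexI[of _ "Blinfun v"]) auto
qed

text \<open>The strong sums of the \<open>U k\<close> and of their adjoints are adjoint to each other, which makes the
  initial and final projections of the limit the strong sums of those of the \<open>U k\<close>.\<close>

lemma orthogonal_sum:
  assumes U: "\<And>k::nat. U k \<in> partial_isometries M"
    and orth: "\<And>k m. k \<noteq> m \<Longrightarrow> adj_op (U k) o\<^sub>L U m = 0"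
    and orth': "\<And>k m. k \<noteq> m \<Longrightarrow> U k o\<^sub>L adj_op (U m) = 0"
  shows "\<exists>V\<in>partial_isometries M.
    (\<forall>x. (\<lambda>k. blinfun_apply (U k) x) sums blinfun_apply V x) \<and>
    (\<forall>x. (\<lambda>k. adj_op (U k) (blinfun_apply (U k) x)) sums adj_op V (blinfun_apply V x)) \<and>
    (\<forall>x. (\<lambda>k. blinfun_apply (U k) (adj_op (U k) x)) sums blinfun_apply V (adj_op V x)) \<and>
    (\<forall>k. adj_op V o\<^sub>L U k = adj_op (U k) o\<^sub>L U k) \<and>
    (\<forall>k. U k o\<^sub>L (adj_op V o\<^sub>L V) = U k) \<and> (\<forall>k. V o\<^sub>L (adj_op V o\<^sub>L U k) = U k)"
proof -
  note UD = partial_isometryD[OF U]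
  have UM: "U k \<in> M" for k using UD by blast
  obtain V where V: "V \<in> M" and sV: "\<And>x. (\<lambda>k. U k x) sums V x"
    using strong_sum_exists[of U, OF U orth orth'] by blast
  obtain V' where V': "V' \<in> M" and sV': "\<And>x. (\<lambda>k. adj_op (U k) x) sums V' x"
    using strong_sum_exists[of "\<lambda>k. adj_op (U k)"] adj_partial_isometry[OF U] orth orth'
    by (auto simp: adj_simps UM)
  have "adj_op V = V'"
  proof (rule adj_op_eqI, rule sums_unique2)
    fix x y
    show "(\<lambda>k. cinner (U k x) y) sums cinner (V x) y"
      by (rule bounded_linear.sums[OF bounded_bilinear.bounded_linear_left[OF bounded_bilinear_cinner] sV])
    have "(\<lambda>k. cinner x (adj_op (U k) y)) sums cinner x (V' y)"
      by (rule bounded_linear.sums[OF bounded_bilinear.bounded_linear_right[OF bounded_bilinear_cinner] sV'])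
    then show "(\<lambda>k. cinner (U k x) y) sums cinner x (V' y)"
      by (simp add: cinner_adj_right in_complex UM)
  qed
  note sA = sV'[folded this]
  have single: "(\<lambda>j. if j = k then y else 0) sums y" for k :: nat and y :: 'h
    using sums_single[of k "\<lambda>_. y"] by simp
  have Vp: "V (adj_op (U k) x) = U k (adj_op (U k) x)" for k x
  proof (rule sums_unique2[OF sV])
    have "(\<lambda>j. U j (adj_op (U k) x)) = (\<lambda>j. if j = k then U k (adj_op (U k) x) else 0)"
      using compose_eq_apply[OF orth'] by (auto simp: fun_eq_iff)
    then show "(\<lambda>j. U j (adj_op (U k) x)) sums U k (adj_op (U k) x)" using single by simp
  qed
  have AU: "adj_op V (U k x) = adj_op (U k) (U k x)" for k x
  proof (rule sums_unique2[OF sA])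
    have "(\<lambda>j. adj_op (U j) (U k x)) = (\<lambda>j. if j = k then adj_op (U k) (U k x) else 0)"
      using compose_eq_apply[OF orth] by (auto simp: fun_eq_iff)
    then show "(\<lambda>j. adj_op (U j) (U k x)) sums adj_op (U k) (U k x)" using single by simp
  qed
  have VV: "(\<lambda>k. adj_op (U k) (U k x)) sums adj_op V (V x)" for x
    using bounded_linear.sums[OF blinfun.bounded_linear_right sV, of "adj_op V" x] by (simp add: AU)
  have VV': "(\<lambda>k. U k (adj_op (U k) x)) sums V (adj_op V x)" for x
    using bounded_linear.sums[OF blinfun.bounded_linear_right sA, of V x] by (simp add: Vp)
  have Upp: "U k (adj_op (U k) (U k x)) = U k x" for k x
    using compose_eq_apply[OF UD(2), of k x] by simp
  have "V (adj_op V (V x)) = V x" for x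
    using bounded_linear.sums[OF blinfun.bounded_linear_right VV, of V x] sV[of x]
    by (simp add: Vp Upp sums_unique2)
  then have Vpi: "V \<in> partial_isometries M"
    using V by (auto simp: partial_isometries_def intro!: blinfun_eqI)
  have VVU: "V o\<^sub>L (adj_op V o\<^sub>L U k) = U k" for k
    by (rule blinfun_eqI) (simp add: AU Vp Upp)
  have UVV: "U k o\<^sub>L (adj_op V o\<^sub>L V) = U k" for k
  proof -
    have "(adj_op V o\<^sub>L V) o\<^sub>L adj_op (U k) = adj_op (U k)"
      by (rule blinfun_eqI) (simp add: Vp AU compose_eq_apply[OF UD(3), simplified])
    from arg_cong[OF this, of adj_op] show ?thesis using V UM by (simp add: adj_simps)
  qed
  have "adj_op V o\<^sub>L U k = adj_op (U k) o\<^sub>L U k" for k by (rule blinfun_eqI) (simp add: AU)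
  then show ?thesis using Vpi sV VV VV' UVV VVU by blast
qed

end

section \<open>The trace of a projection\<close>

locale traced_factor = von_neumann +
  fixes \<tau> :: "('h::complex_hilbert_space) op \<Rightarrow> ennreal"
  assumes trace: "faithful_normal_semifinite_trace M \<tau>"
    and trivial_centre: "M \<inter> commutant M = range scalar_op"
    and no_abelian_projections: "abelian_projections M = {0}"
    and nontrivial: "id_blinfun \<noteq> (0 :: 'h op)"
begin

lemma trace_add: "S \<in> positive_part M \<Longrightarrow> T \<in> positive_part M \<Longrightarrow> \<tau> (S + T) = \<tau> S + \<tau> T"
  and trace_scaleR: "0 \<le> r \<Longrightarrow> T \<in> positive_part M \<Longrightarrow> \<tau> (r *\<^sub>R T) = ennreal r * \<tau> T"
  and trace_commute: "T \<in> M \<Longrightarrow> \<tau> (adj_op T o\<^sub>L T) = \<tau> (T o\<^sub>L adj_op T)"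
  and trace_faithful: "T \<in> positive_part M \<Longrightarrow> \<tau> T = 0 \<Longrightarrow> T = 0"
  and trace_semifinite: "T \<in> positive_part M \<Longrightarrow> T \<noteq> 0 \<Longrightarrow>
        \<exists>S\<in>positive_part M. S \<noteq> 0 \<and> le_op S T \<and> \<tau> S < \<infinity>"
proof -
  have w: "tracial_weight M \<tau>" "faithful_weight M \<tau>" "semifinite_weight M \<tau>"
    using trace unfolding faithful_normal_semifinite_trace_def by auto
  show "S \<in> positive_part M \<Longrightarrow> T \<in> positive_part M \<Longrightarrow> \<tau> (S + T) = \<tau> S + \<tau> T"
    "0 \<le> r \<Longrightarrow> T \<in> positive_part M \<Longrightarrow> \<tau> (r *\<^sub>R T) = ennreal r * \<tau> T"
    "T \<in> M \<Longrightarrow> \<tau> (adj_op T o\<^sub>L T) = \<tau> (T o\<^sub>L adj_op T)"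
    using w(1) by (simp_all add: tracial_weight_def)
  show "T \<in> positive_part M \<Longrightarrow> \<tau> T = 0 \<Longrightarrow> T = 0"
    using w(2) by (simp add: faithful_weight_def)
  show "T \<in> positive_part M \<Longrightarrow> T \<noteq> 0 \<Longrightarrow>
        \<exists>S\<in>positive_part M. S \<noteq> 0 \<and> le_op S T \<and> \<tau> S < \<infinity>"
    using w(3) by (simp add: semifinite_weight_def)
qed

lemma positive_part_square: "T \<in> M \<Longrightarrow> adj_op T o\<^sub>L T \<in> positive_part M"
  by (simp add: positive_part_def positive_op_def closure in_complex cinner_adj_left cinner_self)

lemma proj_positive: "E \<in> projections M \<Longrightarrow> E \<in> positive_part M"
  using positive_part_square[of E] projD[of E] by simp

lemma trace_zero: "\<tau> 0 = 0"
  using trace_scaleR[of 0 0] positive_part_square[OF zero_in] by simp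

lemma trace_proj_add:
  "E \<in> projections M \<Longrightarrow> F \<in> projections M \<Longrightarrow> \<tau> (E + F) = \<tau> E + \<tau> F"
  by (simp add: trace_add proj_positive)

lemma trace_proj_diff:
  assumes "E \<in> projections M" "F \<in> projections M" "E o\<^sub>L F = F"
  shows "\<tau> E = \<tau> (E - F) + \<tau> F"
  using trace_proj_add[OF proj_diff[OF assms] assms(2)] by simp

lemma trace_proj_mono:
  assumes "E \<in> projections M" "F \<in> projections M" "E o\<^sub>L F = F"
  shows "\<tau> F \<le> \<tau> E"
  using trace_proj_diff[OF assms] by simp

lemma trace_proj_pos: "E \<in> projections M \<Longrightarrow> E \<noteq> 0 \<Longrightarrow> 0 < \<tau> E"
  using trace_faithful[of E] proj_positive[of E] by (auto simp: zero_less_iff_neq_zero)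

lemma trace_projection_sum:
  fixes n :: nat
  assumes "\<And>k. k < n \<Longrightarrow> p k \<in> projections M" "\<And>k m. k < m \<Longrightarrow> m < n \<Longrightarrow> p k o\<^sub>L p m = 0"
  shows "\<tau> (\<Sum>k<n. p k) = (\<Sum>k<n. \<tau> (p k))"
  using assms
proof (induction n)
  case (Suc n)
  have "(\<Sum>k<n. p k) \<in> projections M" by (rule orthogonal_projection_sum) (use Suc.prems in auto)
  then show ?case using trace_proj_add[of "\<Sum>k<n. p k" "p n"] Suc by simp
qed (simp add: trace_zero)

text \<open>Choosing at each stage a partial isometry whose initial projection has at least half of the
  largest trace still possible exhausts the given class, because the traces have a bounded sum.\<close>

lemma exhausting_orthogonal_sequence:
  assumes UU: "\<U> \<subseteq> partial_isometries M" "0 \<in> \<U>" "\<And>U. U \<in> \<U> \<Longrightarrow> U o\<^sub>L P = U"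
    and P: "P \<in> projections M" "\<tau> P < \<infinity>"
  obtains U :: "nat \<Rightarrow> 'h op" where "\<And>k. U k \<in> \<U>"
    "\<And>k m. k \<noteq> m \<Longrightarrow> adj_op (U k) o\<^sub>L U m = 0" "\<And>k m. k \<noteq> m \<Longrightarrow> U k o\<^sub>L adj_op (U m) = 0"
    "\<And>W. W \<in> \<U> \<Longrightarrow> (\<And>k. adj_op (U k) o\<^sub>L W = 0) \<Longrightarrow> (\<And>k. W o\<^sub>L adj_op (U k) = 0) \<Longrightarrow> W = 0"
proof -
  define t where "t U = \<tau> (adj_op U o\<^sub>L U)" for U
  define C where "C S = {W \<in> \<U>. \<forall>V\<in>S. adj_op V o\<^sub>L W = 0 \<and> W o\<^sub>L adj_op V = 0}" for S
  have M: "U \<in> M" if "U \<in> \<U>" for U using that UU partial_isometryD by blast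
  have supp: "P o\<^sub>L (adj_op U o\<^sub>L U) = adj_op U o\<^sub>L U" if "U \<in> \<U>" for U
    using partial_isometry_support[of U P] UU that P by blast
  have t_le: "t U \<le> \<tau> P" if "U \<in> \<U>" for U
    unfolding t_def using supp[OF that] that UU partial_isometryD(4) P by (intro trace_proj_mono) auto
  have "\<exists>f. \<forall>n::nat. f n \<in> C (f ` {..<n}) \<and> (\<forall>W\<in>C (f ` {..<n}). t W \<le> 2 * t (f n))"
  proof (rule dependent_wellorder_choice)
    fix n :: nat and f g :: "nat \<Rightarrow> 'h op" and r
    assume "\<And>y. y < n \<Longrightarrow> f y = g y"
    then have "f ` {..<n} = g ` {..<n}" by auto
    then show "(r \<in> C (f ` {..<n}) \<and> (\<forall>W\<in>C (f ` {..<n}). t W \<le> 2 * t r)) =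
      (r \<in> C (g ` {..<n}) \<and> (\<forall>W\<in>C (g ` {..<n}). t W \<le> 2 * t r))" by simp
  next
    fix n :: nat and f :: "nat \<Rightarrow> 'h op"
    let ?C = "C (f ` {..<n})"
    have C0: "0 \<in> ?C" using UU by (simp add: C_def)
    \<comment> \<open>The supremum need not be attained, but half of it is exceeded unless it is zero.\<close>
    define s where "s = (SUP W\<in>?C. t W)"
    have ub: "t W \<le> s" if "W \<in> ?C" for W unfolding s_def using that by (rule SUP_upper)
    have "s \<le> \<tau> P" unfolding s_def using t_le by (intro SUP_least) (auto simp: C_def)
    then have fin: "s < \<infinity>" using P(2) by (rule order_le_less_trans)
    show "\<exists>r. r \<in> ?C \<and> (\<forall>W\<in>?C. t W \<le> 2 * t r)"
    proof (cases "s = 0")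
      case True
      then show ?thesis using C0 ub by (intro exI[of _ 0]) (auto intro: order_trans)
    next
      case False
      then have "s / 2 < s" using fin
        by (cases s) (auto simp: ennreal_divide_numeral ennreal_less_iff)
      then obtain r where r: "r \<in> ?C" "s / 2 < t r" unfolding s_def less_SUP_iff by blast
      have "s = 2 * (s / 2)" by (simp add: ennreal_times_divide mult.commute[of 2 s] ennreal_mult_divide_eq)
      also have "\<dots> \<le> 2 * t r" using r(2) by (intro mult_left_mono) auto
      finally show ?thesis using r(1) ub order_trans by blast
    qed
  qed
  then obtain U :: "nat \<Rightarrow> 'h op"
    where U0: "\<forall>n. U n \<in> C (U ` {..<n}) \<and> (\<forall>W\<in>C (U ` {..<n}). t W \<le> 2 * t (U n))"
    by (rule exE)
  have U: "U n \<in> C (U ` {..<n})" for n using U0 by simp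
  have tU: "t W \<le> 2 * t (U n)" if "W \<in> C (U ` {..<n})" for n W using U0 that by simp
  have UM: "U n \<in> \<U>" for n using U by (simp add: C_def)
  have lt: "adj_op (U k) o\<^sub>L U m = 0" "U m o\<^sub>L adj_op (U k) = 0" if "k < m" for k m
    using U[of m] that by (auto simp: C_def)
  have orth: "adj_op (U k) o\<^sub>L U m = 0" if "k \<noteq> m" for k m
    using lt(1)[of k m] adj_orthogonal_sym(1)[OF M[OF UM] M[OF UM] lt(1)[of m k]] that
    by (cases k m rule: linorder_cases) auto
  have orth': "U k o\<^sub>L adj_op (U m) = 0" if "k \<noteq> m" for k m
    using lt(2)[of m k] adj_orthogonal_sym(2)[OF M[OF UM] M[OF UM] lt(2)[of k m]] that
    by (cases k m rule: linorder_cases) auto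
  show thesis
  proof (rule that[OF UM orth orth'])
    fix W assume W: "W \<in> \<U>" "\<And>k. adj_op (U k) o\<^sub>L W = 0" "\<And>k. W o\<^sub>L adj_op (U k) = 0"
    define p where "p k = adj_op (U k) o\<^sub>L U k" for k
    have p: "p k \<in> projections M" and Pp: "P o\<^sub>L p k = p k" for k
      using UM UU partial_isometryD(4) supp[OF UM] by (auto simp: p_def)
    have pp: "p k o\<^sub>L p m = 0" if "k < m" for k m
      using compose_eq_apply[OF orth'[of k m]] that by (auto intro!: blinfun_eqI simp: p_def op_apply)
    have "(\<Sum>k<n. \<tau> (p k)) \<le> \<tau> P" for n
      using trace_proj_mono[OF P(1) orthogonal_projection_sum[of n p]] trace_projection_sum[of n p] p pp
      by (simp add: compose_sum_right Pp)
    moreover have "of_nat n * t W \<le> 2 * (\<Sum>k<n. \<tau> (p k))" for n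
    proof -
      have "t W \<le> 2 * \<tau> (p k)" for k using tU[of W k] W by (simp add: C_def t_def p_def)
      then have "(\<Sum>k<n. t W) \<le> (\<Sum>k<n. 2 * \<tau> (p k))" by (intro sum_mono)
      then show ?thesis by (simp add: sum_distrib_left)
    qed
    ultimately have le: "of_nat n * t W \<le> 2 * \<tau> P" for n
      by (meson mult_left_mono order_trans zero_le)
    have "t W = 0"
    proof -
      obtain a where a: "0 \<le> a" "t W = ennreal a" using t_le[OF W(1)] P(2) by (cases "t W") (auto simp: top_unique)
      obtain b where b: "0 \<le> b" "\<tau> P = ennreal b" using P(2) by (cases "\<tau> P") auto
      have "real n * a \<le> 2 * b" for n
        using le[of n] a b by (simp add: ennreal_of_nat_eq_real_of_nat flip: ennreal_mult ennreal_numeral)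
      then have "a = 0" using a(1) reals_Archimedean3[of a] by (metis less_eq_real_def not_less)
      then show ?thesis using a by simp
    qed
    then have "adj_op W o\<^sub>L W = 0"
      using trace_faithful[OF positive_part_square[OF M[OF W(1)]]] by (simp add: t_def)
    then show "W = 0" using adj_op_mult_self_eq_0[OF in_complex[OF M[OF W(1)]]] by blast
  qed
qed

section \<open>Comparison of projections in a factor\<close>

lemma projection_scalar_cases:
  assumes E: "E \<in> projections M" and c: "E = scalar_op c"
  shows "E = 0 \<or> E = id_blinfun"
proof (cases "E = 0")
  case False
  then obtain x where x: "E x \<noteq> 0" by (metis blinfun_eqI zero_blinfun.rep_eq)
  have "scaleC c (E x) = E x" using projD(4)[OF E, of x] by (simp add: c scalar_op.rep_eq)
  then have "scaleC (c - 1) (E x) = 0"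
    using scaleC_add_left[of c "-1" "E x"] by (simp add: scaleC_minus_left)
  then have "c = 1" using norm_scaleC[of "c - 1" "E x"] x by simp
  then show ?thesis using c by (auto intro!: blinfun_eqI simp: scalar_op.rep_eq)
qed simp

text \<open>The vectors \<open>y\<close> with \<open>Q T y = 0\<close> for all \<open>T \<in> M\<close> form a closed subspace that is invariant
  under \<open>M\<close> and under its commutant, so the projection onto it is central.\<close>

lemma factor_connects_projections:
  assumes P: "P \<in> projections M" "P \<noteq> 0" and Q: "Q \<in> projections M" "Q \<noteq> 0"
  shows "\<exists>T\<in>M. Q o\<^sub>L (T o\<^sub>L P) \<noteq> 0"
proof (rule ccontr)
  assume "\<not> ?thesis"
  then have zero: "Q (T (P x)) = 0" if "T \<in> M" for T x
    using that compose_eq_apply[of Q "T o\<^sub>L P" 0 x] by simp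
  define K where "K = {y. \<forall>T\<in>M. Q (T y) = 0}"
  have QM: "Q \<in> M" using Q projD by blast
  have K: "complex_subspace K" unfolding complex_subspace_def K_def
    by (auto simp: op_apply complex_operatorsD[OF in_complex] QM)
  have clK: "closed K"
  proof -
    have "K = (\<Inter>T\<in>M. {y. Q (blinfun_apply T y) = 0})" by (auto simp: K_def)
    moreover have "closed {y. Q (T y) = 0}" for T :: "'h op"
      by (intro closed_Collect_eq continuous_intros)
    ultimately show ?thesis by auto
  qed
  obtain Z where Z: "Z \<in> projections M" and ZK: "\<And>x. Z x \<in> K" "\<And>x. x \<in> K \<Longrightarrow> Z x = x"
    using projection_onto_invariant_subspace[OF K clK]
  proof -
    have "S x \<in> K" if "S \<in> commutant M" "x \<in> K" for S x
      using that commutes_apply[OF _ that(1)] by (auto simp: K_def QM op_apply)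
    then show ?thesis using that projection_onto_invariant_subspace[OF K clK] by metis
  qed
  note ZD = projD[OF Z]
  have inv: "T (Z x) = Z (T (Z x))" if "T \<in> M" for T x
  proof -
    have "Q (S (T (Z x))) = 0" if "S \<in> M" for S
      using ZK(1)[of x] compose_in[OF that \<open>T \<in> M\<close>] unfolding K_def
      by (metis (mono_tags, lifting) blinfun_apply_blinfun_compose mem_Collect_eq)
    then show ?thesis using ZK(2)[of "T (Z x)"] by (simp add: K_def)
  qed
  have "Z o\<^sub>L T = T o\<^sub>L Z" if T: "T \<in> M" for T
  proof -
    have "adj_op T o\<^sub>L Z = Z o\<^sub>L (adj_op T o\<^sub>L Z)" using inv[OF adj_in[OF T]] by (auto intro!: blinfun_eqI)
    from arg_cong[OF this, of adj_op] have "Z o\<^sub>L T = Z o\<^sub>L (T o\<^sub>L Z)"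
      using T ZD by (simp add: adj_simps compose_assoc)
    moreover have "T o\<^sub>L Z = Z o\<^sub>L (T o\<^sub>L Z)" using inv[OF T] by (auto intro!: blinfun_eqI)
    ultimately show ?thesis by simp
  qed
  then have "Z \<in> commutant M" using in_complex[OF ZD(1)] unfolding commutant_def by blast
  then have "Z \<in> M \<inter> commutant M" using ZD(1) by blast
  then have "Z \<in> range scalar_op" by (simp only: trivial_centre)
  then obtain c where "Z = scalar_op c" by (rule rangeE)
  then have "Z = 0 \<or> Z = id_blinfun" by (rule projection_scalar_cases[OF Z])
  then show False
  proof
    assume Z0: "Z = 0"
    have "P x = 0" for x using ZK(2)[of "P x"] zero by (simp add: K_def Z0)
    then show False using P(2) blinfun_eqI[of P 0] by simp
  next
    assume "Z = id_blinfun"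
    then have "Q x = 0" for x using ZK(1)[of x] id_in by (force simp: K_def)
    then show False using Q(2) blinfun_eqI[of Q 0] by simp
  qed
qed

text \<open>The sum of an exhausting sequence is maximal. The relation with \<open>A\<close> can be demanded of every term
  because both of its sides are strong sums. For \<open>A = 0\<close> it is void.\<close>

lemma maximal_partial_isometry:
  assumes P: "P \<in> projections M" "\<tau> P < \<infinity>" and Q: "Q \<in> projections M"
  obtains V where "V \<in> partial_isometries M" "V o\<^sub>L P = V" "Q o\<^sub>L V = V"
    "V o\<^sub>L (adj_op V o\<^sub>L A) = A o\<^sub>L (adj_op V o\<^sub>L V)"
    "\<And>W. W \<in> partial_isometries M \<Longrightarrow> W o\<^sub>L P = W \<Longrightarrow> Q o\<^sub>L W = W \<Longrightarrow>
      W o\<^sub>L (adj_op W o\<^sub>L A) = A o\<^sub>L (adj_op W o\<^sub>L W) \<Longrightarrow>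
      adj_op V o\<^sub>L W = 0 \<Longrightarrow> W o\<^sub>L adj_op V = 0 \<Longrightarrow> W = 0"
proof -
  define UU where "UU = {U \<in> partial_isometries M. U o\<^sub>L P = U \<and> Q o\<^sub>L U = U \<and>
     U o\<^sub>L (adj_op U o\<^sub>L A) = A o\<^sub>L (adj_op U o\<^sub>L U)}"
  have UU0: "UU \<subseteq> partial_isometries M" "0 \<in> UU" "\<And>U. U \<in> UU \<Longrightarrow> U o\<^sub>L P = U"
    by (auto simp: UU_def zero_partial_isometry)
  obtain U :: "nat \<Rightarrow> 'h op" where U: "\<And>k. U k \<in> UU"
    and orth: "\<And>k m. k \<noteq> m \<Longrightarrow> adj_op (U k) o\<^sub>L U m = 0" "\<And>k m. k \<noteq> m \<Longrightarrow> U k o\<^sub>L adj_op (U m) = 0"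
    and max: "\<And>W. W \<in> UU \<Longrightarrow> (\<And>k. adj_op (U k) o\<^sub>L W = 0) \<Longrightarrow> (\<And>k. W o\<^sub>L adj_op (U k) = 0) \<Longrightarrow> W = 0"
    using exhausting_orthogonal_sequence[OF UU0 P] by metis
  have Upi: "U k \<in> partial_isometries M" and UP: "U k (P x) = U k x" and QU: "Q (U k x) = U k x"
    and UA: "U k (adj_op (U k) (A x)) = A (adj_op (U k) (U k x))" for k x
    using U[of k] by (auto simp: UU_def dest: compose_eq_apply[where x = x])
  have UM: "U k \<in> M" for k using partial_isometryD[OF Upi] by blast
  obtain V where V: "V \<in> partial_isometries M" and sV: "\<And>x. (\<lambda>k. U k x) sums V x"
    and sVV: "\<And>x. (\<lambda>k. adj_op (U k) (U k x)) sums adj_op V (V x)"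
    and sVV': "\<And>x. (\<lambda>k. U k (adj_op (U k) x)) sums V (adj_op V x)"
    and UVV: "\<And>k. U k o\<^sub>L (adj_op V o\<^sub>L V) = U k" and VVU: "\<And>k. V o\<^sub>L (adj_op V o\<^sub>L U k) = U k"
    using orthogonal_sum[of U, OF Upi orth] by blast
  note VD = partial_isometryD[OF V] and image_sums = bounded_linear.sums[OF blinfun.bounded_linear_right]
  show thesis
  proof (rule that[OF V])
    show "V o\<^sub>L P = V"
      using sums_unique2[OF sV] sV by (intro blinfun_eqI) (simp add: UP)
    show "Q o\<^sub>L V = V"
      using sums_unique2[OF image_sums[OF sV, of Q]] sV by (intro blinfun_eqI) (simp add: QU)
    show "V o\<^sub>L (adj_op V o\<^sub>L A) = A o\<^sub>L (adj_op V o\<^sub>L V)"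
      using sums_unique2[OF sVV'] image_sums[OF sVV, of A] by (intro blinfun_eqI) (simp add: UA)
    fix W assume W: "W \<in> partial_isometries M" "W o\<^sub>L P = W" "Q o\<^sub>L W = W"
      "W o\<^sub>L (adj_op W o\<^sub>L A) = A o\<^sub>L (adj_op W o\<^sub>L W)" and 0: "adj_op V o\<^sub>L W = 0" "W o\<^sub>L adj_op V = 0"
    have "adj_op (U k) = adj_op (U k) o\<^sub>L (V o\<^sub>L adj_op V)" "adj_op (U k) = adj_op V o\<^sub>L (V o\<^sub>L adj_op (U k))" for k
      using arg_cong[OF VVU[of k], of adj_op] arg_cong[OF UVV[of k], of adj_op] UM[of k] VD(1)
      by (simp_all add: adj_simps compose_assoc)
    then have "adj_op (U k) o\<^sub>L W = 0" "W o\<^sub>L adj_op (U k) = 0" for k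
      using 0 by (metis compose_assoc compose_zero)+
    then show "W = 0" using W by - (rule max, simp_all add: UU_def)
  qed
qed

text \<open>If a maximal partial isometry between two projections left nonzero remainders of both, an
  element of the factor would connect the remainders, and its polar decomposition would give an
  extension.\<close>

lemma comparison:
  assumes P: "P \<in> projections M" "\<tau> P < \<infinity>" and Q: "Q \<in> projections M"
  obtains V where "V \<in> partial_isometries M" "V o\<^sub>L P = V" "Q o\<^sub>L V = V"
    "adj_op V o\<^sub>L V = P \<or> V o\<^sub>L adj_op V = Q"
proof -
  obtain V where V: "V \<in> partial_isometries M" and VP: "V o\<^sub>L P = V" and QV: "Q o\<^sub>L V = V"
    and max: "\<And>W. W \<in> partial_isometries M \<Longrightarrow> W o\<^sub>L P = W \<Longrightarrow> Q o\<^sub>L W = W \<Longrightarrow>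
      adj_op V o\<^sub>L W = 0 \<Longrightarrow> W o\<^sub>L adj_op V = 0 \<Longrightarrow> W = 0"
    using maximal_partial_isometry[OF P Q, of 0] by auto
  note VD = partial_isometryD[OF V] and PD = projD[OF P(1)] and QD = projD[OF Q]
  define P' where "P' = P - (adj_op V o\<^sub>L V)"
  define Q' where "Q' = Q - (V o\<^sub>L adj_op V)"
  have PV: "P o\<^sub>L (adj_op V o\<^sub>L V) = adj_op V o\<^sub>L V"
    using partial_isometry_support[OF V P(1)] VP by blast
  have P': "P' \<in> projections M" unfolding P'_def by (rule proj_diff[OF P(1) VD(4) PV])
  have Q': "Q' \<in> projections M" unfolding Q'_def
    by (rule proj_diff[OF Q VD(5)]) (use QV in \<open>simp flip: compose_assoc\<close>)
  have "P' = 0 \<or> Q' = 0"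
  proof (rule ccontr)
    assume "\<not> ?thesis"
    then obtain T where T: "T \<in> M" "Q' o\<^sub>L (T o\<^sub>L P') \<noteq> 0"
      using factor_connects_projections P' Q' by blast
    define A where "A = Q' o\<^sub>L (T o\<^sub>L P')"
    have A: "A \<in> M" "A \<noteq> 0" using T P' Q' projD by (auto simp: A_def closure)
    have QA: "Q' o\<^sub>L A = A" and AP: "A o\<^sub>L P' = A"
      using projD(4)[OF P'] projD(4)[OF Q'] by (auto intro!: blinfun_eqI simp: A_def)
    obtain W where W: "W \<in> partial_isometries M" "W \<noteq> 0"
      and ran: "\<And>G. G \<in> projections M \<Longrightarrow> G o\<^sub>L A = A \<Longrightarrow> G o\<^sub>L W = W"
      and sup: "\<And>G. G \<in> projections M \<Longrightarrow> A o\<^sub>L G = A \<Longrightarrow> W o\<^sub>L G = W"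
      using partial_isometry_in_range[OF A] by metis
    have QW: "Q' o\<^sub>L W = W" and WP: "W o\<^sub>L P' = W" using ran[OF Q' QA] sup[OF P' AP] .
    have "P' o\<^sub>L P = P'" "Q o\<^sub>L Q' = Q'"
      using PD(3) QD(3) VP compose_eq_apply[OF QV] compose_eq_apply[OF VP]
      by (auto intro!: blinfun_eqI simp: P'_def Q'_def op_apply PD(4) QD(4))
    then have "W o\<^sub>L P = W" "Q o\<^sub>L W = W" using QW WP by (metis compose_assoc)+
    moreover have "adj_op V o\<^sub>L Q' = 0" "P' o\<^sub>L adj_op V = 0"
      using arg_cong[OF QV, of adj_op] arg_cong[OF VP, of adj_op] VD PD QD
      by (simp_all add: P'_def Q'_def compose_diff_left compose_diff_right adj_simps compose_assoc)
    then have "adj_op V o\<^sub>L W = 0" "W o\<^sub>L adj_op V = 0" using QW WP by (metis compose_assoc compose_zero)+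
    ultimately show False using max W by blast
  qed
  then show thesis using that[OF V VP QV] by (auto simp: P'_def Q'_def)
qed

lemma comparison_strict:
  assumes P: "P \<in> projections M" "\<tau> P < \<tau> Q" and Q: "Q \<in> projections M"
  obtains V where "V \<in> partial_isometries M" "adj_op V o\<^sub>L V = P" "Q o\<^sub>L V = V"
proof -
  have fin: "\<tau> P < \<infinity>" using P(2) by (rule order_less_le_trans) simp
  obtain V where V: "V \<in> partial_isometries M" "V o\<^sub>L P = V" "Q o\<^sub>L V = V"
    "adj_op V o\<^sub>L V = P \<or> V o\<^sub>L adj_op V = Q"
    by (rule comparison[OF P(1) fin Q])
  have "V o\<^sub>L adj_op V \<noteq> Q"
  proof
    assume "V o\<^sub>L adj_op V = Q"
    then have "\<tau> Q = \<tau> (adj_op V o\<^sub>L V)" using trace_commute[OF partial_isometryD(1)[OF V(1)]] by simp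
    also have "\<dots> \<le> \<tau> P"
      using partial_isometry_support[OF V(1) P(1)] V(2)
      by (intro trace_proj_mono[OF P(1) partial_isometryD(4)[OF V(1)]]) blast
    finally show False using P(2) by simp
  qed
  then show thesis using that V by blast
qed

text \<open>Kaplansky's formula: the part of \<open>E \<or> F\<close> outside \<open>F\<close> is the closed range of \<open>A = (1 - F) E\<close>, hence
  equivalent to a subprojection of \<open>E\<close>.  The equivalence is a partial isometry \<open>V\<close> that is maximal
  among those compatible with \<open>A\<close>.  What remains of \<open>A\<close> off the final space of \<open>V\<close> must vanish,
  since its polar part would extend \<open>V\<close>, and so \<open>F + V V\<^sup>*\<close> lies above \<open>E\<close>.\<close>

lemma projection_join:
  assumes E: "E \<in> projections M" "\<tau> E < \<infinity>" and F: "F \<in> projections M"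
  obtains G where "G \<in> projections M" "G o\<^sub>L E = E" "G o\<^sub>L F = F" "\<tau> G \<le> \<tau> E + \<tau> F"
proof -
  note ED = projD[OF E(1)] and FD = projD[OF F]
  define A where "A = (id_blinfun - F) o\<^sub>L E"
  have A: "A \<in> M" using ED FD by (simp add: A_def closure)
  have AE: "A o\<^sub>L E = A" and FA: "F o\<^sub>L A = 0"
    using ED FD by (auto intro!: blinfun_eqI simp: A_def op_apply)
  obtain V where V: "V \<in> partial_isometries M" and VE: "V o\<^sub>L E = V"
    and FV: "(id_blinfun - F) o\<^sub>L V = V" and VA: "V o\<^sub>L (adj_op V o\<^sub>L A) = A o\<^sub>L (adj_op V o\<^sub>L V)"
    and max: "\<And>W. W \<in> partial_isometries M \<Longrightarrow> W o\<^sub>L E = W \<Longrightarrow> (id_blinfun - F) o\<^sub>L W = W \<Longrightarrow>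
      W o\<^sub>L (adj_op W o\<^sub>L A) = A o\<^sub>L (adj_op W o\<^sub>L W) \<Longrightarrow>
      adj_op V o\<^sub>L W = 0 \<Longrightarrow> W o\<^sub>L adj_op V = 0 \<Longrightarrow> W = 0"
    using maximal_partial_isometry[OF E proj_complement[OF F], of A] by blast
  note VD = partial_isometryD[OF V]
  have FV: "F o\<^sub>L V = 0" using FV by (simp add: compose_diff_left)
  have VA: "V (adj_op V (A x)) = A (adj_op V (V x))" for x using compose_eq_apply[OF VA, of x] by simp
  have VVV: "V (adj_op V (V x)) = V x" "adj_op V (V (adj_op V x)) = adj_op V x" for x
    using compose_eq_apply[OF VD(2), of x] compose_eq_apply[OF VD(3), of x] by auto
  define A' where "A' = A - (V o\<^sub>L (adj_op V o\<^sub>L A))"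
  have A'x: "A' x = A x - A (adj_op V (V x))" for x by (simp add: A'_def op_apply VA)
  have "A' = 0"
  proof (rule ccontr)
    assume "A' \<noteq> 0"
    moreover have "A' \<in> M" using A VD(1) by (simp add: A'_def closure)
    ultimately obtain W where W: "W \<in> partial_isometries M" "W \<noteq> 0"
      and ran: "\<And>G. G \<in> projections M \<Longrightarrow> G o\<^sub>L A' = A' \<Longrightarrow> G o\<^sub>L W = W"
      and sup: "\<And>G. G \<in> projections M \<Longrightarrow> A' o\<^sub>L G = A' \<Longrightarrow> W o\<^sub>L G = W"
      and WA: "W o\<^sub>L (adj_op W o\<^sub>L A') = A' o\<^sub>L (adj_op W o\<^sub>L W)"
      using partial_isometry_in_range[of A'] by metis
    note WD = partial_isometryD[OF W(1)]
    have "A' o\<^sub>L E = A'"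
      using compose_eq_apply[OF AE] by (auto intro!: blinfun_eqI simp: A'_def op_apply)
    then have WE: "W o\<^sub>L E = W" by (rule sup[OF E(1)])
    have "(id_blinfun - F) o\<^sub>L A' = A'"
      using compose_eq_apply[OF FA] compose_eq_apply[OF FV]
      by (auto intro!: blinfun_eqI simp: A'_def op_apply)
    then have FW: "(id_blinfun - F) o\<^sub>L W = W" by (rule ran[OF proj_complement[OF F]])
    have "(id_blinfun - (V o\<^sub>L adj_op V)) o\<^sub>L A' = A'"
      by (auto intro!: blinfun_eqI simp: A'_def op_apply VVV)
    then have "(id_blinfun - (V o\<^sub>L adj_op V)) o\<^sub>L W = W" by (rule ran[OF proj_complement[OF VD(5)]])
    then have VW0: "V o\<^sub>L (adj_op V o\<^sub>L W) = 0" by (simp add: compose_diff_left compose_assoc)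
    have "A' o\<^sub>L (id_blinfun - (adj_op V o\<^sub>L V)) = A'"
      by (auto intro!: blinfun_eqI simp: A'x op_apply VVV)
    then have "W o\<^sub>L (id_blinfun - (adj_op V o\<^sub>L V)) = W" by (rule sup[OF proj_complement[OF VD(4)]])
    then have WV0: "W o\<^sub>L (adj_op V o\<^sub>L V) = 0" by (simp add: compose_diff_right)
    have VW: "adj_op V (W x) = 0" for x
      using compose_eq_apply[OF VW0, of x] VVV(2)[of "W x"] by simp
    have WV: "W (adj_op V x) = 0" for x
      using compose_eq_apply[OF WV0, of "adj_op V x"] VVV(2)[of x] by simp
    have VW0: "adj_op V o\<^sub>L W = 0" and WV0: "W o\<^sub>L adj_op V = 0" using VW WV by (auto intro!: blinfun_eqI)
    have WV': "adj_op W (V x) = 0" and VW': "V (adj_op W x) = 0" for x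
      using compose_eq_apply[OF adj_orthogonal_sym(1)[OF VD(1) WD(1) VW0], of x]
        compose_eq_apply[OF adj_orthogonal_sym(2)[OF WD(1) VD(1) WV0], of x] by auto
    have "W o\<^sub>L (adj_op W o\<^sub>L A) = A o\<^sub>L (adj_op W o\<^sub>L W)"
    proof (rule blinfun_eqI)
      fix x
      have "W (adj_op W (A' x)) = A' (adj_op W (W x))" using compose_eq_apply[OF WA, of x] by simp
      then show "(W o\<^sub>L (adj_op W o\<^sub>L A)) x = (A o\<^sub>L (adj_op W o\<^sub>L W)) x"
        by (simp add: A'_def op_apply WV') (simp add: VA VW')
    qed
    then show False using max[OF W(1) WE FW _ VW0 WV0] W(2) by blast
  qed
  then have VVA: "V (adj_op V (A x)) = A x" for x
    using A'x[of x] VA[of x] by simp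
  define G where "G = F + (V o\<^sub>L adj_op V)"
  have G: "G \<in> projections M" unfolding G_def
    by (rule proj_add[OF F VD(5)]) (use FV in \<open>simp flip: compose_assoc\<close>)
  have "adj_op V o\<^sub>L F = 0"
    using arg_cong[OF FV, of adj_op] VD(1) FD by (simp add: adj_simps)
  then have VF: "adj_op V (F x) = 0" for x using compose_eq_apply[of "adj_op V" F 0 x] by simp
  have "G o\<^sub>L E = E"
  proof (rule blinfun_eqI)
    fix x
    have "V (adj_op V (E x - F (E x))) = E x - F (E x)" using VVA[of x] by (simp add: A_def op_apply)
    then show "(G o\<^sub>L E) x = E x" by (simp add: G_def op_apply VF)
  qed
  moreover have "G o\<^sub>L F = F" using FD VF by (auto intro!: blinfun_eqI simp: G_def op_apply)
  moreover have "\<tau> G \<le> \<tau> E + \<tau> F"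
  proof -
    have "\<tau> G = \<tau> F + \<tau> (V o\<^sub>L adj_op V)" unfolding G_def by (rule trace_proj_add[OF F VD(5)])
    also have "\<tau> (V o\<^sub>L adj_op V) = \<tau> (adj_op V o\<^sub>L V)" using trace_commute[OF VD(1)] by simp
    also have "\<dots> \<le> \<tau> E"
      using partial_isometry_support[OF V E(1)] VE by (intro trace_proj_mono[OF E(1) VD(4)]) auto
    finally show ?thesis by (simp add: add.commute)
  qed
  ultimately show thesis using that G by blast
qed

end

section \<open>Finite projections\<close>

lemma positive_op_self_adjoint:
  assumes "positive_op S"
  shows "adj_op S = S"
proof (rule adj_op_eqI)
  fix x y
  have S: "S \<in> complex_operators" and im: "\<And>x. Im (cinner (S x) x) = 0"
    using assms by (auto simp: positive_op_def)
  have "Im (cinner (S x) y) + Im (cinner (S y) x) = 0"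
    using im[of "x + y"] im[of x] im[of y] by (simp add: op_apply cinner_simps)
  moreover have "Re (cinner (S y) x) - Re (cinner (S x) y) = 0"
    using im[of "x + scaleC \<i> y"] im[of x] im[of y]
    by (simp add: op_apply cinner_simps complex_operatorsD[OF S])
  ultimately have "cinner (S x) y = cnj (cinner (S y) x)" by (simp add: complex_eq_iff)
  then show "cinner (S x) y = cinner x (S y)" by (subst (2) cinner_commute)
qed

context traced_factor
begin

text \<open>A positive \<open>S\<close> of finite trace dominates \<open>l Q\<close>, where \<open>Q\<close> is its spectral projection above
  \<open>l = \<parallel>S\<parallel> / 2\<close>.\<close>

lemma finite_trace_projection_exists:
  obtains P where "P \<in> projections M" "P \<noteq> 0" "\<tau> P < \<infinity>"
proof -
  obtain S where S: "S \<in> positive_part M" "S \<noteq> 0" "\<tau> S < \<infinity>"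
    using trace_semifinite[OF proj_positive[OF proj_id] nontrivial] by blast
  have SM: "S \<in> M" and pos: "positive_op S" using S by (auto simp: positive_part_def)
  have Sadj: "adj_op S = S" by (rule positive_op_self_adjoint[OF pos])
  have Sc: "S \<in> complex_operators" by (rule in_complex[OF SM])
  have im: "Im (cinner (S x) x) = 0" and re: "0 \<le> Re (cinner (S x) x)" for x
    using pos by (auto simp: positive_op_def)
  define l where "l = norm S / 2"
  have l: "0 < l" using S by (simp add: l_def)
  define A where "A = S - l *\<^sub>R id_blinfun"
  have A: "A \<in> M" "adj_op A = A" using SM Sadj by (simp_all add: A_def adj_simps)
  have Aq: "Re (cinner (A x) x) = Re (cinner (S x) x) - l * (norm x)\<^sup>2" for x
    by (simp add: A_def op_apply cinner_simps power2_norm_eq)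
  obtain Q where Q: "Q \<in> projections (generated_algebra A)"
    and Q1: "\<And>x. 0 \<le> Re (cinner (A (Q x)) (Q x))" and Q2: "\<And>x. Re (cinner (A (x - Q x)) (x - Q x)) \<le> 0"
    using positive_spectral_projection[OF in_complex[OF A(1)] A(2)] by metis
  have QM: "Q \<in> projections M"
    using Q generated_algebra_subset[OF von_neumann_axioms A(1)] by (auto simp: projections_def)
  note QD = projD[OF QM]
  have "S o\<^sub>L A = A o\<^sub>L S" by (simp add: A_def op_algebra)
  then have "Q o\<^sub>L S = S o\<^sub>L Q"
    using generated_algebra_commutes[of Q A S] Q Sc by (simp add: projections_def)
  then have QS: "Q (S x) = S (Q x)" for x by (metis blinfun_apply_blinfun_compose)
  have SQ: "cinner (S x) (Q y) = cinner (S (Q x)) y" for x y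
    using QD(5)[of "S x" y] QS by simp
  have "Q \<noteq> 0"
  proof
    assume "Q = 0"
    then have "Re (cinner (S x) x) \<le> l * (norm x)\<^sup>2" for x using Q2[of x] Aq[of x] by simp
    then have "norm S \<le> l" using re l by (intro norm_le_quadratic_form Sc Sadj) auto
    then show False using l by (simp add: l_def)
  qed
  moreover have "\<tau> Q < \<infinity>"
  proof -
    have pp: "B \<in> positive_part M" if "B \<in> M" "\<And>x. cinner (B x) x = cinner (S (G x)) (G x)" for B and G :: "'h op"
      using that im re by (simp add: positive_part_def positive_op_def in_complex)
    have 1: "Q o\<^sub>L S \<in> positive_part M"
      by (rule pp[of _ Q]) (use QD SM in \<open>auto simp: closure QS SQ\<close>)
    have 2: "S - (Q o\<^sub>L S) \<in> positive_part M"
      by (rule pp[of _ "id_blinfun - Q"])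
         (use QD SM in \<open>auto simp: closure QS SQ op_apply cinner_simps\<close>)
    have 3: "(Q o\<^sub>L S) - l *\<^sub>R Q \<in> positive_part M"
    proof -
      have "cinner (((Q o\<^sub>L S) - l *\<^sub>R Q) x) x = cinner (A (Q x)) (Q x)" for x
        using QD by (simp add: A_def op_apply cinner_simps QS SQ)
      moreover have "Im (cinner (A (Q x)) (Q x)) = 0" for x
        using im[of "Q x"] by (simp add: A_def op_apply cinner_simps cinner_self)
      ultimately show ?thesis
        using Q1 QD SM by (simp add: positive_part_def positive_op_def in_complex closure)
    qed
    have 4: "l *\<^sub>R Q \<in> positive_part M"
      using proj_positive[OF QM] l by (simp add: positive_part_def positive_op_def in_complex closure
          op_apply cinner_simps)
    have "ennreal l * \<tau> Q = \<tau> (l *\<^sub>R Q)" using trace_scaleR[of l Q] l proj_positive[OF QM] by simp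
    also have "\<dots> \<le> \<tau> (Q o\<^sub>L S)" using trace_add[OF 3 4] by simp
    also have "\<dots> \<le> \<tau> S" using trace_add[OF 2 1] by simp
    finally have "ennreal l * \<tau> Q < \<infinity>" using S(3) by (rule order_le_less_trans)
    then show ?thesis using l by (auto simp: ennreal_mult_less_top)
  qed
  ultimately show thesis using that QM by blast
qed

lemma le_op_proj_iff:
  assumes E: "E \<in> projections M" and F: "F \<in> projections M"
  shows "le_op F E \<longleftrightarrow> E o\<^sub>L F = F"
proof
  note ED = projD[OF E] and FD = projD[OF F]
  assume "le_op F E"
  have F_norm: "Re (cinner (- F y) y) = - (norm (F y))\<^sup>2" for y
    using FD(5)[of "F y" y] by (simp add: cinner_minus_left power2_norm_eq FD(4))
  have "F (x - E x) = 0" for x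
  proof -
    have "0 \<le> Re (cinner ((E - F) (x - E x)) (x - E x))"
      using \<open>le_op F E\<close> by (simp add: le_op_def positive_op_def)
    also have "(E - F) (x - E x) = - F (x - E x)" by (simp add: op_apply ED)
    also note F_norm
    finally show ?thesis by simp
  qed
  then have "F o\<^sub>L E = F" by (auto intro!: blinfun_eqI simp: op_apply)
  then show "E o\<^sub>L F = F" by (rule proj_absorb'[OF E F])
next
  assume "E o\<^sub>L F = F"
  then show "le_op F E"
    using proj_positive[OF proj_diff[OF E F]] by (simp add: le_op_def positive_part_def)
qed

text \<open>A projection of infinite trace contains infinitely many orthogonal copies of a projection of
  finite trace.  Shifting the copies makes it equivalent to a proper subprojection.\<close>

lemma infinite_trace_not_finite:
  assumes E: "E \<in> projections M" "\<tau> E = \<infinity>"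
  shows "E \<notin> finite_projections M"
proof
  assume fin: "E \<in> finite_projections M"
  note ED = projD[OF E(1)]
  obtain P where P: "P \<in> projections M" "P \<noteq> 0" "\<tau> P < \<infinity>"
    using finite_trace_projection_exists by blast
  have "\<exists>W. \<forall>n::nat. (W n \<in> partial_isometries M \<and> adj_op (W n) o\<^sub>L W n = P \<and> E o\<^sub>L W n = W n)
      \<and> (\<forall>k<n. adj_op (W k) o\<^sub>L W n = 0)"
  proof (rule dependent_wellorder_choice)
    fix n :: nat and W :: "nat \<Rightarrow> 'h op"
    assume "\<And>k. k < n \<Longrightarrow> (W k \<in> partial_isometries M \<and> adj_op (W k) o\<^sub>L W k = P \<and> E o\<^sub>L W k = W k)
      \<and> (\<forall>j<k. adj_op (W j) o\<^sub>L W k = 0)"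
    then have W: "W k \<in> partial_isometries M" and WP: "adj_op (W k) o\<^sub>L W k = P"
      and EW: "E o\<^sub>L W k = W k" and lt: "\<And>j. j < k \<Longrightarrow> adj_op (W j) o\<^sub>L W k = 0" if "k < n" for k
      using that by blast+
    note WD = partial_isometryD[OF W]
    have orth: "adj_op (W k) o\<^sub>L W m = 0" if "k < n" "m < n" "k \<noteq> m" for k m
      using lt[of m k] adj_orthogonal_sym(1)[OF WD(1) WD(1) lt[of k m]] that
      by (cases k m rule: linorder_cases) auto
    define S where "S = (\<Sum>k<n. W k o\<^sub>L adj_op (W k))"
    have q: "W k o\<^sub>L adj_op (W k) \<in> projections M" if "k < n" for k by (rule WD(5)[OF that])
    have qq: "(W k o\<^sub>L adj_op (W k)) o\<^sub>L (W m o\<^sub>L adj_op (W m)) = 0" if "k < m" "m < n" for k m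
      using compose_eq_apply[OF orth[of k m]] that by (auto intro!: blinfun_eqI simp: op_apply)
    have Sp: "S \<in> projections M" unfolding S_def by (rule orthogonal_projection_sum[OF q qq])
    have "\<tau> (W k o\<^sub>L adj_op (W k)) = \<tau> P" if "k < n" for k
      using trace_commute[OF WD(1)[OF that]] WP[OF that] by simp
    then have "\<tau> S = of_nat n * \<tau> P"
      using trace_projection_sum[of n "\<lambda>k. W k o\<^sub>L adj_op (W k)", OF q qq] by (simp add: S_def)
    then have "\<tau> S < \<infinity>" using P(3) by (simp add: ennreal_mult_less_top of_nat_less_top)
    moreover have ES: "E o\<^sub>L S = S"
      unfolding S_def compose_sum_right by (rule sum.cong) (simp_all add: EW flip: compose_assoc)
    ultimately have "\<tau> (E - S) = \<infinity>"
      using trace_proj_diff[OF E(1) Sp ES, symmetric] E(2) by (auto simp: ennreal_add_eq_top)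
    then have "\<tau> P < \<tau> (E - S)" using P(3) by simp
    then obtain V where V: "V \<in> partial_isometries M" "adj_op V o\<^sub>L V = P" "(E - S) o\<^sub>L V = V"
      using comparison_strict[OF P(1) _ proj_diff[OF E(1) Sp ES]] by blast
    have "E o\<^sub>L (E - S) = E - S" using ED(3) ES by (simp add: compose_diff_right)
    then have "E o\<^sub>L V = V" using V(3) by (metis compose_assoc)
    moreover have "adj_op (W k) o\<^sub>L V = 0" if k: "k < n" for k
    proof -
      have "adj_op (W k) o\<^sub>L S = (\<Sum>j<n. if j = k then adj_op (W k) else 0)"
        unfolding S_def compose_sum_right
      proof (rule sum.cong)
        fix j assume "j \<in> {..<n}"
        then have "adj_op (W k) o\<^sub>L W j = 0" if "j \<noteq> k" using orth[of k j] k that by simp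
        then show "adj_op (W k) o\<^sub>L (W j o\<^sub>L adj_op (W j)) = (if j = k then adj_op (W k) else 0)"
          using WD(3)[OF k] by (auto simp flip: compose_assoc)
      qed simp
      also have "\<dots> = adj_op (W k)" using k by simp
      finally have "adj_op (W k) o\<^sub>L (E - S) = 0"
        using arg_cong[OF EW[OF k], of adj_op] WD(1)[OF k] ED(1,2) by (simp add: compose_diff_right adj_simps)
      then show ?thesis using V(3) by (metis compose_assoc compose_zero(1))
    qed
    ultimately show "\<exists>V. (V \<in> partial_isometries M \<and> adj_op V o\<^sub>L V = P \<and> E o\<^sub>L V = V)
      \<and> (\<forall>k<n. adj_op (W k) o\<^sub>L V = 0)" using V by blast
  qed simp
  then obtain W where W: "\<And>n::nat. W n \<in> partial_isometries M" and WP: "\<And>n. adj_op (W n) o\<^sub>L W n = P"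
    and EWn: "\<And>n. E o\<^sub>L W n = W n" and lt: "\<And>k n. k < n \<Longrightarrow> adj_op (W k) o\<^sub>L W n = 0" by metis
  note WD = partial_isometryD[OF W]
  have WM: "W n \<in> M" for n by (rule WD)
  have WWW: "W n (adj_op (W n) (W n x)) = W n x" "adj_op (W n) (W n (adj_op (W n) x)) = adj_op (W n) x" for n x
    using compose_eq_apply[OF WD(2), of n x] compose_eq_apply[OF WD(3), of n x] by auto
  have WW0: "adj_op (W n) (W m x) = 0" if "n \<noteq> m" for n m x
    using compose_eq_apply[OF lt[of n m], of x] compose_eq_apply[OF adj_orthogonal_sym(1)[OF WM WM lt[of m n]], of x] that
    by (cases n m rule: linorder_cases) auto
  have PW: "adj_op (W n) (W n x) = P x" for n x using compose_eq_apply[OF WP, of n x] by simp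
  have WPx: "W n (P x) = W n x" "P (adj_op (W n) x) = adj_op (W n) x" for n x
    using WWW[of n x] by (simp_all add: PW)
  \<comment> \<open>\<open>U n\<close> carries the copy of \<open>P\<close> number \<open>n\<close> to the next one.\<close>
  define U where "U n = W (Suc n) o\<^sub>L adj_op (W n)" for n
  have UM: "U n \<in> M" for n using WM by (simp add: U_def closure)
  have Uadj: "adj_op (U n) = W n o\<^sub>L adj_op (W (Suc n))" for n
    using WM by (simp add: U_def adj_simps)
  have U: "U n \<in> partial_isometries M" for n
    using UM by (auto simp: partial_isometries_def Uadj intro!: blinfun_eqI) (simp add: U_def PW WPx)
  have o1: "adj_op (U k) o\<^sub>L U m = 0" if "k \<noteq> m" for k m
    using that by (auto intro!: blinfun_eqI simp: Uadj) (simp add: U_def WW0)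
  have o2: "U k o\<^sub>L adj_op (U m) = 0" if "k \<noteq> m" for k m
    using that by (auto intro!: blinfun_eqI simp: Uadj) (simp add: U_def WW0)
  obtain V where V: "V \<in> partial_isometries M" and sV: "\<And>x. (\<lambda>k. U k x) sums V x"
    and UVV: "\<And>k. U k o\<^sub>L (adj_op V o\<^sub>L V) = U k"
    using orthogonal_sum[of U, OF U o1 o2] by blast
  note VD = partial_isometryD[OF V]
  have map: "A (V x) = B x" if "\<And>k. A (U k x) = C (U k x)" "B = C o\<^sub>L V" for A B C :: "'h op" and x
    using bounded_linear.sums[OF blinfun.bounded_linear_right sV[of x], of A]
      bounded_linear.sums[OF blinfun.bounded_linear_right sV[of x], of C] that
    by (simp add: sums_unique2)
  have EW: "E (W n x) = W n x" for n x using compose_eq_apply[OF EWn, of n x] .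
  have EV: "E (V x) = V x" for x
    using map[of E x id_blinfun V] by (simp add: U_def EW)
  have VVq: "adj_op V (V (W n x)) = W n x" for n x
  proof -
    have "(adj_op V o\<^sub>L V) o\<^sub>L adj_op (U n) = adj_op (U n)"
      using arg_cong[OF UVV[of n], of adj_op] VD(1) UM by (simp add: adj_simps)
    from compose_eq_apply[OF this, of "W (Suc n) x"] show ?thesis
      by (simp add: Uadj PW WPx)
  qed
  have VVV: "adj_op V (V (V x)) = V x" for x
    using map[of "adj_op V o\<^sub>L V" x id_blinfun V] by (simp add: U_def VVq)
  have W0V: "adj_op (W 0) (V x) = 0" for x
    using map[of "adj_op (W 0)" x 0 0] by (simp add: U_def WW0)
  define G where "G = E - (adj_op V o\<^sub>L V)"
  have GM: "G \<in> M" using ED VD by (simp add: G_def closure)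
  have EVV: "E o\<^sub>L (adj_op V o\<^sub>L V) = adj_op V o\<^sub>L V"
  proof -
    have "U k (E x) = U k x" for k x
    proof -
      have "adj_op (W k) o\<^sub>L E = adj_op (W k)"
        using arg_cong[OF EWn[of k], of adj_op] WM[of k] ED(1,2) by (simp add: adj_simps)
      then show ?thesis using compose_eq_apply[of "adj_op (W k)" E] by (simp add: U_def)
    qed
    then have "V (E x) = V x" for x using sV[of "E x"] sV[of x] by (simp add: sums_unique2)
    then have "V o\<^sub>L E = V" by (auto intro!: blinfun_eqI)
    then show ?thesis using partial_isometry_support[OF V E(1)] by blast
  qed
  have Gp: "G \<in> projections M" unfolding G_def by (rule proj_diff[OF E(1) VD(4) EVV])
  have GV: "G o\<^sub>L V = 0" by (auto intro!: blinfun_eqI simp: G_def op_apply EV VVV)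
  have VG: "adj_op V o\<^sub>L G = 0"
    using arg_cong[OF GV, of adj_op] VD(1) projD[OF Gp] by (simp add: adj_simps)
  \<comment> \<open>The shift on the copies, extended by the identity on the rest of \<open>E\<close>.\<close>
  define X where "X = V + G"
  have X: "X \<in> M" using VD GM by (simp add: X_def closure)
  have XX: "adj_op X o\<^sub>L X = E"
    using VD(1) projD[OF Gp] GV VG by (simp add: X_def adj_simps compose_add_left compose_add_right) (simp add: G_def)
  then have Xpi: "X \<in> partial_isometries M" using partial_isometryI[OF X] E by simp
  note XD = partial_isometryD[OF Xpi]
  have EX: "E o\<^sub>L X = X" using ED compose_eq_apply[OF EVV]
    by (auto intro!: blinfun_eqI simp: X_def G_def op_apply EV)
  have "le_op (X o\<^sub>L adj_op X) E"
    using le_op_proj_iff[OF E(1) XD(5)] EX by (simp flip: compose_assoc)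
  moreover have "equivalent_projections M E (X o\<^sub>L adj_op X)"
    using X XX by (auto simp: equivalent_projections_def)
  ultimately have XE: "X o\<^sub>L adj_op X = E"
    using fin XD(5) unfolding finite_projections_def by blast
  have W0X: "adj_op (W 0) (X x) = 0" for x
  proof -
    have "(adj_op V o\<^sub>L V) o\<^sub>L W 0 = W 0" "E o\<^sub>L W 0 = W 0" by (auto intro!: blinfun_eqI simp: VVq EW)
    then have "G o\<^sub>L W 0 = 0" by (simp add: G_def compose_diff_left)
    from arg_cong[OF this, of adj_op] have "adj_op (W 0) o\<^sub>L G = 0"
      using WM[of 0] projD(1,2)[OF Gp] by (simp add: adj_simps)
    then show ?thesis using compose_eq_apply[of "adj_op (W 0)" G 0 x] by (simp add: X_def op_apply W0V)
  qed
  have "adj_op (W 0) (E x) = 0" for x using W0X[of "adj_op X x"] compose_eq_apply[OF XE, of x] by simp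
  from this[of "W 0 _"] have "P x = 0" for x by (simp add: EW PW)
  then show False using P(2) blinfun_eqI[of P 0] by simp
qed

lemma finite_projection_iff:
  assumes E: "E \<in> projections M"
  shows "E \<in> finite_projections M \<longleftrightarrow> \<tau> E < \<infinity>"
proof
  assume "E \<in> finite_projections M"
  then show "\<tau> E < \<infinity>"
    using infinite_trace_not_finite[OF E] by (metis infinity_ennreal_def top.not_eq_extremum)
next
  assume fin: "\<tau> E < \<infinity>"
  have "F = E" if F: "F \<in> projections M" and le: "le_op F E" and eq: "equivalent_projections M E F" for F
  proof -
    have EF: "E o\<^sub>L F = F" using le le_op_proj_iff[OF E F] by blast
    obtain V where V: "V \<in> M" "adj_op V o\<^sub>L V = E" "V o\<^sub>L adj_op V = F"
      using eq by (auto simp: equivalent_projections_def)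
    have "\<tau> E = \<tau> F" using trace_commute[OF V(1)] V by simp
    then have "\<tau> (E - F) = 0" using trace_proj_diff[OF E F EF] fin by auto
    then have "E - F = 0" using trace_faithful[OF proj_positive[OF proj_diff[OF E F EF]]] by blast
    then show ?thesis by simp
  qed
  then show "E \<in> finite_projections M" using E by (simp add: finite_projections_def)
qed

end

section \<open>Projections of small trace\<close>

context traced_factor
begin

text \<open>On a minimal projection \<open>P\<close> every spectral projection below \<open>P\<close> is \<open>0\<close> or \<open>P\<close>, so an element
  of \<open>M P\<close> is a multiple of an isometry on the range of \<open>P\<close>.\<close>

lemma minimal_projection_square_scalar:
  assumes P: "P \<in> projections M"
    and min: "\<And>Q. Q \<in> projections M \<Longrightarrow> P o\<^sub>L Q = Q \<Longrightarrow> Q = 0 \<or> Q = P"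
    and T: "T \<in> M" "T o\<^sub>L P = T"
  shows "adj_op T o\<^sub>L T = (norm T)\<^sup>2 *\<^sub>R P"
proof -
  note PD = projD[OF P]
  have TP: "T (P x) = T x" for x using compose_eq_apply[OF T(2)] by simp
  have lower: "l * norm (P x) \<le> norm (T x)" if l: "0 < l" "l < norm T" for l x
  proof -
    obtain Q where Q: "Q \<in> projections M" and Q1: "\<And>x. l * norm (Q x) \<le> norm (T (Q x))"
      and Q2: "\<And>x. norm (T (x - Q x)) \<le> l * norm (x - Q x)"
      and supp: "\<And>E. E \<in> projections M \<Longrightarrow> T o\<^sub>L E = T \<Longrightarrow> Q o\<^sub>L E = Q"
      using spectral_cut[OF T(1), of l] l by (metis less_imp_le)
    have "Q \<noteq> 0"
    proof
      assume "Q = 0"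
      then have "norm T \<le> l" using Q2 l by (intro norm_blinfun_bound) auto
      then show False using l by simp
    qed
    moreover have "P o\<^sub>L Q = Q" by (rule proj_absorb'[OF P Q supp[OF P T(2)]])
    ultimately have "Q = P" using min[OF Q] by blast
    then show ?thesis using Q1[of x] by (simp add: TP)
  qed
  have low: "norm T * norm (P x) \<le> norm (T x)" for x
  proof (cases "P x = 0 \<or> T = 0")
    case False
    then have pos: "0 < norm T" "0 < norm (P x)" by auto
    have "l \<le> norm (T x) / norm (P x)" if l: "0 < l" "l < norm T" for l
      using lower[OF l, of x] pos by (simp add: field_simps)
    then have "norm T \<le> norm (T x) / norm (P x)" by (rule dense_le_bounded[OF pos(1)])
    then show ?thesis using pos by (simp add: field_simps)
  qed auto
  have eq: "norm (T x) = norm T * norm (P x)" for x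
    using low[of x] norm_blinfun[of T "P x"] by (simp add: TP)
  define D where "D = (adj_op T o\<^sub>L T) - (norm T)\<^sup>2 *\<^sub>R P"
  have "norm D \<le> 0"
  proof (rule norm_le_quadratic_form)
    show "D \<in> complex_operators" using T PD by (simp add: D_def adj_simps)
    show "adj_op D = D" using T PD by (simp add: D_def adj_simps)
    have "Re (cinner (D x) x) = (norm (T x))\<^sup>2 - (norm T)\<^sup>2 * (norm (P x))\<^sup>2" for x
      using PD(5)[of x "P x"] power2_norm_compose_adj[OF in_complex[OF T(1)], of x]
      by (simp add: D_def op_apply cinner_simps power2_norm_eq[of "P x"] PD)
    then show "\<bar>Re (cinner (D x) x)\<bar> \<le> 0 * (norm x)\<^sup>2" for x
      by (simp add: eq power_mult_distrib)
  qed simp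
  then show ?thesis by (simp add: D_def)
qed

text \<open>For \<open>X\<close> in \<open>P M P\<close> the squares \<open>X\<^sup>* X\<close>, \<open>(X + P)\<^sup>* (X + P)\<close> and \<open>(X + \<i> P)\<^sup>* (X + \<i> P)\<close> are multiples of \<open>P\<close>.
  Expanding the last two shows that \<open>X\<^sup>* + X\<close> and \<open>X\<^sup>* - X\<close> are, hence also \<open>X\<close>.\<close>

lemma minimal_projection_abelian:
  assumes P: "P \<in> projections M"
    and min: "\<And>Q. Q \<in> projections M \<Longrightarrow> P o\<^sub>L Q = Q \<Longrightarrow> Q = 0 \<or> Q = P"
  shows "P \<in> abelian_projections M"
proof -
  note PD = projD[OF P]
  have sq: "\<exists>t. \<forall>x. adj_op T (T x) = t *\<^sub>R P x" if "T \<in> M" "T o\<^sub>L P = T" for T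
    using compose_eq_apply[OF minimal_projection_square_scalar[OF P min that]]
    by (auto simp: op_apply)
  have scalar: "\<exists>c. \<forall>x. P (S (P x)) = scaleC c (P x)" if S: "S \<in> M" for S
  proof -
    define X where "X = P o\<^sub>L (S o\<^sub>L P)"
    have X: "X \<in> M" "X o\<^sub>L P = X"
      using S PD by (auto simp: X_def closure compose_assoc)
    have Xx: "P (X x) = X x" "X (P x) = X x" for x by (simp_all add: X_def PD)
    have "adj_op X = P o\<^sub>L (adj_op S o\<^sub>L P)" using S PD(1,2) by (simp add: X_def adj_simps compose_assoc)
    then have AX: "P (adj_op X x) = adj_op X x" "adj_op X (P x) = adj_op X x" for x
      by (simp_all add: PD)
    define Y where "Y = X + (scalar_op \<i> o\<^sub>L P)"
    have Y: "Y \<in> M" "Y o\<^sub>L P = Y" using X PD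
      by (auto simp: Y_def closure compose_add_left compose_assoc)
    have Yadj: "adj_op Y = adj_op X + (P o\<^sub>L scalar_op (- \<i>))"
      using X PD by (simp add: Y_def adj_simps adj_scalar)
    have Z: "X + P \<in> M" "(X + P) o\<^sub>L P = X + P" using X PD by (auto simp: closure compose_add_left)
    have Zadj: "adj_op (X + P) = adj_op X + P" using X PD by (simp add: adj_simps)
    note Xc = complex_operatorsD[OF in_complex[OF X(1)]]
      complex_operatorsD[OF in_complex[OF adj_in[OF X(1)]]] complex_operatorsD[OF in_complex[OF PD(1)]]
    obtain t where t: "\<And>x. adj_op X (X x) = t *\<^sub>R P x" using sq[OF X] by blast
    obtain a where a: "\<And>x. adj_op (X + P) ((X + P) x) = a *\<^sub>R P x" using sq[OF Z] by blast
    obtain b where b: "\<And>x. adj_op Y (Y x) = b *\<^sub>R P x" using sq[OF Y] by blast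
    have 1: "adj_op X x + X x = (a - t - 1) *\<^sub>R P x" for x
      using a[of x] unfolding Zadj by (simp add: op_apply Xx AX t PD algebra_simps)
    have 2: "scaleC \<i> (adj_op X x) - scaleC \<i> (X x) = (b - t - 1) *\<^sub>R P x" for x
      using b[of x] unfolding Yadj
      by (simp add: op_apply Xx AX t PD Xc Y_def scalar_op.rep_eq scaleC_scaleC scaleC_minus_left
          scaleC_add_right algebra_simps)
    have 3: "scaleC (2 * \<i>) (X x) = scaleC (\<i> * of_real (a - t - 1) - of_real (b - t - 1)) (P x)" for x
    proof -
      have "scaleC \<i> (adj_op X x + X x) - (scaleC \<i> (adj_op X x) - scaleC \<i> (X x)) = scaleC (2 * \<i>) (X x)"
        using scaleC_add_left[of \<i> \<i> "X x"] by (simp add: scaleC_add_right)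
      moreover have "scaleC \<i> ((a - t - 1) *\<^sub>R P x) - (b - t - 1) *\<^sub>R P x
          = scaleC (\<i> * of_real (a - t - 1) - of_real (b - t - 1)) (P x)"
        using scaleC_add_left[of "\<i> * of_real (a - t - 1)" "- of_real (b - t - 1)" "P x"]
        by (simp only: scaleC_minus_left diff_conv_add_uminus scaleC_of_real flip: scaleC_scaleC)
      ultimately show ?thesis using 1[of x] 2[of x] by simp
    qed
    have "X x = scaleC (inverse (2 * \<i>)) (scaleC (2 * \<i>) (X x))" for x by (simp add: scaleC_scaleC)
    then have "X x = scaleC (inverse (2 * \<i>) * (\<i> * of_real (a - t - 1) - of_real (b - t - 1))) (P x)" for x
      by (simp only: 3 scaleC_scaleC)
    then show ?thesis by (auto simp: X_def)
  qed
  have "(P o\<^sub>L S o\<^sub>L P) o\<^sub>L (P o\<^sub>L T o\<^sub>L P) = (P o\<^sub>L T o\<^sub>L P) o\<^sub>L (P o\<^sub>L S o\<^sub>L P)"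
    if S: "S \<in> M" and T: "T \<in> M" for S T
  proof -
    obtain c where c: "\<And>x. P (S (P x)) = scaleC c (P x)" using scalar[OF S] by blast
    obtain d where d: "\<And>x. P (T (P x)) = scaleC d (P x)" using scalar[OF T] by blast
    show ?thesis
      by (rule blinfun_eqI)
         (simp add: c d PD complex_operatorsD[OF in_complex[OF PD(1)]] complex_operatorsD[OF in_complex[OF S]]
           complex_operatorsD[OF in_complex[OF T]] scaleC_scaleC mult.commute)
  qed
  then show ?thesis using P by (simp add: abelian_projections_def)
qed

text \<open>If the nonzero projections had traces bounded below, one with trace less than twice the
  infimum could not be split and would be minimal.\<close>

lemma small_projection_exists:
  assumes d: "0 < d"
  obtains P where "P \<in> projections M" "P \<noteq> 0" "\<tau> P < d"
proof (rule ccontr)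
  assume not: "\<not> thesis"
  note found = that
  have lb: "d \<le> \<tau> P" if "P \<in> projections M" "P \<noteq> 0" for P
    using found[OF that] not linorder_not_le by blast
  define m where "m = (INF P\<in>projections M - {0}. \<tau> P)"
  have "d \<le> m" unfolding m_def using lb by (intro INF_greatest) auto
  then have m0: "0 < m" using d by simp
  obtain P0 where "P0 \<in> projections M" "P0 \<noteq> 0" "\<tau> P0 < \<infinity>"
    using finite_trace_projection_exists by blast
  then have "m < \<infinity>" unfolding m_def by (meson DiffI INF_lower empty_iff insert_iff order_le_less_trans)
  then have "m < m + m" using m0 by (cases m) (auto simp: ennreal_less_iff simp flip: ennreal_plus)
  then obtain P where P: "P \<in> projections M" "P \<noteq> 0" "\<tau> P < m + m"
    unfolding m_def INF_less_iff by blast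
  have m_le: "m \<le> \<tau> Q" if "Q \<in> projections M" "Q \<noteq> 0" for Q
    unfolding m_def using that by (intro INF_lower) auto
  have "Q = 0 \<or> Q = P" if Q: "Q \<in> projections M" "P o\<^sub>L Q = Q" for Q
  proof (rule ccontr)
    assume "\<not> ?thesis"
    then have "m \<le> \<tau> Q" "m \<le> \<tau> (P - Q)" using m_le Q proj_diff[OF P(1) Q] by auto
    then have "m + m \<le> \<tau> P" unfolding trace_proj_diff[OF P(1) Q] by (rule add_mono[rotated])
    then show False using P(3) by simp
  qed
  then have "P \<in> abelian_projections M" by (rule minimal_projection_abelian[OF P(1)])
  then show False using P(2) no_abelian_projections by simp
qed

section \<open>The ideal of operators with finite support\<close>

text \<open>The unitary is \<open>U = A / 2 + \<i> sqrt (1 - A\<^sup>2 / 4)\<close>.  Halving \<open>A\<close> keeps the norm of \<open>A\<^sup>2 / 4\<close> below \<open>1\<close>, as the contraction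
  argument for the square root requires.\<close>

lemma unitary_real_part:
  assumes A: "A \<in> M" "adj_op A = A" "norm A \<le> 1"
  obtains U where "U \<in> unitaries M" "adj_op U \<in> unitaries M" "A = U + adj_op U"
proof -
  have Ac: "A \<in> complex_operators" by (rule in_complex[OF A(1)])
  note vn = von_neumann_generated_algebra[OF Ac A(2)]
  interpret W: von_neumann "generated_algebra A" by (rule vn)
  have Ain: "A \<in> generated_algebra A" by (rule self_in_generated_algebra[OF Ac])
  have sub: "generated_algebra A \<subseteq> M" by (rule generated_algebra_subset[OF von_neumann_axioms A(1)])
  define X where "X = (1/4) *\<^sub>R (A o\<^sub>L A)"
  have "norm (A o\<^sub>L A) \<le> 1"
    by (rule order_trans[OF norm_blinfun_compose]) (use A(3) mult_mono[of "norm A" 1 "norm A" 1] in simp)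
  then have nX: "norm X \<le> 1/4" by (simp add: X_def)
  have X: "X \<in> generated_algebra A" "adj_op X = X"
    using Ain A Ac by (simp_all add: X_def W.closure adj_scaleR adj_compose complex_operators_compose)
  obtain Y where Y: "Y \<in> generated_algebra A" "adj_op Y = Y"
    and YX: "(id_blinfun - Y) o\<^sub>L (id_blinfun - Y) = id_blinfun - X"
    using square_root_near_identity[OF vn X nX] by auto
  define R where "R = id_blinfun - Y"
  have R: "R \<in> generated_algebra A" "adj_op R = R" using Y by (simp_all add: R_def W.adj_simps)
  have RM: "R \<in> M" using R sub by blast
  have RR: "R (R x) = x - X x" for x using compose_eq_apply[OF YX, of x] by (simp add: R_def op_apply)
  have AR: "A (R x) = R (A x)" for x
    using generated_algebra_commute[OF Ac Ain R(1)] by (metis blinfun_apply_blinfun_compose)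
  note lin = complex_operatorsD[OF Ac] complex_operatorsD[OF in_complex[OF RM]]
  define U where "U = (1/2) *\<^sub>R A + (scalar_op \<i> o\<^sub>L R)"
  have UM: "U \<in> M" using A RM by (simp add: U_def closure)
  have Uadj: "adj_op U = (1/2) *\<^sub>R A + (R o\<^sub>L scalar_op (- \<i>))"
    using A RM R by (simp add: U_def adj_simps adj_scalar)
  have 1: "adj_op U (U x) = x" for x
    unfolding Uadj by (simp add: U_def op_apply scalar_op.rep_eq lin AR scaleC_scaleC scaleC_minus_left scaleC_scaleR
        scaleC_add_right RR X_def scaleR_diff_right scaleR_add_right)
  have 2: "U (adj_op U x) = x" for x
    unfolding Uadj by (simp add: U_def op_apply scalar_op.rep_eq lin AR scaleC_scaleC scaleC_minus_left scaleC_scaleR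
        scaleC_add_right RR X_def scaleR_diff_right scaleR_add_right)
  have UU: "adj_op U o\<^sub>L U = id_blinfun" "U o\<^sub>L adj_op U = id_blinfun"
    using 1 2 by (auto intro!: blinfun_eqI)
  have "A = U + adj_op U"
    by (rule blinfun_eqI)
       (unfold Uadj, simp add: U_def op_apply scalar_op.rep_eq lin scaleC_minus_left flip: scaleR_add_left)
  then show thesis using that[of U] UU UM by (simp add: unitaries_def adj_simps)
qed

lemma norm_scalar_compose:
  "norm (scalar_op a o\<^sub>L T) \<le> cmod a * norm T" for T :: "'h op"
  by (rule norm_blinfun_bound)
     (auto simp: scalar_op.rep_eq norm_scaleC mult.assoc intro!: mult_left_mono norm_blinfun)

lemma four_unitaries:
  assumes A: "A \<in> M" "norm A \<le> 1"
  obtains U1 U2 U3 U4 where "{U1, U2, U3, U4} \<subseteq> unitaries M"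
    "A = (U1 + U2) + (scalar_op \<i> o\<^sub>L (U3 + U4))"
proof -
  define A1 where "A1 = (1/2) *\<^sub>R (A + adj_op A)"
  define A2 where "A2 = scalar_op (- (\<i> / 2)) o\<^sub>L (A - adj_op A)"
  have A1: "A1 \<in> M" "adj_op A1 = A1" using A by (simp_all add: A1_def adj_simps add.commute)
  have A2: "A2 \<in> M" using A by (simp add: A2_def closure)
  note lin = complex_operatorsD[OF in_complex[OF A(1)]] complex_operatorsD[OF in_complex[OF adj_in[OF A(1)]]]
  have A2adj: "adj_op A2 = A2"
  proof -
    have "adj_op A2 = (adj_op A - A) o\<^sub>L scalar_op (\<i> / 2)"
      using A by (simp add: A2_def adj_simps adj_scalar)
    then show ?thesis
      by (auto intro!: blinfun_eqI simp: A2_def op_apply scalar_op.rep_eq lin scaleC_diff_right scaleC_minus_left)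
  qed
  have nA: "norm (adj_op A) \<le> 1" using A norm_adj[OF in_complex] by simp
  have n1: "norm A1 \<le> 1"
    using norm_triangle_ineq[of A "adj_op A"] A nA by (simp add: A1_def)
  have "norm A2 \<le> cmod (- (\<i> / 2)) * norm (A - adj_op A)" unfolding A2_def by (rule norm_scalar_compose)
  also have "\<dots> \<le> 1" using norm_triangle_ineq4[of A "adj_op A"] A nA by (simp add: norm_divide)
  finally have n2: "norm A2 \<le> 1" .
  have AA: "A = A1 + (scalar_op \<i> o\<^sub>L A2)"
  proof (rule blinfun_eqI)
    fix x
    have "scaleC (1/2) y = (1/2) *\<^sub>R y" for y :: 'h using scaleC_of_real[of "1/2" y] by simp
    then show "A x = (A1 + (scalar_op \<i> o\<^sub>L A2)) x"
      by (simp add: A1_def A2_def op_apply scalar_op.rep_eq scaleC_scaleC algebra_simps flip: scaleR_add_left)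
  qed
  obtain U V where U: "U \<in> unitaries M" "adj_op U \<in> unitaries M" "A1 = U + adj_op U"
    using unitary_real_part[OF A1 n1] by blast
  obtain V where V: "V \<in> unitaries M" "adj_op V \<in> unitaries M" "A2 = V + adj_op V"
    using unitary_real_part[OF A2 A2adj n2] by blast
  show thesis by (rule that[of U "adj_op U" V "adj_op V"]) (use U V AA in auto)
qed

end

lemma scaleR_eq_scalar_op: "r *\<^sub>R T = scalar_op (complex_of_real r) o\<^sub>L T"
  by (rule blinfun_eqI) (simp add: scalar_op.rep_eq scaleC_of_real op_apply)

locale normed_ideal = traced_factor +
  fixes \<nu> :: "('h::complex_hilbert_space) op \<Rightarrow> real"
  assumes invariant_norm: "unitarily_invariant_norm M \<nu>"
begin

lemma J_idealI:
  assumes "T \<in> M" "E \<in> projections M" "\<tau> E < \<infinity>" "E o\<^sub>L T = T" "T o\<^sub>L E = T"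
  shows "T \<in> J_ideal M"
  using assms finite_projection_iff[OF assms(2)]
  unfolding J_ideal_def by (metis (mono_tags, lifting) mem_Collect_eq)

lemma J_idealE:
  assumes "T \<in> J_ideal M"
  obtains E where "E \<in> projections M" "\<tau> E < \<infinity>" "E o\<^sub>L T = T" "T o\<^sub>L E = T"
proof -
  obtain E where E: "E \<in> finite_projections M" "T = E o\<^sub>L T o\<^sub>L E"
    using assms by (auto simp: J_ideal_def)
  have Ep: "E \<in> projections M" using E by (simp add: finite_projections_def)
  have "E (T x) = T x" "T (E x) = T x" for x
    by (subst (1 2) E(2), simp add: projD[OF Ep])+
  then have "E o\<^sub>L T = T" "T o\<^sub>L E = T" by (auto intro!: blinfun_eqI)
  then show thesis using that[OF Ep] finite_projection_iff[OF Ep] E(1) by blast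
qed

lemma J_in: "T \<in> J_ideal M \<Longrightarrow> T \<in> M"
  by (simp add: J_ideal_def)

lemma projection_in_J: "E \<in> projections M \<Longrightarrow> \<tau> E < \<infinity> \<Longrightarrow> E \<in> J_ideal M"
  using projD[of E] by (intro J_idealI) auto

lemma zero_in_J: "0 \<in> J_ideal M"
  by (rule J_idealI[of 0 0]) (auto simp: closure projections_def trace_zero)

text \<open>The join of the left support \<open>E\<close> and the right support \<open>F\<close> is a two-sided support of finite trace.\<close>

lemma J_ideal_two_supports:
  assumes T: "T \<in> M" and E: "E \<in> projections M" "\<tau> E < \<infinity>" "E o\<^sub>L T = T"
    and F: "F \<in> projections M" "\<tau> F < \<infinity>" "T o\<^sub>L F = T"
  shows "T \<in> J_ideal M"
proof -
  obtain G where G: "G \<in> projections M" "G o\<^sub>L E = E" "G o\<^sub>L F = F" "\<tau> G \<le> \<tau> E + \<tau> F"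
    using projection_join[OF E(1,2) F(1)] by blast
  show ?thesis
  proof (rule J_idealI[OF T G(1)])
    show "\<tau> G < \<infinity>" using G(4) E(2) F(2) by (auto intro: order_le_less_trans)
    show "G o\<^sub>L T = T" using G(2) E(3) by (metis compose_assoc)
    show "T o\<^sub>L G = T" using proj_absorb[OF G(1) F(1) G(3)] F(3) by (metis compose_assoc)
  qed
qed

lemma J_add:
  assumes S: "S \<in> J_ideal M" and T: "T \<in> J_ideal M"
  shows "S + T \<in> J_ideal M"
proof -
  obtain E where E: "E \<in> projections M" "\<tau> E < \<infinity>" "E o\<^sub>L S = S" "S o\<^sub>L E = S"
    using S by (rule J_idealE)
  obtain F where F: "F \<in> projections M" "\<tau> F < \<infinity>" "F o\<^sub>L T = T" "T o\<^sub>L F = T"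
    using T by (rule J_idealE)
  obtain G where G: "G \<in> projections M" "G o\<^sub>L E = E" "G o\<^sub>L F = F" "\<tau> G \<le> \<tau> E + \<tau> F"
    using projection_join[OF E(1,2) F(1)] by blast
  have 1: "G o\<^sub>L S = S" "G o\<^sub>L T = T" using G E F by (metis compose_assoc)+
  have 2: "S o\<^sub>L G = S" "T o\<^sub>L G = T"
    using proj_absorb[OF G(1) E(1) G(2)] proj_absorb[OF G(1) F(1) G(3)] E F by (metis compose_assoc)+
  show ?thesis
  proof (rule J_idealI[OF _ G(1)])
    show "\<tau> G < \<infinity>" using G(4) E(2) F(2) by (auto intro: order_le_less_trans)
  qed (use 1 2 S T in \<open>auto simp: compose_add_left compose_add_right add_in J_in\<close>)
qed

lemma J_scalar:
  assumes T: "T \<in> J_ideal M"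
  shows "scalar_op a o\<^sub>L T \<in> J_ideal M"
proof -
  obtain E where E: "E \<in> projections M" "\<tau> E < \<infinity>" "E o\<^sub>L T = T" "T o\<^sub>L E = T"
    using T by (rule J_idealE)
  have "E o\<^sub>L (scalar_op a o\<^sub>L T) = scalar_op a o\<^sub>L T"
    using compose_eq_apply[OF E(3)]
    by (auto intro!: blinfun_eqI simp: scalar_op.rep_eq complex_operatorsD[OF in_complex[OF projD(1)[OF E(1)]]])
  then show ?thesis using E J_in[OF T] by (intro J_idealI[OF _ E(1,2)]) (auto simp: closure compose_assoc)
qed

lemma J_uminus: "T \<in> J_ideal M \<Longrightarrow> - T \<in> J_ideal M"
  using J_scalar[of T "-1"] scaleR_eq_scalar_op[of "-1" T] by simp

lemma J_diff: "S \<in> J_ideal M \<Longrightarrow> T \<in> J_ideal M \<Longrightarrow> S - T \<in> J_ideal M"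
  using J_add[of S "- T"] J_uminus[of T] by simp

lemma unitary_conjugate:
  assumes U: "U \<in> unitaries M" and E: "E \<in> projections M"
  shows "U o\<^sub>L (E o\<^sub>L adj_op U) \<in> projections M" "\<tau> (U o\<^sub>L (E o\<^sub>L adj_op U)) = \<tau> E"
proof -
  note ED = projD[OF E]
  have UM: "U \<in> M" and UU: "adj_op U (U x) = x" for x
    using U compose_eq_apply[of "adj_op U" U id_blinfun x] by (auto simp: unitaries_def)
  show "U o\<^sub>L (E o\<^sub>L adj_op U) \<in> projections M"
    by (rule projI) (use UM ED in \<open>auto simp: adj_simps compose_assoc UU intro!: blinfun_eqI\<close>)
  have "\<tau> E = \<tau> (adj_op (U o\<^sub>L E) o\<^sub>L (U o\<^sub>L E))"
    by (rule arg_cong[of _ _ \<tau>]) (use UM ED in \<open>auto simp: adj_simps UU intro!: blinfun_eqI\<close>)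
  also have "\<dots> = \<tau> ((U o\<^sub>L E) o\<^sub>L adj_op (U o\<^sub>L E))" using UM ED by (intro trace_commute) (simp add: closure)
  also have "(U o\<^sub>L E) o\<^sub>L adj_op (U o\<^sub>L E) = U o\<^sub>L (E o\<^sub>L adj_op U)"
    using UM ED by (auto simp: adj_simps intro!: blinfun_eqI)
  finally show "\<tau> (U o\<^sub>L (E o\<^sub>L adj_op U)) = \<tau> E" by simp
qed

lemma J_unitary:
  assumes U: "U \<in> unitaries M" and T: "T \<in> J_ideal M"
  shows "U o\<^sub>L T \<in> J_ideal M" "T o\<^sub>L U \<in> J_ideal M"
proof -
  have UM: "U \<in> M" and UU: "adj_op U (U x) = x" "U (adj_op U x) = x" for x
    using U compose_eq_apply[of "adj_op U" U id_blinfun x] compose_eq_apply[of U "adj_op U" id_blinfun x]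
    by (auto simp: unitaries_def)
  have U': "adj_op U \<in> unitaries M" using U by (simp add: unitaries_def adj_simps)
  obtain E where E: "E \<in> projections M" "\<tau> E < \<infinity>" "E o\<^sub>L T = T" "T o\<^sub>L E = T"
    using T by (rule J_idealE)
  have ET: "E (T x) = T x" "T (E x) = T x" for x
    using compose_eq_apply[OF E(3)] compose_eq_apply[OF E(4)] by auto
  have "adj_op (adj_op U) = U" using UM by (simp add: adj_simps)
  note conj' = unitary_conjugate[OF U' E(1), unfolded this]
  show "U o\<^sub>L T \<in> J_ideal M"
    by (rule J_ideal_two_supports[OF _ unitary_conjugate(1)[OF U E(1)] _ _ E(1,2)])
       (use E UM J_in[OF T] in \<open>auto simp: closure unitary_conjugate[OF U E(1)] UU ET intro!: blinfun_eqI\<close>)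
  show "T o\<^sub>L U \<in> J_ideal M"
    by (rule J_ideal_two_supports[OF _ E(1,2) _ conj'(1)])
       (use E UM J_in[OF T] in \<open>auto simp: closure conj'(2) UU ET intro!: blinfun_eqI\<close>)
qed

section \<open>Unitarily invariant norms\<close>

lemma norm_J: "norm_on_J M \<nu>"
  using invariant_norm by (simp add: unitarily_invariant_norm_def)

lemma nu_nonneg: "T \<in> J_ideal M \<Longrightarrow> 0 \<le> \<nu> T"
  and nu_eq_0: "T \<in> J_ideal M \<Longrightarrow> \<nu> T = 0 \<longleftrightarrow> T = 0"
  and nu_scalar: "T \<in> J_ideal M \<Longrightarrow> \<nu> (scalar_op a o\<^sub>L T) = cmod a * \<nu> T"
  and nu_triangle: "S \<in> J_ideal M \<Longrightarrow> T \<in> J_ideal M \<Longrightarrow> \<nu> (S + T) \<le> \<nu> S + \<nu> T"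
  using norm_J by (simp_all add: norm_on_J_def)

lemma nu_zero: "\<nu> 0 = 0"
  using nu_eq_0[OF zero_in_J] by simp

lemma nu_uminus: "T \<in> J_ideal M \<Longrightarrow> \<nu> (- T) = \<nu> T"
  using nu_scalar[of T "-1"] scaleR_eq_scalar_op[of "-1" T] by simp

lemma nu_unitary:
  assumes "U \<in> unitaries M" "T \<in> J_ideal M"
  shows "\<nu> (U o\<^sub>L T) = \<nu> T" "\<nu> (T o\<^sub>L U) = \<nu> T"
proof -
  have id: "id_blinfun \<in> unitaries M" by (simp add: unitaries_def closure)
  have inv: "\<nu> (U o\<^sub>L T o\<^sub>L V) = \<nu> T" if "U \<in> unitaries M" "V \<in> unitaries M" for U V
    using invariant_norm that assms(2) by (simp add: unitarily_invariant_norm_def)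
  show "\<nu> (U o\<^sub>L T) = \<nu> T" "\<nu> (T o\<^sub>L U) = \<nu> T" using inv[OF assms(1) id] inv[OF id assms(1)] by simp_all
qed

text \<open>Multiplication by a fixed element of the ideal, from the left or from the right, is additive and
  homogeneous, so an estimate on unitaries extends to all of \<open>M\<close>.\<close>

lemma bound_from_unitaries:
  fixes f :: "'h op \<Rightarrow> 'h op"
  assumes f: "\<And>S T. f (S + T) = f S + f T" "\<And>a S. f (scalar_op a o\<^sub>L S) = scalar_op a o\<^sub>L f S"
    and fU: "\<And>U. U \<in> unitaries M \<Longrightarrow> f U \<in> J_ideal M \<and> \<nu> (f U) \<le> c"
    and A: "A \<in> M"
  shows "f A \<in> J_ideal M \<and> \<nu> (f A) \<le> 4 * norm A * c"
proof (cases "A = 0")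
  case True
  have "scalar_op 0 o\<^sub>L T = 0" for T :: "'h op" using scaleR_eq_scalar_op[of 0 T] by simp
  then have "f 0 = 0" using f(2)[of 0 0] by simp
  then show ?thesis using True zero_in_J nu_zero by simp
next
  case False
  define B where "B = (1 / norm A) *\<^sub>R A"
  have "B \<in> M" "norm B \<le> 1" using A False by (simp_all add: B_def closure)
  then obtain U1 U2 U3 U4 where U: "{U1, U2, U3, U4} \<subseteq> unitaries M"
    "B = (U1 + U2) + (scalar_op \<i> o\<^sub>L (U3 + U4))" by (rule four_unitaries)
  have J: "f U1 \<in> J_ideal M" "f U2 \<in> J_ideal M" "f U3 \<in> J_ideal M" "f U4 \<in> J_ideal M"
    using fU U by auto
  have fB: "f B = (f U1 + f U2) + (scalar_op \<i> o\<^sub>L (f U3 + f U4))" by (simp add: U(2) f)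
  have BJ: "f B \<in> J_ideal M" unfolding fB by (intro J_add J_scalar J)
  have "\<nu> (f B) \<le> \<nu> (f U1 + f U2) + \<nu> (scalar_op \<i> o\<^sub>L (f U3 + f U4))"
    unfolding fB by (intro nu_triangle J_add J_scalar J)
  also have "\<dots> = \<nu> (f U1 + f U2) + \<nu> (f U3 + f U4)"
    by (simp add: nu_scalar[OF J_add[OF J(3,4)]])
  also have "\<dots> \<le> (\<nu> (f U1) + \<nu> (f U2)) + (\<nu> (f U3) + \<nu> (f U4))"
    by (intro add_mono nu_triangle J)
  also have "\<dots> \<le> 4 * c" using fU[of U1] fU[of U2] fU[of U3] fU[of U4] U(1) by simp
  finally have le: "\<nu> (f B) \<le> 4 * c" .
  have "A = scalar_op (complex_of_real (norm A)) o\<^sub>L B"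
    using False by (simp add: B_def flip: scaleR_eq_scalar_op)
  then have fA: "f A = scalar_op (complex_of_real (norm A)) o\<^sub>L f B" by (metis f(2))
  have "\<nu> (f A) = norm A * \<nu> (f B)" unfolding fA by (simp add: nu_scalar[OF BJ])
  also have "\<dots> \<le> norm A * (4 * c)" using le by (intro mult_left_mono) auto
  finally show ?thesis using J_scalar[OF BJ] by (simp add: fA mult_ac)
qed

lemma nu_left:
  assumes "A \<in> M" "T \<in> J_ideal M"
  shows "A o\<^sub>L T \<in> J_ideal M" "\<nu> (A o\<^sub>L T) \<le> 4 * norm A * \<nu> T"
  using bound_from_unitaries[of "\<lambda>S. S o\<^sub>L T" "\<nu> T" A] assms J_unitary nu_unitary
  by (simp_all add: compose_add_left compose_assoc)

lemma nu_right:
  assumes "A \<in> M" "T \<in> J_ideal M"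
  shows "T o\<^sub>L A \<in> J_ideal M" "\<nu> (T o\<^sub>L A) \<le> 4 * norm A * \<nu> T"
proof -
  have "T o\<^sub>L (scalar_op a o\<^sub>L S) = scalar_op a o\<^sub>L (T o\<^sub>L S)" for a and S :: "'h op"
    using complex_operatorsD[OF in_complex[OF J_in[OF assms(2)]]]
    by (auto intro!: blinfun_eqI simp: scalar_op.rep_eq)
  then show "T o\<^sub>L A \<in> J_ideal M" "\<nu> (T o\<^sub>L A) \<le> 4 * norm A * \<nu> T"
    using bound_from_unitaries[of "\<lambda>S. T o\<^sub>L S" "\<nu> T" A] assms J_unitary nu_unitary
    by (simp_all add: compose_add_right)
qed

lemma nu_both:
  assumes "A \<in> M" "B \<in> M" "T \<in> J_ideal M" "norm A \<le> a" "norm B \<le> b"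
  shows "A o\<^sub>L (T o\<^sub>L B) \<in> J_ideal M" "\<nu> (A o\<^sub>L (T o\<^sub>L B)) \<le> 16 * a * b * \<nu> T"
proof -
  note TB = nu_right[OF assms(2,3)]
  show "A o\<^sub>L (T o\<^sub>L B) \<in> J_ideal M" by (rule nu_left[OF assms(1) TB(1)])
  have pos: "0 \<le> \<nu> T" "0 \<le> a" "0 \<le> \<nu> (T o\<^sub>L B)"
    using nu_nonneg assms(3) TB order_trans[OF norm_ge_zero assms(4)] by auto
  have "\<nu> (A o\<^sub>L (T o\<^sub>L B)) \<le> 4 * norm A * \<nu> (T o\<^sub>L B)" by (rule nu_left[OF assms(1) TB(1)])
  also have "\<dots> \<le> 4 * a * (4 * norm B * \<nu> T)"
    using assms(4) TB(2) pos by (intro mult_mono) auto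
  also have "\<dots> \<le> 4 * a * (4 * b * \<nu> T)"
    using assms(5) pos by (intro mult_left_mono mult_right_mono) auto
  finally show "\<nu> (A o\<^sub>L (T o\<^sub>L B)) \<le> 16 * a * b * \<nu> T" by (simp add: mult_ac)
qed

lemma partial_isometry_norm:
  assumes V: "V \<in> partial_isometries M"
  shows "norm V \<le> 1"
proof (rule norm_blinfun_bound)
  note VD = partial_isometryD[OF V]
  fix x
  have "(norm (V x))\<^sup>2 = Re (cinner ((adj_op V o\<^sub>L V) x) x)" by (rule power2_norm_apply[OF in_complex[OF VD(1)]])
  also have "\<dots> \<le> norm ((adj_op V o\<^sub>L V) x) * norm x" by (rule Re_cinner_le)
  also have "\<dots> \<le> norm x * norm x" by (intro mult_right_mono proj_norm_apply[OF VD(4)]) simp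
  finally show "norm (V x) \<le> 1 * norm x" by (simp add: power2_eq_square abs_le_square_iff[symmetric] flip: power2_eq_square)
qed simp

text \<open>If \<open>X\<close> is bounded below on the range of \<open>P\<close>, every projection of smaller trace than \<open>P\<close> factors
  through \<open>X\<close>: it is equivalent to a subprojection of \<open>P\<close>, and \<open>X P\<close> has a left inverse of norm at
  most \<open>1 / l\<close> on that range.\<close>

lemma nu_lower_bound:
  assumes X: "X \<in> J_ideal M" and P: "P \<in> projections M" and F: "F \<in> projections M"
    and l: "0 < l" and lower: "\<And>x. l * norm (blinfun_apply P x) \<le> norm (blinfun_apply X (blinfun_apply P x))"
    and lt: "\<tau> F < \<tau> P"
  shows "\<nu> F \<le> 16 / l * \<nu> X"
proof -
  obtain V R W where V: "V \<in> partial_isometries M" "adj_op V o\<^sub>L V = P" and R: "R \<in> M" "norm R \<le> 1 / l"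
    and VX: "V = X o\<^sub>L (P o\<^sub>L R)"
    using polar_decomposition_below[OF J_in[OF X] P l lower] by metis
  obtain W where W: "W \<in> partial_isometries M" "adj_op W o\<^sub>L W = F" "P o\<^sub>L W = W"
    using comparison_strict[OF F lt P] by blast
  note VD = partial_isometryD[OF V(1)] and WD = partial_isometryD[OF W(1)]
  define A where "A = adj_op W o\<^sub>L adj_op V"
  define B where "B = P o\<^sub>L (R o\<^sub>L W)"
  have A: "A \<in> M" and B: "B \<in> M" using VD WD R projD[OF P] by (auto simp: A_def B_def closure)
  have "F = A o\<^sub>L (X o\<^sub>L B)"
  proof (rule blinfun_eqI)
    fix x
    have "F x = adj_op W (P (W x))"
      using compose_eq_apply[OF W(2), of x] compose_eq_apply[OF W(3), of x] by simp
    also have "P (W x) = adj_op V (V (W x))" using compose_eq_apply[OF V(2), of "W x"] by simp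
    also have "V (W x) = X (P (R (W x)))" by (simp add: VX)
    finally show "F x = (A o\<^sub>L (X o\<^sub>L B)) x" by (simp add: A_def B_def)
  qed
  moreover have "norm A \<le> 1"
    unfolding A_def using partial_isometry_norm[OF V(1)] partial_isometry_norm[OF W(1)]
      norm_adj[OF in_complex[OF VD(1)]] norm_adj[OF in_complex[OF WD(1)]]
    by (intro order_trans[OF norm_blinfun_compose]) (simp add: mult_le_one)
  moreover have "norm B \<le> 1 / l"
  proof -
    have "norm (R o\<^sub>L W) \<le> (1 / l) * 1"
      using R partial_isometry_norm[OF W(1)] l
      by (intro order_trans[OF norm_blinfun_compose] mult_mono) auto
    then have "norm B \<le> 1 * (1 / l)" unfolding B_def
      by (intro order_trans[OF norm_blinfun_compose[of P]] mult_mono proj_norm[OF P]) auto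
    then show ?thesis by simp
  qed
  ultimately show ?thesis using nu_both(2)[OF A B X, of 1 "1 / l"] by simp
qed

text \<open>The isometric part of \<open>X P\<close> makes \<open>P\<close> equivalent to a subprojection of \<open>F\<close>.\<close>

lemma trace_le_of_lower_bound:
  assumes X: "X \<in> M" and P: "P \<in> projections M" and F: "F \<in> projections M" "F o\<^sub>L X = X"
    and l: "0 < l" and lower: "\<And>x. l * norm (blinfun_apply P x) \<le> norm (blinfun_apply X (blinfun_apply P x))"
  shows "\<tau> P \<le> \<tau> F"
proof -
  obtain V R W where V: "V \<in> partial_isometries M" "adj_op V o\<^sub>L V = P" and VX: "V = X o\<^sub>L (P o\<^sub>L R)"
    using polar_decomposition_below[OF X P l lower] by metis
  note VD = partial_isometryD[OF V(1)]
  have "F o\<^sub>L V = V" unfolding VX using F(2) by (metis compose_assoc)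
  then have "F o\<^sub>L (V o\<^sub>L adj_op V) = V o\<^sub>L adj_op V" by (metis compose_assoc)
  then have "\<tau> (V o\<^sub>L adj_op V) \<le> \<tau> F" by (rule trace_proj_mono[OF F(1) VD(5)])
  then show ?thesis using trace_commute[OF VD(1)] V(2) by simp
qed

section \<open>The norm topology and the measure topology\<close>

text \<open>If \<open>T\<close> is not small in measure, it is bounded below on a projection whose trace exceeds that of
  a fixed nonzero projection.\<close>

lemma small_norm_small_measure:
  assumes e: "0 < e" and d: "0 < d"
  obtains r where "0 < r" "\<And>T. T \<in> J_ideal M \<Longrightarrow> \<nu> T < r \<Longrightarrow> T \<in> measure_nhd M \<tau> e d"
proof -
  obtain P where P: "P \<in> projections M" "P \<noteq> 0" "\<tau> P < ennreal d"
    using small_projection_exists[of "ennreal d"] d by auto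
  have PJ: "P \<in> J_ideal M" using P by (intro projection_in_J) (auto intro: order_less_trans)
  have nP: "0 < \<nu> P" using nu_nonneg[OF PJ] nu_eq_0[OF PJ] P(2) by simp
  show thesis
  proof (rule that)
    show "0 < e * \<nu> P / 32" using e nP by simp
    fix T assume T: "T \<in> J_ideal M" "\<nu> T < e * \<nu> P / 32"
    obtain Q where Q: "Q \<in> projections M" and Q1: "\<And>x. (e/2) * norm (Q x) \<le> norm (T (Q x))"
      and Q2: "\<And>x. norm (T (x - Q x)) \<le> (e/2) * norm (x - Q x)"
      using spectral_cut[OF J_in[OF T(1)], of "e/2"] e by (metis half_gt_zero less_imp_le)
    have "\<tau> Q < ennreal d"
    proof (rule ccontr)
      assume "\<not> ?thesis"
      then have "\<tau> P < \<tau> Q" using P(3) by simp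
      then have "\<nu> P \<le> 16 / (e/2) * \<nu> T"
        using e by (intro nu_lower_bound[OF T(1) Q P(1) _ Q1]) auto
      then show False using T(2) e by (simp add: field_simps)
    qed
    moreover have "norm (T o\<^sub>L (id_blinfun - Q)) \<le> e / 2"
    proof (rule norm_blinfun_bound)
      fix x
      have "norm (T (x - Q x)) \<le> (e/2) * norm (x - Q x)" by (rule Q2)
      also have "\<dots> \<le> (e/2) * norm x"
        using proj_norm_apply[OF proj_complement[OF Q], of x] e by (intro mult_left_mono) (auto simp: op_apply)
      finally show "norm ((T o\<^sub>L (id_blinfun - Q)) x) \<le> (e/2) * norm x" by (simp add: op_apply)
    qed (use e in simp)
    ultimately show "T \<in> measure_nhd M \<tau> e d"
      using Q J_in[OF T(1)] e unfolding measure_nhd_def by (auto intro!: bexI[of _ Q])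
  qed
qed

text \<open>Write \<open>T = T (1 - F) E + T F E\<close>, where \<open>E\<close> is a finite support of \<open>T\<close> and \<open>F\<close> is a projection of small
  trace off which \<open>S\<close> is small.  The first summand is close to a compression of \<open>T - S\<close>.  The
  norm of the second is at most a multiple of \<open>\<parallel>T\<parallel> \<nu>(F)\<close>.  Now \<open>T\<close> is bounded below by
  \<open>\<parallel>T\<parallel> / 2\<close> on a nonzero spectral projection \<open>Q\<close>, and \<open>T (1 - F)\<close> still is bounded below by
  \<open>\<parallel>T\<parallel> / 4\<close> on the large part of \<open>Q\<close> that is nearly orthogonal to \<open>F\<close>.  So \<open>\<parallel>T\<parallel> \<nu>(F)\<close> is in turn
  bounded by the norm of the first summand.\<close>

lemma norm_lower_semicontinuous:
  assumes T: "T \<in> J_ideal M" and r: "0 < r"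
  obtains e d where "0 < e" "0 < d"
    "\<And>S. S \<in> J_ideal M \<Longrightarrow> S \<in> measure_nhd M \<tau> e d \<Longrightarrow> \<nu> (T - S) \<le> r \<Longrightarrow> \<nu> T \<le> 17425 * r"
proof (cases "T = 0")
  case True
  then show thesis using that[of 1 1] r nu_zero by simp
next
  case False
  have TM: "T \<in> M" by (rule J_in[OF T])
  obtain E where E: "E \<in> projections M" "\<tau> E < \<infinity>" "E o\<^sub>L T = T" "T o\<^sub>L E = T"
    using T by (rule J_idealE)
  note ED = projD[OF E(1)]
  have EJ: "E \<in> J_ideal M" by (rule projection_in_J[OF E(1,2)])
  have ET: "E (T x) = T x" and TE: "T (E x) = T x" for x
    using compose_eq_apply[OF E(3)] compose_eq_apply[OF E(4)] by auto
  define l where "l = norm T / 2"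
  have l: "0 < l" using False by (simp add: l_def)
  obtain Q where Q: "Q \<in> projections M"
    and Q1: "\<And>x. l * norm (Q x) \<le> norm (T (Q x))" and Q2: "\<And>x. norm (T (x - Q x)) \<le> l * norm (x - Q x)"
    and QE: "Q o\<^sub>L E = Q"
    using spectral_cut[OF TM, of l] l E(1,4) by (metis less_imp_le)
  note QD = projD[OF Q]
  have "Q \<noteq> 0"
  proof
    assume "Q = 0"
    then have "norm T \<le> l" using Q2 l by (intro norm_blinfun_bound) auto
    then show False using l by (simp add: l_def)
  qed
  then have tQ: "0 < \<tau> Q" by (rule trace_proj_pos[OF Q])
  have EQ: "E o\<^sub>L Q = Q" by (rule proj_absorb'[OF E(1) Q QE])
  have fQ: "\<tau> Q < \<infinity>" using trace_proj_mono[OF E(1) Q EQ] E(2) by (rule order_le_less_trans)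
  \<comment> \<open>For \<open>\<tau> F < d\<close>, removing from \<open>Q\<close> a part of trace at most \<open>\<tau> F\<close> leaves trace larger than \<open>\<tau> F\<close>.\<close>
  define d where "d = enn2real (\<tau> Q) / 2"
  have d: "0 < d" using tQ fQ by (simp add: d_def enn2real_positive_iff)
  have dd: "ennreal d + ennreal d = \<tau> Q" using fQ d by (simp add: d_def flip: ennreal_plus)
  define e where "e = r / (4 * (\<nu> E + 1))"
  have nE: "0 \<le> \<nu> E" by (rule nu_nonneg[OF EJ])
  have e: "0 < e" using r nE by (simp add: e_def)
  have er: "4 * e * \<nu> E \<le> r" using r nE by (simp add: e_def field_simps)
  show thesis
  proof (rule that[OF e d])
    fix S assume S: "S \<in> J_ideal M" "S \<in> measure_nhd M \<tau> e d" and TS: "\<nu> (T - S) \<le> r"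
    obtain F where F: "F \<in> projections M" "\<tau> F < ennreal d" "norm (S o\<^sub>L (id_blinfun - F)) < e"
      using S(2) by (auto simp: measure_nhd_def)
    note FD = projD[OF F(1)]
    have FJ: "F \<in> J_ideal M" using F by (intro projection_in_J) (auto intro: order_less_trans)
    have cM: "id_blinfun - F \<in> M" using FD by (simp add: closure)
    have SM: "S \<in> M" by (rule J_in[OF S(1)])
    have cE: "norm ((id_blinfun - F) o\<^sub>L E) \<le> 1"
      using proj_norm[OF proj_complement[OF F(1)]] proj_norm[OF E(1)]
      by (intro order_trans[OF norm_blinfun_compose]) (simp add: mult_le_one)
    define X where "X = T o\<^sub>L ((id_blinfun - F) o\<^sub>L E)"
    have XJ: "X \<in> J_ideal M" unfolding X_def by (intro nu_right T closure cM ED(1))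
    have nX: "\<nu> X \<le> 17 * r"
    proof -
      define X1 where "X1 = E o\<^sub>L ((T - S) o\<^sub>L ((id_blinfun - F) o\<^sub>L E))"
      define B where "B = (S o\<^sub>L (id_blinfun - F)) o\<^sub>L E"
      have BM: "B \<in> M" using SM cM ED by (simp add: B_def closure)
      have DJ: "T - S \<in> J_ideal M" by (rule J_diff[OF T S(1)])
      have "X = X1 + (E o\<^sub>L B)"
        by (rule blinfun_eqI) (simp add: X_def X1_def B_def op_apply ET)
      moreover have X1: "X1 \<in> J_ideal M" "\<nu> X1 \<le> 16 * 1 * 1 * \<nu> (T - S)"
        unfolding X1_def by (rule nu_both; use cE proj_norm[OF E(1)] DJ cM ED(1) in \<open>simp add: closure\<close>)+
      moreover have EB: "E o\<^sub>L B \<in> J_ideal M" "\<nu> (E o\<^sub>L B) \<le> 4 * norm B * \<nu> E"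
        by (rule nu_right[OF BM EJ])+
      moreover have "norm B \<le> e * 1"
        unfolding B_def using F(3) proj_norm[OF E(1)] e
        by (intro order_trans[OF norm_blinfun_compose[of _ E]] mult_mono) auto
      then have "4 * norm B * \<nu> E \<le> 4 * e * \<nu> E" using nE by (intro mult_right_mono) auto
      ultimately show ?thesis using nu_triangle[OF X1(1) EB(1)] TS er by simp
    qed
    have FQM: "F o\<^sub>L Q \<in> M" using FD QD by (simp add: closure)
    \<comment> \<open>\<open>P'\<close> is the part of \<open>Q\<close> on which \<open>F\<close> is not small. Its trace is at most that of \<open>F\<close>.\<close>
    obtain P' where P': "P' \<in> projections M" and P1: "\<And>x. (1/4) * norm (P' x) \<le> norm ((F o\<^sub>L Q) (P' x))"
      and P2: "\<And>x. norm ((F o\<^sub>L Q) (x - P' x)) \<le> (1/4) * norm (x - P' x)" and PQ: "P' o\<^sub>L Q = P'"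
    proof (rule spectral_cut[OF FQM, of "1/4"])
      fix P' assume *: "P' \<in> projections M" "\<And>x. 1 / 4 * norm (P' x) \<le> norm ((F o\<^sub>L Q) (P' x))"
        "\<And>x. norm ((F o\<^sub>L Q) (x - P' x)) \<le> 1 / 4 * norm (x - P' x)"
        "\<And>E. 0 < (1::real) / 4 \<Longrightarrow> E \<in> projections M \<Longrightarrow> (F o\<^sub>L Q) o\<^sub>L E = F o\<^sub>L Q \<Longrightarrow> P' o\<^sub>L E = P'"
      have "P' o\<^sub>L Q = P'" using *(4)[of Q] Q QD by (simp add: compose_assoc)
      then show thesis using that * by blast
    qed simp
    have QP: "Q o\<^sub>L P' = P'" by (rule proj_absorb'[OF Q P' PQ])
    define P where "P = Q - P'"
    have P: "P \<in> projections M" unfolding P_def by (rule proj_diff[OF Q P' QP])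
    have "\<tau> P' \<le> \<tau> F"
      by (rule trace_le_of_lower_bound[OF FQM P' F(1) _ _ P1]) (auto intro!: blinfun_eqI simp: FD)
    have ltP: "\<tau> F < \<tau> P"
    proof (rule ccontr)
      assume "\<not> ?thesis"
      then have "\<tau> Q \<le> \<tau> F + \<tau> F"
        unfolding trace_proj_diff[OF Q P' QP] P_def[symmetric] using \<open>\<tau> P' \<le> \<tau> F\<close> by (intro add_mono) auto
      also have "\<dots> < ennreal d + ennreal d" using F(2) by (intro add_strict_mono)
      finally show False using dd by simp
    qed
    have lower: "l / 2 * norm (P x) \<le> norm (X (P x))" for x
    proof -
      have Px: "P x = Q x - P' (Q x)" using compose_eq_apply[OF PQ, of x] by (simp add: P_def op_apply)
      have QPx: "Q (P x) = P x" using compose_eq_apply[OF QP, of x] QD(4) by (simp add: P_def op_apply)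
      have EPx: "E (P x) = P x" using compose_eq_apply[OF EQ, of "P x"] QPx by simp
      have "norm (F (P x)) \<le> 1/4 * norm (P x)" using P2[of "Q x"] QPx by (simp flip: Px)
      then have "norm T * norm (F (P x)) \<le> norm T * (1/4 * norm (P x))" by (intro mult_left_mono) auto
      then have "norm (T (F (P x))) \<le> l / 2 * norm (P x)"
        using norm_blinfun[of T "F (P x)"] by (simp add: l_def)
      moreover have "l * norm (P x) \<le> norm (T (P x))" using Q1[of "P x"] QPx by simp
      moreover have "X (P x) = T (P x) - T (F (P x))" by (simp add: X_def op_apply EPx)
      ultimately show ?thesis using norm_triangle_ineq2[of "T (P x)" "T (F (P x))"] by simp
    qed
    have "\<nu> F \<le> 16 / (l / 2) * \<nu> X" using l by (intro nu_lower_bound[OF XJ P F(1) _ lower ltP]) auto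
    also have "\<dots> \<le> 16 / (l / 2) * (17 * r)" using nX l by (intro mult_left_mono) auto
    also have "\<dots> = 1088 * r / norm T" by (simp add: l_def)
    finally have nF: "\<nu> F \<le> 1088 * r / norm T" .
    define Y where "Y = T o\<^sub>L (F o\<^sub>L E)"
    have YJ: "Y \<in> J_ideal M" unfolding Y_def by (rule nu_both(1)[OF TM ED(1) FJ order_refl order_refl])
    have "\<nu> Y \<le> 16 * norm T * 1 * \<nu> F"
      unfolding Y_def by (rule nu_both(2)[OF TM ED(1) FJ order_refl proj_norm[OF E(1)]])
    also have "\<dots> \<le> 16 * norm T * 1 * (1088 * r / norm T)" using nF by (intro mult_left_mono) auto
    also have "\<dots> = 17408 * r" using False by simp
    finally have nY: "\<nu> Y \<le> 17408 * r" .
    have "T = X + Y" by (rule blinfun_eqI) (simp add: X_def Y_def op_apply TE)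
    then have "\<nu> T \<le> \<nu> X + \<nu> Y" using nu_triangle[OF XJ YJ] by simp
    then show "\<nu> T \<le> 17425 * r" using nX nY by simp
  qed
qed

end

section \<open>Maps between completions\<close>

text \<open>The properties of the filter of neighbourhoods of \<open>0\<close> in a group topology. The norm topology and
  the measure topology are the instances below.\<close>

locale group_nhds =
  fixes Z :: "'a::ab_group_add filter"
  assumes zero: "eventually P Z \<Longrightarrow> P 0"
    and uminus: "eventually P Z \<Longrightarrow> eventually (\<lambda>x. P (- x)) Z"
    and add: "eventually P Z \<Longrightarrow> \<exists>Q. eventually Q Z \<and> (\<forall>x y. Q x \<longrightarrow> Q y \<longrightarrow> P (x + y))"
begin

lemma lim_zero: "filterlim (\<lambda>_. 0) Z F"
  unfolding filterlim_iff using zero by (auto intro: always_eventually)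

lemma lim_uminus: "filterlim f Z F \<Longrightarrow> filterlim (\<lambda>x. - f x) Z F"
  unfolding filterlim_iff using uminus by blast

lemma lim_add:
  assumes "filterlim f Z F" "filterlim g Z F"
  shows "filterlim (\<lambda>x. f x + g x) Z F"
  unfolding filterlim_iff
proof (intro allI impI)
  fix P assume "eventually P Z"
  then obtain Q where Q: "eventually Q Z" "\<And>x y. Q x \<Longrightarrow> Q y \<Longrightarrow> P (x + y)" using add by blast
  have "eventually (\<lambda>x. Q (f x)) F" "eventually (\<lambda>x. Q (g x)) F"
    using assms Q(1) unfolding filterlim_iff by blast+
  then show "eventually (\<lambda>x. P (f x + g x)) F" by eventually_elim (rule Q(2))
qed

lemma lim_diff:
  assumes "filterlim f Z F" "filterlim g Z F"
  shows "filterlim (\<lambda>x. f x - g x) Z F"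
  using lim_add[OF assms(1) lim_uminus[OF assms(2)]] by simp

lemma equiv_cauchy_rel: "equiv (cauchy_seqs X Z) (cauchy_rel X Z)"
proof (rule equivI)
  show "cauchy_rel X Z \<subseteq> cauchy_seqs X Z \<times> cauchy_seqs X Z" by (auto simp: cauchy_rel_def)
  show "refl_on (cauchy_seqs X Z) (cauchy_rel X Z)"
    by (auto simp: refl_on_def cauchy_rel_def lim_zero)
  show "sym (cauchy_rel X Z)"
  proof (rule symI)
    fix s t assume "(s, t) \<in> cauchy_rel X Z"
    then show "(t, s) \<in> cauchy_rel X Z"
      using lim_uminus[of "\<lambda>n. s n - t n" sequentially] by (auto simp: cauchy_rel_def)
  qed
  show "trans (cauchy_rel X Z)"
  proof (rule transI)
    fix s t u assume "(s, t) \<in> cauchy_rel X Z" "(t, u) \<in> cauchy_rel X Z"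
    then show "(s, u) \<in> cauchy_rel X Z"
      using lim_add[of "\<lambda>n. s n - t n" sequentially "\<lambda>n. t n - u n"] by (auto simp: cauchy_rel_def)
  qed
qed

lemma const_cauchy: "x \<in> X \<Longrightarrow> (\<lambda>_. x) \<in> cauchy_seqs X Z"
  using lim_zero[of "sequentially \<times>\<^sub>F sequentially"] by (auto simp: cauchy_seqs_def case_prod_unfold)

lemma diff_cauchy:
  assumes "\<And>x y. x \<in> X \<Longrightarrow> y \<in> X \<Longrightarrow> x - y \<in> X" "s \<in> cauchy_seqs X Z" "t \<in> cauchy_seqs X Z"
  shows "(\<lambda>n. s n - t n) \<in> cauchy_seqs X Z"
proof -
  have "filterlim (\<lambda>p. (s (fst p) - s (snd p)) - (t (fst p) - t (snd p))) Z (sequentially \<times>\<^sub>F sequentially)"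
    by (rule lim_diff) (use assms in \<open>auto simp: cauchy_seqs_def case_prod_unfold\<close>)
  moreover have "(s (fst p) - s (snd p)) - (t (fst p) - t (snd p))
      = (s (fst p) - t (fst p)) - (s (snd p) - t (snd p))" for p by simp
  ultimately show ?thesis using assms by (auto simp: cauchy_seqs_def case_prod_unfold image_subset_iff)
qed

lemma class_self: "s \<in> cauchy_seqs X Z \<Longrightarrow> s \<in> cauchy_class X Z s"
  unfolding cauchy_class_def by (rule equiv_class_self[OF equiv_cauchy_rel])

lemma class_in_completion: "s \<in> cauchy_seqs X Z \<Longrightarrow> cauchy_class X Z s \<in> cauchy_completion X Z"
  unfolding cauchy_class_def cauchy_completion_def by (rule quotientI)

lemma class_eq_iff:
  "s \<in> cauchy_seqs X Z \<Longrightarrow> t \<in> cauchy_seqs X Z \<Longrightarrow>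
    cauchy_class X Z s = cauchy_class X Z t \<longleftrightarrow> filterlim (\<lambda>n. s n - t n) Z sequentially"
  unfolding cauchy_class_def
  by (simp add: eq_equiv_class_iff[OF equiv_cauchy_rel]) (simp add: cauchy_rel_def)

text \<open>A Cauchy sequence is close to its own tails, which is convergence of the constant sequences
  \<open>s n\<close> to the class of \<open>s\<close>.\<close>

lemma embed_converges:
  assumes s: "s \<in> cauchy_seqs X Z"
  shows "limitin (completion_topology X Z) (\<lambda>n. completion_embed X Z (s n)) (cauchy_class X Z s) sequentially"
  unfolding limitin_def
proof (intro conjI allI impI)
  show "cauchy_class X Z s \<in> topspace (completion_topology X Z)"
    by (simp add: topspace_completion_topology class_in_completion s)
  fix U assume U: "openin (completion_topology X Z) U \<and> cauchy_class X Z s \<in> U"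
  then obtain P where P: "eventually P Z" "completion_nhd X Z P (cauchy_class X Z s) \<subseteq> U"
    unfolding openin_completion_topology by blast
  have "eventually (\<lambda>(m, n). P (s m - s n)) (sequentially \<times>\<^sub>F sequentially)"
    using s P(1) unfolding cauchy_seqs_def filterlim_iff by (auto simp: case_prod_unfold)
  then obtain N where N: "\<And>m n. m \<ge> N \<Longrightarrow> n \<ge> N \<Longrightarrow> P (s m - s n)"
    unfolding eventually_prod_sequentially by auto
  have "completion_embed X Z (s n) \<in> U" if n: "n \<ge> N" for n
  proof -
    have c: "(\<lambda>_. s n) \<in> cauchy_seqs X Z" using s by (intro const_cauchy) (auto simp: cauchy_seqs_def)
    have "\<forall>\<^sub>F k in sequentially. P (s n - s k)"
      using N[OF n] by (auto simp: eventually_sequentially)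
    then have "completion_embed X Z (s n) \<in> completion_nhd X Z P (cauchy_class X Z s)"
      unfolding completion_nhd_def completion_embed_def
      by (intro CollectI conjI class_in_completion[OF c] bexI[OF _ class_self[OF s]]
          bexI[OF _ class_self[OF c]])
    then show ?thesis using P(2) by blast
  qed
  then show "\<forall>\<^sub>F n in sequentially. completion_embed X Z (s n) \<in> U"
    by (auto simp: eventually_sequentially)
qed

end

text \<open>When the topology \<open>Z1\<close> is finer than \<open>Z2\<close>, every \<open>Z1\<close>-Cauchy sequence is \<open>Z2\<close>-Cauchy, and a class
  is sent to the \<open>Z2\<close>-class containing it.  The map is injective when a \<open>Z1\<close>-Cauchy
  sequence cannot tend to \<open>0\<close> for \<open>Z2\<close> without doing so for \<open>Z1\<close>.\<close>

lemma completion_map_exists: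
  fixes X1 X2 :: "'a::ab_group_add set"
  assumes Z1: "group_nhds Z1" and Z2: "group_nhds Z2" and finer: "Z1 \<le> Z2" and sub: "X1 \<subseteq> X2"
    and diff: "\<And>x y. x \<in> X1 \<Longrightarrow> y \<in> X1 \<Longrightarrow> x - y \<in> X1"
    and closable: "\<And>s. s \<in> cauchy_seqs X1 Z1 \<Longrightarrow> filterlim s Z2 sequentially \<Longrightarrow> filterlim s Z1 sequentially"
  shows "\<exists>\<Phi>. continuous_map (completion_topology X1 Z1) (completion_topology X2 Z2) \<Phi> \<and>
    inj_on \<Phi> (cauchy_completion X1 Z1) \<and>
    (\<forall>x\<in>X1. \<Phi> (completion_embed X1 Z1 x) = completion_embed X2 Z2 x) \<and>
    (\<forall>s\<in>cauchy_seqs X1 Z1.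
       limitin (completion_topology X2 Z2) (\<lambda>n. completion_embed X2 Z2 (s n))
         (\<Phi> (cauchy_class X1 Z1 s)) sequentially)"
proof -
  interpret G1: group_nhds Z1 by (rule Z1)
  interpret G2: group_nhds Z2 by (rule Z2)
  define \<Phi> where "\<Phi> c = cauchy_rel X2 Z2 `` c" for c
  have seqs: "s \<in> cauchy_seqs X2 Z2" if "s \<in> cauchy_seqs X1 Z1" for s
    using that sub filterlim_mono[OF _ finer order_refl] by (auto simp: cauchy_seqs_def)
  have rel: "cauchy_rel X1 Z1 \<subseteq> cauchy_rel X2 Z2"
    using seqs filterlim_mono[OF _ finer order_refl] by (auto simp: cauchy_rel_def)
  have \<Phi>_class: "\<Phi> (cauchy_class X1 Z1 s) = cauchy_class X2 Z2 s" if s: "s \<in> cauchy_seqs X1 Z1" for s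
  proof
    show "\<Phi> (cauchy_class X1 Z1 s) \<subseteq> cauchy_class X2 Z2 s"
      using rel equivE[OF G2.equiv_cauchy_rel[of X2]] unfolding \<Phi>_def cauchy_class_def trans_def by blast
    show "cauchy_class X2 Z2 s \<subseteq> \<Phi> (cauchy_class X1 Z1 s)"
      using G1.class_self[OF s] unfolding \<Phi>_def cauchy_class_def by blast
  qed
  have classE: "\<exists>s\<in>cauchy_seqs X1 Z1. c = cauchy_class X1 Z1 s" if "c \<in> cauchy_completion X1 Z1" for c
    using that by (auto simp: cauchy_completion_def cauchy_class_def quotient_def)
  have \<Phi>_in: "\<Phi> c \<in> cauchy_completion X2 Z2" if "c \<in> cauchy_completion X1 Z1" for c
    using classE[OF that] \<Phi>_class seqs G2.class_in_completion by auto
  have \<Phi>_member: "s \<in> \<Phi> c" if "c \<in> cauchy_completion X1 Z1" "s \<in> c" for c s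
  proof -
    have "s \<in> cauchy_seqs X1 Z1"
      using that by (auto simp: cauchy_completion_def quotient_def cauchy_rel_def)
    then have "(s, s) \<in> cauchy_rel X2 Z2" using seqs by (auto simp: cauchy_rel_def G2.lim_zero)
    then show ?thesis using that(2) by (auto simp: \<Phi>_def)
  qed
  have "continuous_map (completion_topology X1 Z1) (completion_topology X2 Z2) \<Phi>"
    unfolding continuous_map_def topspace_completion_topology
  proof (intro conjI allI impI)
    show "\<Phi> \<in> cauchy_completion X1 Z1 \<rightarrow> cauchy_completion X2 Z2" using \<Phi>_in by blast
    fix U assume U: "openin (completion_topology X2 Z2) U"
    show "openin (completion_topology X1 Z1) {c \<in> cauchy_completion X1 Z1. \<Phi> c \<in> U}"
      unfolding openin_completion_topology
    proof (intro conjI ballI)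
      fix c assume "c \<in> {c \<in> cauchy_completion X1 Z1. \<Phi> c \<in> U}"
      then have c: "c \<in> cauchy_completion X1 Z1" "\<Phi> c \<in> U" by auto
      obtain P where P: "eventually P Z2" "completion_nhd X2 Z2 P (\<Phi> c) \<subseteq> U"
        using U c(2) unfolding openin_completion_topology by blast
      have "completion_nhd X1 Z1 P c \<subseteq> {c \<in> cauchy_completion X1 Z1. \<Phi> c \<in> U}"
      proof
        fix d assume "d \<in> completion_nhd X1 Z1 P c"
        then obtain s t where d: "d \<in> cauchy_completion X1 Z1" "s \<in> c" "t \<in> d"
          "\<forall>\<^sub>F n in sequentially. P (t n - s n)" by (auto simp: completion_nhd_def)
        then have "\<Phi> d \<in> completion_nhd X2 Z2 P (\<Phi> c)"
          using \<Phi>_in[OF d(1)] \<Phi>_member[OF c(1) d(2)] \<Phi>_member[OF d(1,3)]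
          by (auto simp: completion_nhd_def)
        then show "d \<in> {c \<in> cauchy_completion X1 Z1. \<Phi> c \<in> U}" using P(2) d(1) by blast
      qed
      moreover have "eventually P Z1" using P(1) finer by (rule filter_leD[rotated])
      ultimately show "\<exists>P. eventually P Z1 \<and>
          completion_nhd X1 Z1 P c \<subseteq> {c \<in> cauchy_completion X1 Z1. \<Phi> c \<in> U}" by blast
    qed auto
  qed
  moreover have "inj_on \<Phi> (cauchy_completion X1 Z1)"
  proof (rule inj_onI)
    fix c d assume cd: "c \<in> cauchy_completion X1 Z1" "d \<in> cauchy_completion X1 Z1" "\<Phi> c = \<Phi> d"
    obtain s where s: "s \<in> cauchy_seqs X1 Z1" "c = cauchy_class X1 Z1 s" using classE[OF cd(1)] by blast
    obtain t where t: "t \<in> cauchy_seqs X1 Z1" "d = cauchy_class X1 Z1 t" using classE[OF cd(2)] by blast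
    have "cauchy_class X2 Z2 s = cauchy_class X2 Z2 t" using cd(3) s t \<Phi>_class by simp
    then have "filterlim (\<lambda>n. s n - t n) Z2 sequentially"
      using G2.class_eq_iff[OF seqs[OF s(1)] seqs[OF t(1)]] by simp
    moreover have "(\<lambda>n. s n - t n) \<in> cauchy_seqs X1 Z1"
      by (rule G1.diff_cauchy[OF diff s(1) t(1)])
    ultimately have "filterlim (\<lambda>n. s n - t n) Z1 sequentially" by (intro closable)
    then show "c = d" using G1.class_eq_iff[OF s(1) t(1)] s t by simp
  qed
  moreover have "\<Phi> (completion_embed X1 Z1 x) = completion_embed X2 Z2 x" if "x \<in> X1" for x
    unfolding completion_embed_def using \<Phi>_class[OF G1.const_cauchy[OF that]] .
  moreover have "limitin (completion_topology X2 Z2) (\<lambda>n. completion_embed X2 Z2 (s n))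
      (\<Phi> (cauchy_class X1 Z1 s)) sequentially" if "s \<in> cauchy_seqs X1 Z1" for s
    unfolding \<Phi>_class[OF that] by (rule G2.embed_converges[OF seqs[OF that]])
  ultimately show ?thesis by blast
qed

context normed_ideal
begin

lemma eventually_norm_zero_nhds:
  "eventually P (norm_zero_nhds M \<nu>) \<longleftrightarrow> (\<exists>e>0. \<forall>T\<in>J_ideal M. \<nu> T < e \<longrightarrow> P T)"
proof -
  have "eventually P (norm_zero_nhds M \<nu>) \<longleftrightarrow>
      (\<exists>e\<in>{0<..}. eventually P (principal {T \<in> J_ideal M. \<nu> T < e}))"
    unfolding norm_zero_nhds_def
  proof (rule eventually_INF_base)
    fix a b :: real assume "a \<in> {0<..}" "b \<in> {0<..}"
    then show "\<exists>x\<in>{0<..}. principal {T \<in> J_ideal M. \<nu> T < x}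
        \<le> inf (principal {T \<in> J_ideal M. \<nu> T < a}) (principal {T \<in> J_ideal M. \<nu> T < b})"
      by (intro bexI[of _ "min a b"]) auto
  qed auto
  then show ?thesis by (auto simp: eventually_principal)
qed

lemma measure_nhd_mono: "e \<le> e' \<Longrightarrow> d \<le> d' \<Longrightarrow> measure_nhd M \<tau> e d \<subseteq> measure_nhd M \<tau> e' d'"
  unfolding measure_nhd_def by (blast intro: order_less_le_trans ennreal_leI)

lemma eventually_measure_zero_nhds:
  "eventually P (measure_zero_nhds M \<tau>) \<longleftrightarrow> (\<exists>e>0. \<exists>d>0. \<forall>T\<in>measure_nhd M \<tau> e d. P T)"
proof -
  have "eventually P (measure_zero_nhds M \<tau>) \<longleftrightarrow>
      (\<exists>p\<in>{0<..} \<times> {0<..}. eventually P (case p of (e, d) \<Rightarrow> principal (measure_nhd M \<tau> e d)))"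
    unfolding measure_zero_nhds_def
  proof (rule eventually_INF_base)
    fix a b :: "real \<times> real" assume ab: "a \<in> {0<..} \<times> {0<..}" "b \<in> {0<..} \<times> {0<..}"
    have "measure_nhd M \<tau> (min (fst a) (fst b)) (min (snd a) (snd b)) \<subseteq> measure_nhd M \<tau> (fst a) (snd a)"
      "measure_nhd M \<tau> (min (fst a) (fst b)) (min (snd a) (snd b)) \<subseteq> measure_nhd M \<tau> (fst b) (snd b)"
      by (intro measure_nhd_mono; simp)+
    then show "\<exists>p\<in>{0<..} \<times> {0<..}. (case p of (e, d) \<Rightarrow> principal (measure_nhd M \<tau> e d))
        \<le> inf (case a of (e, d) \<Rightarrow> principal (measure_nhd M \<tau> e d))
          (case b of (e, d) \<Rightarrow> principal (measure_nhd M \<tau> e d))"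
      using ab by (intro bexI[of _ "(min (fst a) (fst b), min (snd a) (snd b))"]) (auto simp: case_prod_unfold)
  qed auto
  then show ?thesis by (auto simp: eventually_principal)
qed

lemma group_nhds_norm: "group_nhds (norm_zero_nhds M \<nu>)"
proof
  fix P assume "eventually P (norm_zero_nhds M \<nu>)"
  then obtain e where e: "0 < e" "\<And>T. T \<in> J_ideal M \<Longrightarrow> \<nu> T < e \<Longrightarrow> P T"
    by (auto simp: eventually_norm_zero_nhds)
  show "P 0" using e zero_in_J nu_zero by simp
  show "eventually (\<lambda>T. P (- T)) (norm_zero_nhds M \<nu>)"
    unfolding eventually_norm_zero_nhds using e J_uminus nu_uminus by metis
  have "P (S + T)" if "S \<in> J_ideal M" "\<nu> S < e/2" "T \<in> J_ideal M" "\<nu> T < e/2" for S T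
    using that nu_triangle[of S T] J_add[of S T] by (intro e(2)) auto
  moreover have "eventually (\<lambda>T. T \<in> J_ideal M \<and> \<nu> T < e/2) (norm_zero_nhds M \<nu>)"
    unfolding eventually_norm_zero_nhds using e(1) by (intro exI[of _ "e/2"]) auto
  ultimately show "\<exists>Q. eventually Q (norm_zero_nhds M \<nu>) \<and> (\<forall>x y. Q x \<longrightarrow> Q y \<longrightarrow> P (x + y))"
    by (intro exI[of _ "\<lambda>T. T \<in> J_ideal M \<and> \<nu> T < e/2"]) blast
qed

lemma measure_nhd_add:
  assumes e: "0 < e" and d: "0 < d" and S: "S \<in> measure_nhd M \<tau> (e/2) (d/2)" and T: "T \<in> measure_nhd M \<tau> (e/2) (d/2)"
  shows "S + T \<in> measure_nhd M \<tau> e d"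
proof -
  obtain E where E: "E \<in> projections M" "\<tau> E < ennreal (d/2)" "norm (S o\<^sub>L (id_blinfun - E)) < e/2"
    using S by (auto simp: measure_nhd_def)
  obtain F where F: "F \<in> projections M" "\<tau> F < ennreal (d/2)" "norm (T o\<^sub>L (id_blinfun - F)) < e/2"
    using T by (auto simp: measure_nhd_def)
  have "\<tau> E < \<infinity>" using E(2) by (auto intro: order_less_trans)
  then obtain G where G: "G \<in> projections M" "G o\<^sub>L E = E" "G o\<^sub>L F = F" "\<tau> G \<le> \<tau> E + \<tau> F"
    using projection_join[OF E(1) _ F(1)] by blast
  note nG = proj_norm[OF proj_complement[OF G(1)]]
  have bound: "norm (R o\<^sub>L (id_blinfun - G)) < e/2"
    if "norm (R o\<^sub>L (id_blinfun - H)) < e/2" "H \<in> projections M" "G o\<^sub>L H = H" for R H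
  proof -
    have "H o\<^sub>L G = H" using proj_absorb[OF G(1) that(2,3)] .
    then have "R o\<^sub>L (id_blinfun - G) = (R o\<^sub>L (id_blinfun - H)) o\<^sub>L (id_blinfun - G)"
      by (simp add: compose_diff_left compose_diff_right compose_assoc)
    then have "norm (R o\<^sub>L (id_blinfun - G)) \<le> norm (R o\<^sub>L (id_blinfun - H)) * norm (id_blinfun - G)"
      by (metis norm_blinfun_compose)
    also have "\<dots> \<le> norm (R o\<^sub>L (id_blinfun - H)) * 1" using nG by (intro mult_left_mono) auto
    finally show ?thesis using that(1) by simp
  qed
  have "\<tau> G < ennreal (d/2) + ennreal (d/2)"
    using G(4) add_strict_mono[OF E(2) F(2)] by (rule order_le_less_trans)
  also have "\<dots> = ennreal d" using d by (simp flip: ennreal_plus)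
  finally have "\<tau> G < ennreal d" .
  moreover have "norm ((S + T) o\<^sub>L (id_blinfun - G)) < e"
    unfolding compose_add_left
    using norm_triangle_ineq[of "S o\<^sub>L (id_blinfun - G)" "T o\<^sub>L (id_blinfun - G)"]
      bound[OF E(3,1) G(2)] bound[OF F(3,1) G(3)] by simp
  ultimately show ?thesis using G(1) S T by (auto simp: measure_nhd_def add_in)
qed

lemma group_nhds_measure: "group_nhds (measure_zero_nhds M \<tau>)"
proof
  fix P assume "eventually P (measure_zero_nhds M \<tau>)"
  then obtain e d where e: "0 < e" and d: "0 < d" and P: "\<And>T. T \<in> measure_nhd M \<tau> e d \<Longrightarrow> P T"
    by (auto simp: eventually_measure_zero_nhds)
  have "0 \<in> measure_nhd M \<tau> e d"
    unfolding measure_nhd_def using e d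
    by (auto simp: zero_in trace_zero projections_def intro!: exI[of _ 0])
  then show "P 0" by (rule P)
  have "- T \<in> measure_nhd M \<tau> e d" if T: "T \<in> measure_nhd M \<tau> e d" for T
  proof -
    have "(- T) o\<^sub>L B = - (T o\<^sub>L B)" for B :: "'h op" by (rule blinfun_eqI) (simp add: op_apply)
    then show ?thesis using T by (simp add: measure_nhd_def uminus_in)
  qed
  then show "eventually (\<lambda>T. P (- T)) (measure_zero_nhds M \<tau>)"
    unfolding eventually_measure_zero_nhds using e d P by blast
  have "eventually (\<lambda>T. T \<in> measure_nhd M \<tau> (e/2) (d/2)) (measure_zero_nhds M \<tau>)"
    unfolding eventually_measure_zero_nhds using e d by (intro exI[of _ "e/2"] exI[of _ "d/2"] conjI) auto
  then show "\<exists>Q. eventually Q (measure_zero_nhds M \<tau>) \<and> (\<forall>x y. Q x \<longrightarrow> Q y \<longrightarrow> P (x + y))"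
    using P measure_nhd_add[OF e d] by (intro exI[of _ "\<lambda>T. T \<in> measure_nhd M \<tau> (e/2) (d/2)"]) blast
qed

lemma norm_finer_than_measure: "norm_zero_nhds M \<nu> \<le> measure_zero_nhds M \<tau>"
proof (rule filter_leI)
  fix P assume "eventually P (measure_zero_nhds M \<tau>)"
  then obtain e d where "0 < e" "0 < d" and P: "\<And>T. T \<in> measure_nhd M \<tau> e d \<Longrightarrow> P T"
    by (auto simp: eventually_measure_zero_nhds)
  then obtain r where "0 < r" "\<And>T. T \<in> J_ideal M \<Longrightarrow> \<nu> T < r \<Longrightarrow> T \<in> measure_nhd M \<tau> e d"
    using small_norm_small_measure by metis
  then show "eventually P (norm_zero_nhds M \<nu>)" unfolding eventually_norm_zero_nhds using P by blast
qed

text \<open>Each late term \<open>s n\<close> is norm-close to terms \<open>s m\<close> that are as small in measure as lower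
  semicontinuity at \<open>s n\<close> demands.\<close>

lemma cauchy_null_in_measure_null_in_norm:
  assumes s: "s \<in> cauchy_seqs (J_ideal M) (norm_zero_nhds M \<nu>)"
    and lim: "filterlim s (measure_zero_nhds M \<tau>) sequentially"
  shows "filterlim s (norm_zero_nhds M \<nu>) sequentially"
  unfolding filterlim_iff
proof (intro allI impI)
  fix P assume "eventually P (norm_zero_nhds M \<nu>)"
  then obtain a where a: "0 < a" "\<And>T. T \<in> J_ideal M \<Longrightarrow> \<nu> T < a \<Longrightarrow> P T"
    by (auto simp: eventually_norm_zero_nhds)
  have sJ: "s n \<in> J_ideal M" for n using s by (auto simp: cauchy_seqs_def)
  \<comment> \<open>One more than the constant of lower semicontinuity, for a strict inequality.\<close>
  define r where "r = a / 17426"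
  have r: "0 < r" using a by (simp add: r_def)
  have "eventually (\<lambda>T. \<nu> T < r) (norm_zero_nhds M \<nu>)"
    unfolding eventually_norm_zero_nhds using r by blast
  then have "eventually (\<lambda>(m, n). \<nu> (s m - s n) < r) (sequentially \<times>\<^sub>F sequentially)"
    using s unfolding cauchy_seqs_def filterlim_iff by (auto simp: case_prod_unfold)
  then obtain N where N: "\<And>m n. m \<ge> N \<Longrightarrow> n \<ge> N \<Longrightarrow> \<nu> (s m - s n) < r"
    unfolding eventually_prod_sequentially by auto
  have "P (s n)" if n: "n \<ge> N" for n
  proof -
    obtain e d where e: "0 < e" "0 < d" and low: "\<And>S. S \<in> J_ideal M \<Longrightarrow> S \<in> measure_nhd M \<tau> e d \<Longrightarrow>
        \<nu> (s n - S) \<le> r \<Longrightarrow> \<nu> (s n) \<le> 17425 * r"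
      using norm_lower_semicontinuous[OF sJ r] by blast
    have "eventually (\<lambda>T. T \<in> measure_nhd M \<tau> e d) (measure_zero_nhds M \<tau>)"
      unfolding eventually_measure_zero_nhds using e by blast
    then have "\<forall>\<^sub>F m in sequentially. s m \<in> measure_nhd M \<tau> e d"
      using lim unfolding filterlim_iff by blast
    then obtain m where m: "m \<ge> N" "s m \<in> measure_nhd M \<tau> e d"
      unfolding eventually_sequentially by (metis nle_le)
    have "\<nu> (s n) \<le> 17425 * r" using low[OF sJ m(2)] N[OF n m(1)] by simp
    then have "\<nu> (s n) < a" using a(1) by (simp add: r_def)
    then show ?thesis by (rule a(2)[OF sJ])
  qed
  then show "\<forall>\<^sub>F n in sequentially. P (s n)" by (auto simp: eventually_sequentially)
qed

end

theorem proposition10p10: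
  fixes M :: "('h::complex_hilbert_space) op set"
    and \<tau> :: "'h op \<Rightarrow> ennreal"
    and \<nu> :: "'h op \<Rightarrow> real"
  assumes "type_II_infinity_factor M"
    and "faithful_normal_semifinite_trace M \<tau>"
    and "unitarily_invariant_norm M \<nu>"
  shows "\<exists>\<Phi>.
    continuous_map (completion_topology (J_ideal M) (norm_zero_nhds M \<nu>))
                   (completion_topology M (measure_zero_nhds M \<tau>)) \<Phi> \<and>
    inj_on \<Phi> (cauchy_completion (J_ideal M) (norm_zero_nhds M \<nu>)) \<and>
    (\<forall>T\<in>J_ideal M. \<Phi> (completion_embed (J_ideal M) (norm_zero_nhds M \<nu>) T) =
                    completion_embed M (measure_zero_nhds M \<tau>) T) \<and>
    (\<forall>s\<in>cauchy_seqs (J_ideal M) (norm_zero_nhds M \<nu>).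
       limitin (completion_topology M (measure_zero_nhds M \<tau>))
         (\<lambda>n. completion_embed M (measure_zero_nhds M \<tau>) (s n))
         (\<Phi> (cauchy_class (J_ideal M) (norm_zero_nhds M \<nu>) s)) sequentially)"
proof -
  have "id_blinfun \<noteq> (0 :: 'h op)"
  proof
    assume 0: "id_blinfun = (0 :: 'h op)"
    obtain E where "E \<in> finite_projections M" "E \<noteq> 0"
      using assms(1) by (auto simp: type_II_infinity_factor_def)
    moreover have "E = id_blinfun o\<^sub>L E" by simp
    ultimately show False by (simp add: 0 del: compose_id)
  qed
  then interpret normed_ideal M \<tau> \<nu>
    using assms by unfold_locales (auto simp: type_II_infinity_factor_def factor_def)
  show ?thesis
    by (rule completion_map_exists[OF group_nhds_norm group_nhds_measure norm_finer_than_measure])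
       (auto intro: J_in J_diff cauchy_null_in_measure_null_in_norm)
qed

end
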